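(* Let $\varphi:M^2\to N^n$ be a CMC biconservative surface in a Riemannian manifold. Denote by $\lambda_1$ and $\lambda_2$ the principal curvatures of $M$ and by $\mu=\lambda_1-\lambda_2$ their difference. Then, around any non-pseudoumbilical point $p$ there exists a local chart $(U;x,y)$ which is both isothermal and a line of curvature coordinate system for $A_H$. Moreover, on $U$, we have $$\langle\cdot,\cdot\rangle=\frac1\mu\langle\cdot,\cdot\rangle_0,$$ and $A_H$ is given by $$\langle A_H(\cdot),\cdot\rangle=\left(\frac{|H|^2}{\mu}+\frac12\right)dx^2+\left(\frac{|H|^2}{\mu}-\frac12\right)dy^2,$$ or, equivalently, by $$A_H=\left(|H|^2+\frac{\mu}{2}\right)dx\otimes\partial_x+\left(|H|^2-\frac{\mu}{2}\right)dy\otimes\partial_y,$$ where $\langle\cdot,\cdot\rangle_0=dx^2+dy^2$ is the Euclidean metric on $\mathbb{R}^2$. In the particular case $n=3$, $\mu$ satisfies on $U$ $$\mu\,\Delta_0\mu+\left|\operatorname{grad}_0\mu\right|_0^2+2\mu\left(K^N+|H|^2-\frac{\mu^2}{4|H|^2}\right)=0,$$ where $K^N$ is the sectional curvature of $N^3$ along $M^2$.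
   Context: All manifolds, metrics and maps are smooth; all manifolds are connected and oriented. A surface $\varphi:M^2\to N^n$ is a Riemannian (isometric) immersion of a 2-dimensional Riemannian manifold into a Riemannian manifold. $B$ is the second fundamental form, $H=\frac12\operatorname{trace}B$ the mean curvature vector field, and $A_H$ the shape operator in the direction of $H$, with $\langle A_H(X),Y\rangle=\langle B(X,Y),H\rangle$. CMC means that $|H|$ is constant. The stress-bienergy tensor of a surface is $S_2=-2|H|^2I+4A_H$ ($I$ the identity), and $M$ is biconservative if $\operatorname{div}S_2=0$, where $\operatorname{div}T=\sum_i(\nabla_{X_i}T)(X_i)$ for a local orthonormal frame $\{X_i\}$. The principal curvatures $\lambda_1\ge\lambda_2$ of $M$ are the eigenvalue functions of $A_H$; a point is pseudoumbilical if $A_H=|H|^2I$ there (equivalently $\lambda_1=\lambda_2$). A chart is isothermal if the metric is a positive function times $dx^2+dy^2$, and is a line of curvature coordinate system for $A_H$ if $\partial_x,\partial_y$ are eigenvectors of $A_H$ at each point. $\Delta_0$ and $\operatorname{grad}_0$ are the Laplacian and the gradient with respect to $\langle\cdot,\cdot\rangle_0$, with sign convention $\Delta_0=-(\partial_x^2+\partial_y^2)$, and $|\cdot|_0$ is the Euclidean norm. $K^N$ at a point $q\in M$ is the sectional curvature of $N$ on the plane $d\varphi(T_qM)$. *)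

theory Defs
  imports "HOL-Analysis.Analysis" "HOL-Library.Function_Algebras"
begin

text \<open>
  Tangent vectors are functions \<open>('a \<Rightarrow> real) \<Rightarrow> real\<close>; with the pointwise operations they live
  in a real vector space.
\<close>

instantiation "fun" :: (type, real_vector) real_vector
begin

definition scaleR_fun_def: "scaleR r f = (\<lambda>x. r *\<^sub>R f x)"

instance
  by standard (auto simp: scaleR_fun_def fun_eq_iff scaleR_add_right scaleR_add_left)

end

lemma scaleR_fun_apply [simp]: "(r *\<^sub>R f) x = r *\<^sub>R f x"
  by (simp add: scaleR_fun_def)

text \<open>Only meant for open \<open>S\<close>.\<close>

primrec Ck_on :: "nat \<Rightarrow> 'a::real_normed_vector set \<Rightarrow> ('a \<Rightarrow> 'b::real_normed_vector) \<Rightarrow> bool"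
where
  "Ck_on 0 S f \<longleftrightarrow> continuous_on S f"
| "Ck_on (Suc k) S f \<longleftrightarrow> (\<forall>x\<in>S. f differentiable (at x)) \<and>
     (\<forall>v. Ck_on k S (\<lambda>x. frechet_derivative f (at x) v))"

definition smooth_on :: "'a::real_normed_vector set \<Rightarrow> ('a \<Rightarrow> 'b::real_normed_vector) \<Rightarrow> bool"
  where "smooth_on S f \<longleftrightarrow> (\<forall>k. Ck_on k S f)"

text \<open>
  A chart is a pair of a domain and a coordinate map; the coordinate map is a total function
  whose values outside the domain are irrelevant.
\<close>

type_synonym ('a, 'm) chart = "'a set \<times> ('a \<Rightarrow> real^'m)"

type_synonym 'a tvec = "('a \<Rightarrow> real) \<Rightarrow> real"

type_synonym 'a vfield = "'a \<Rightarrow> 'a tvec"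

text \<open>
  \<open>charts\<close> is the maximal smooth atlas and \<open>oriented_charts\<close> a subatlas fixing the orientation.
  \<open>conn M p u Y\<close> is the covariant derivative at \<open>p\<close> of the vector field \<open>Y\<close> in the direction of
  the tangent vector \<open>u\<close> at \<open>p\<close>; it is required below to be the Levi-Civita connection, which
  is uniquely determined by the metric.
\<close>

record ('a, 'm) riem =
  top_space :: "'a topology"
  charts :: "('a, 'm::finite) chart set"
  oriented_charts :: "('a, 'm) chart set"
  metric :: "'a \<Rightarrow> 'a tvec \<Rightarrow> 'a tvec \<Rightarrow> real"
  conn :: "'a \<Rightarrow> 'a tvec \<Rightarrow> 'a vfield \<Rightarrow> 'a tvec"

abbreviation points :: "('a, 'm::finite) riem \<Rightarrow> 'a set"
  where "points M \<equiv> topspace (top_space M)"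

abbreviation chart_img :: "('a, 'm::finite) chart \<Rightarrow> (real^'m) set"
  where "chart_img c \<equiv> snd c ` fst c"

abbreviation chart_inv :: "('a, 'm::finite) chart \<Rightarrow> real^'m \<Rightarrow> 'a"
  where "chart_inv c \<equiv> inv_into (fst c) (snd c)"

definition topological_chart :: "'a topology \<Rightarrow> ('a, 'm::finite) chart \<Rightarrow> bool" where
  "topological_chart X c \<longleftrightarrow> openin X (fst c) \<and> open (chart_img c) \<and>
     homeomorphic_map (subtopology X (fst c)) (top_of_set (chart_img c)) (snd c)"

definition smoothly_compatible :: "('a, 'm::finite) chart \<Rightarrow> ('a, 'm) chart \<Rightarrow> bool" where
  "smoothly_compatible c d \<longleftrightarrow>
     smooth_on (snd c ` (fst c \<inter> fst d)) (snd d \<circ> chart_inv c) \<and>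
     smooth_on (snd d ` (fst c \<inter> fst d)) (snd c \<circ> chart_inv d)"

definition smooth_manifold :: "('a, 'm::finite) riem \<Rightarrow> bool" where
  "smooth_manifold M \<longleftrightarrow>
     Hausdorff_space (top_space M) \<and> second_countable (top_space M) \<and>
     (\<forall>c\<in>charts M. topological_chart (top_space M) c) \<and>
     (\<Union>c\<in>charts M. fst c) = points M \<and>
     (\<forall>c\<in>charts M. \<forall>d\<in>charts M. smoothly_compatible c d) \<and>
     (\<forall>c. topological_chart (top_space M) c \<and> (\<forall>d\<in>charts M. smoothly_compatible c d)
        \<longrightarrow> c \<in> charts M)"

definition oriented :: "('a, 'm::finite) riem \<Rightarrow> bool" where
  "oriented M \<longleftrightarrow> oriented_charts M \<subseteq> charts M \<and> (\<Union>c\<in>oriented_charts M. fst c) = points M \<and>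
     (\<forall>c\<in>oriented_charts M. \<forall>d\<in>oriented_charts M. \<forall>p \<in> fst c \<inter> fst d.
        det (matrix (frechet_derivative (snd d \<circ> chart_inv c) (at (snd c p)))) > 0)"

definition smooth_near :: "('a, 'm::finite) riem \<Rightarrow> 'a \<Rightarrow> ('a \<Rightarrow> real) \<Rightarrow> bool" where
  "smooth_near M p f \<longleftrightarrow>
     (\<exists>c\<in>charts M. p \<in> fst c \<and> smooth_on (chart_img c) (f \<circ> chart_inv c))"

definition smooth_map ::
  "('a, 'm::finite) riem \<Rightarrow> ('b, 'n::finite) riem \<Rightarrow> ('a \<Rightarrow> 'b) \<Rightarrow> bool" where
  "smooth_map M N \<phi> \<longleftrightarrow> (\<forall>p\<in>points M. \<phi> p \<in> points N \<and>
     (\<exists>c\<in>charts M. \<exists>d\<in>charts N. p \<in> fst c \<and> \<phi> ` fst c \<subseteq> fst d \<and>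
        smooth_on (chart_img c) (snd d \<circ> \<phi> \<circ> chart_inv c)))"

text \<open>
  A tangent vector at \<open>p\<close> is a directional derivative acting on the functions that are smooth in
  a neighbourhood of \<open>p\<close>. It is set to \<open>0\<close> on all other functions, so that equality of tangent
  vectors at \<open>p\<close> is equality of functions. \<open>chart_vec M c p \<xi>\<close> is the vector at \<open>p\<close> with components
  \<open>\<xi>\<close> in the chart \<open>c\<close>.
\<close>

definition chart_vec ::
  "('a, 'm::finite) riem \<Rightarrow> ('a, 'm) chart \<Rightarrow> 'a \<Rightarrow> real^'m \<Rightarrow> 'a tvec" where
  "chart_vec M c p \<xi> = (\<lambda>f. if smooth_near M p f
     then frechet_derivative (f \<circ> chart_inv c) (at (snd c p)) \<xi> else 0)"

definition tangent_space :: "('a, 'm::finite) riem \<Rightarrow> 'a \<Rightarrow> 'a tvec set" where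
  "tangent_space M p = {chart_vec M c p \<xi> | c \<xi>. c \<in> charts M \<and> p \<in> fst c}"

text \<open>The coordinate field \<open>\<partial>\<^sub>i\<close> and the value \<open>dx\<^sup>i(u)\<close> of the coordinate differential.\<close>

definition coord_field ::
  "('a, 'm::finite) riem \<Rightarrow> ('a, 'm) chart \<Rightarrow> 'm \<Rightarrow> 'a vfield" where
  "coord_field M c i p = chart_vec M c p (axis i 1)"

definition coord_diff :: "('a, 'm::finite) chart \<Rightarrow> 'm \<Rightarrow> 'a tvec \<Rightarrow> real" where
  "coord_diff c i u = u (\<lambda>q. snd c q $ i)"

definition smooth_field_near :: "('a, 'm::finite) riem \<Rightarrow> 'a \<Rightarrow> 'a vfield \<Rightarrow> bool" where
  "smooth_field_near M p X \<longleftrightarrow> (\<exists>c\<in>charts M. p \<in> fst c \<and>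
     (\<forall>q\<in>fst c. X q \<in> tangent_space M q) \<and>
     (\<forall>i. smooth_on (chart_img c) ((\<lambda>q. coord_diff c i (X q)) \<circ> chart_inv c)))"

definition lie_bracket :: "('a, 'm::finite) riem \<Rightarrow> 'a vfield \<Rightarrow> 'a vfield \<Rightarrow> 'a vfield" where
  "lie_bracket M X Y p = (\<lambda>f. if smooth_near M p f
     then X p (\<lambda>q. Y q f) - Y p (\<lambda>q. X q f) else 0)"

definition differential ::
  "('a, 'm::finite) riem \<Rightarrow> ('b, 'n::finite) riem \<Rightarrow> ('a \<Rightarrow> 'b) \<Rightarrow> 'a \<Rightarrow> 'a tvec \<Rightarrow> 'b tvec" where
  "differential M N \<phi> p u = (\<lambda>f. if smooth_near N (\<phi> p) f then u (f \<circ> \<phi>) else 0)"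

definition riemannian_metric :: "('a, 'm::finite) riem \<Rightarrow> bool" where
  "riemannian_metric M \<longleftrightarrow>
     (\<forall>p\<in>points M.
        (\<forall>u\<in>tangent_space M p. \<forall>v\<in>tangent_space M p. metric M p u v = metric M p v u) \<and>
        (\<forall>u\<in>tangent_space M p. \<forall>v\<in>tangent_space M p. \<forall>w\<in>tangent_space M p. \<forall>a b.
           metric M p (a *\<^sub>R u + b *\<^sub>R v) w = a * metric M p u w + b * metric M p v w) \<and>
        (\<forall>u\<in>tangent_space M p. u \<noteq> 0 \<longrightarrow> metric M p u u > 0)) \<and>
     (\<forall>c\<in>charts M. \<forall>i j. smooth_on (chart_img c)
        ((\<lambda>q. metric M q (coord_field M c i q) (coord_field M c j q)) \<circ> chart_inv c))"

text \<open>
  The vector fields are only required to be smooth near the point of differentiation. Locality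
  of the connection follows from the Leibniz rule.
\<close>

definition levi_civita :: "('a, 'm::finite) riem \<Rightarrow> bool" where
  "levi_civita M \<longleftrightarrow> (\<forall>p\<in>points M.
     (\<forall>u\<in>tangent_space M p. \<forall>Y. smooth_field_near M p Y \<longrightarrow> conn M p u Y \<in> tangent_space M p) \<and>
     (\<forall>u\<in>tangent_space M p. \<forall>v\<in>tangent_space M p. \<forall>a b Y. smooth_field_near M p Y \<longrightarrow>
        conn M p (a *\<^sub>R u + b *\<^sub>R v) Y = a *\<^sub>R conn M p u Y + b *\<^sub>R conn M p v Y) \<and>
     (\<forall>u\<in>tangent_space M p. \<forall>Y Z. smooth_field_near M p Y \<longrightarrow> smooth_field_near M p Z \<longrightarrow>
        conn M p u (\<lambda>q. Y q + Z q) = conn M p u Y + conn M p u Z) \<and>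
     (\<forall>u\<in>tangent_space M p. \<forall>f Y. smooth_near M p f \<longrightarrow> smooth_field_near M p Y \<longrightarrow>
        conn M p u (\<lambda>q. f q *\<^sub>R Y q) = u f *\<^sub>R Y p + f p *\<^sub>R conn M p u Y) \<and>
     (\<forall>X Y. smooth_field_near M p X \<longrightarrow> smooth_field_near M p Y \<longrightarrow>
        smooth_field_near M p (\<lambda>q. conn M q (X q) Y)) \<and>
     (\<forall>u\<in>tangent_space M p. \<forall>Y Z. smooth_field_near M p Y \<longrightarrow> smooth_field_near M p Z \<longrightarrow>
        u (\<lambda>q. metric M q (Y q) (Z q)) =
          metric M p (conn M p u Y) (Z p) + metric M p (Y p) (conn M p u Z)) \<and>
     (\<forall>X Y. smooth_field_near M p X \<longrightarrow> smooth_field_near M p Y \<longrightarrow>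
        conn M p (X p) Y - conn M p (Y p) X = lie_bracket M X Y p))"

definition riemannian_manifold :: "('a, 'm::finite) riem \<Rightarrow> bool" where
  "riemannian_manifold M \<longleftrightarrow> smooth_manifold M \<and> connected_space (top_space M) \<and> oriented M \<and>
     riemannian_metric M \<and> levi_civita M"

definition orthonormal_frame :: "('a, 'm::finite) riem \<Rightarrow> 'a \<Rightarrow> ('m \<Rightarrow> 'a tvec) \<Rightarrow> bool" where
  "orthonormal_frame M p e \<longleftrightarrow> (\<forall>i. e i \<in> tangent_space M p) \<and>
     (\<forall>i j. metric M p (e i) (e j) = (if i = j then 1 else 0))"

text \<open>
  In the definitions by \<open>THE w. \<forall>\<dots>\<close>, here and below, the quantifier ranges over the auxiliary
  choices (local extensions of tangent vectors, charts, orthonormal frames) of which the value is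
  independent.
\<close>

definition riemann_curvature ::
  "('a, 'm::finite) riem \<Rightarrow> 'a \<Rightarrow> 'a tvec \<Rightarrow> 'a tvec \<Rightarrow> 'a tvec \<Rightarrow> 'a tvec" where
  "riemann_curvature M p u v w = (THE z. \<forall>X Y Z.
     smooth_field_near M p X \<and> smooth_field_near M p Y \<and> smooth_field_near M p Z \<and>
     X p = u \<and> Y p = v \<and> Z p = w \<longrightarrow>
     z = conn M p (X p) (\<lambda>q. conn M q (Y q) Z) - conn M p (Y p) (\<lambda>q. conn M q (X q) Z)
         - conn M p (lie_bracket M X Y p) Z)"

definition sectional_curvature :: "('a, 'm::finite) riem \<Rightarrow> 'a \<Rightarrow> 'a tvec set \<Rightarrow> real" where
  "sectional_curvature M p P = (THE k. \<forall>u v. u \<noteq> v \<and> independent {u, v} \<and> span {u, v} = P \<longrightarrow>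
     k = metric M p (riemann_curvature M p u v v) u /
         (metric M p u u * metric M p v v - (metric M p u v)\<^sup>2))"

text \<open>\<open>(\<nabla>\<^sub>u T)(v)\<close> for a field \<open>T\<close> of endomorphisms of the tangent spaces.\<close>

definition conn_endo ::
  "('a, 'm::finite) riem \<Rightarrow> ('a \<Rightarrow> 'a tvec \<Rightarrow> 'a tvec) \<Rightarrow> 'a \<Rightarrow> 'a tvec \<Rightarrow> 'a tvec \<Rightarrow> 'a tvec" where
  "conn_endo M T p u v = (THE w. \<forall>Y. smooth_field_near M p Y \<and> Y p = v \<longrightarrow>
     w = conn M p u (\<lambda>q. T q (Y q)) - T p (conn M p u Y))"

definition divergence ::
  "('a, 'm::finite) riem \<Rightarrow> ('a \<Rightarrow> 'a tvec \<Rightarrow> 'a tvec) \<Rightarrow> 'a vfield" where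
  "divergence M T p = (THE w. \<forall>e. orthonormal_frame M p e \<longrightarrow>
     w = (\<Sum>i\<in>UNIV. conn_endo M T p (e i) (e i)))"

definition isometric_immersion ::
  "('a, 'm::finite) riem \<Rightarrow> ('b, 'n::finite) riem \<Rightarrow> ('a \<Rightarrow> 'b) \<Rightarrow> bool" where
  "isometric_immersion M N \<phi> \<longleftrightarrow> smooth_map M N \<phi> \<and>
     (\<forall>p\<in>points M. inj_on (differential M N \<phi> p) (tangent_space M p) \<and>
        (\<forall>u\<in>tangent_space M p. \<forall>v\<in>tangent_space M p.
           metric N (\<phi> p) (differential M N \<phi> p u) (differential M N \<phi> p v) = metric M p u v))"

definition surface ::
  "('a, 2) riem \<Rightarrow> ('b, 'n::finite) riem \<Rightarrow> ('a \<Rightarrow> 'b) \<Rightarrow> bool" where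
  "surface M N \<phi> \<longleftrightarrow> riemannian_manifold M \<and> riemannian_manifold N \<and> isometric_immersion M N \<phi>"

text \<open>
  The pull-back connection on \<open>\<phi>\<^sup>*TN\<close>, applied to a field \<open>V\<close> along \<open>\<phi>\<close>, expressed in the
  coordinate frame of a chart of \<open>N\<close>.
\<close>

definition conn_along ::
  "('a, 'm::finite) riem \<Rightarrow> ('b, 'n::finite) riem \<Rightarrow> ('a \<Rightarrow> 'b) \<Rightarrow> 'a \<Rightarrow> 'a tvec \<Rightarrow> ('a \<Rightarrow> 'b tvec)
     \<Rightarrow> 'b tvec" where
  "conn_along M N \<phi> p u V = (THE w. \<forall>d\<in>charts N. \<phi> p \<in> fst d \<longrightarrow>
     w = (\<Sum>a\<in>UNIV. u (\<lambda>q. coord_diff d a (V q)) *\<^sub>R coord_field N d a (\<phi> p)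
            + coord_diff d a (V p) *\<^sub>R conn N (\<phi> p) (differential M N \<phi> p u) (coord_field N d a)))"

text \<open>Gauss formula: \<open>B(X,Y) = \<nabla>\<^sup>N\<^sub>X d\<phi>(Y) - d\<phi>(\<nabla>\<^sub>X Y)\<close>.\<close>

definition second_fundamental_form ::
  "('a, 'm::finite) riem \<Rightarrow> ('b, 'n::finite) riem \<Rightarrow> ('a \<Rightarrow> 'b) \<Rightarrow> 'a \<Rightarrow> 'a tvec \<Rightarrow> 'a tvec
     \<Rightarrow> 'b tvec" where
  "second_fundamental_form M N \<phi> p u v = (THE w. \<forall>Y. smooth_field_near M p Y \<and> Y p = v \<longrightarrow>
     w = conn_along M N \<phi> p u (\<lambda>q. differential M N \<phi> q (Y q))
         - differential M N \<phi> p (conn M p u Y))"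

definition mean_curvature_vector ::
  "('a, 2) riem \<Rightarrow> ('b, 'n::finite) riem \<Rightarrow> ('a \<Rightarrow> 'b) \<Rightarrow> 'a \<Rightarrow> 'b tvec" where
  "mean_curvature_vector M N \<phi> p = (THE w. \<forall>e. orthonormal_frame M p e \<longrightarrow>
     w = (1/2) *\<^sub>R (\<Sum>i\<in>UNIV. second_fundamental_form M N \<phi> p (e i) (e i)))"

definition mean_curvature ::
  "('a, 2) riem \<Rightarrow> ('b, 'n::finite) riem \<Rightarrow> ('a \<Rightarrow> 'b) \<Rightarrow> 'a \<Rightarrow> real" where
  "mean_curvature M N \<phi> p = sqrt (metric N (\<phi> p)
     (mean_curvature_vector M N \<phi> p) (mean_curvature_vector M N \<phi> p))"

definition shape_H ::
  "('a, 2) riem \<Rightarrow> ('b, 'n::finite) riem \<Rightarrow> ('a \<Rightarrow> 'b) \<Rightarrow> 'a \<Rightarrow> 'a tvec \<Rightarrow> 'a tvec" where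
  "shape_H M N \<phi> p u = (THE w. w \<in> tangent_space M p \<and> (\<forall>v\<in>tangent_space M p.
     metric M p w v = metric N (\<phi> p)
       (second_fundamental_form M N \<phi> p u v) (mean_curvature_vector M N \<phi> p)))"

definition CMC :: "('a, 2) riem \<Rightarrow> ('b, 'n::finite) riem \<Rightarrow> ('a \<Rightarrow> 'b) \<Rightarrow> bool" where
  "CMC M N \<phi> \<longleftrightarrow> mean_curvature M N \<phi> constant_on points M"

definition stress_bienergy ::
  "('a, 2) riem \<Rightarrow> ('b, 'n::finite) riem \<Rightarrow> ('a \<Rightarrow> 'b) \<Rightarrow> 'a \<Rightarrow> 'a tvec \<Rightarrow> 'a tvec" where
  "stress_bienergy M N \<phi> p u =
     (-2 * (mean_curvature M N \<phi> p)\<^sup>2) *\<^sub>R u + 4 *\<^sub>R shape_H M N \<phi> p u"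

definition biconservative :: "('a, 2) riem \<Rightarrow> ('b, 'n::finite) riem \<Rightarrow> ('a \<Rightarrow> 'b) \<Rightarrow> bool" where
  "biconservative M N \<phi> \<longleftrightarrow> (\<forall>p\<in>points M. divergence M (stress_bienergy M N \<phi>) p = 0)"

definition eigenvector_on :: "'v::real_vector set \<Rightarrow> ('v \<Rightarrow> 'v) \<Rightarrow> real \<Rightarrow> 'v \<Rightarrow> bool" where
  "eigenvector_on T A l u \<longleftrightarrow> u \<in> T \<and> u \<noteq> 0 \<and> A u = l *\<^sub>R u"

definition principal_curvatures ::
  "('a, 2) riem \<Rightarrow> ('b, 'n::finite) riem \<Rightarrow> ('a \<Rightarrow> 'b) \<Rightarrow> 'a \<Rightarrow> real set" where
  "principal_curvatures M N \<phi> p =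
     {l. \<exists>u. eigenvector_on (tangent_space M p) (shape_H M N \<phi> p) l u}"

definition lambda1 ::
  "('a, 2) riem \<Rightarrow> ('b, 'n::finite) riem \<Rightarrow> ('a \<Rightarrow> 'b) \<Rightarrow> 'a \<Rightarrow> real" where
  "lambda1 M N \<phi> p = Max (principal_curvatures M N \<phi> p)"

definition lambda2 ::
  "('a, 2) riem \<Rightarrow> ('b, 'n::finite) riem \<Rightarrow> ('a \<Rightarrow> 'b) \<Rightarrow> 'a \<Rightarrow> real" where
  "lambda2 M N \<phi> p = Min (principal_curvatures M N \<phi> p)"

definition pseudoumbilical_at ::
  "('a, 2) riem \<Rightarrow> ('b, 'n::finite) riem \<Rightarrow> ('a \<Rightarrow> 'b) \<Rightarrow> 'a \<Rightarrow> bool" where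
  "pseudoumbilical_at M N \<phi> p \<longleftrightarrow>
     (\<forall>u\<in>tangent_space M p. shape_H M N \<phi> p u = (mean_curvature M N \<phi> p)\<^sup>2 *\<^sub>R u)"

definition flat_metric :: "('a, 2) chart \<Rightarrow> 'a tvec \<Rightarrow> 'a tvec \<Rightarrow> real" where
  "flat_metric c u v =
     coord_diff c 1 u * coord_diff c 1 v + coord_diff c 2 u * coord_diff c 2 v"

definition isothermal :: "('a, 2) riem \<Rightarrow> ('a, 2) chart \<Rightarrow> bool" where
  "isothermal M c \<longleftrightarrow> (\<exists>\<rho>. \<forall>q\<in>fst c. \<rho> q > 0 \<and>
     (\<forall>u\<in>tangent_space M q. \<forall>v\<in>tangent_space M q.
        metric M q u v = \<rho> q * flat_metric c u v))"

definition line_of_curvature_chart ::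
  "('a, 2) riem \<Rightarrow> ('b, 'n::finite) riem \<Rightarrow> ('a \<Rightarrow> 'b) \<Rightarrow> ('a, 2) chart \<Rightarrow> bool" where
  "line_of_curvature_chart M N \<phi> c \<longleftrightarrow> (\<forall>q\<in>fst c. \<forall>i. \<exists>l.
     eigenvector_on (tangent_space M q) (shape_H M N \<phi> q) l (coord_field M c i q))"

definition grad0 :: "('a, 2) riem \<Rightarrow> ('a, 2) chart \<Rightarrow> ('a \<Rightarrow> real) \<Rightarrow> 'a \<Rightarrow> real^2" where
  "grad0 M c f q = (\<chi> i. coord_field M c i q f)"

definition laplacian0 :: "('a, 2) riem \<Rightarrow> ('a, 2) chart \<Rightarrow> ('a \<Rightarrow> real) \<Rightarrow> 'a \<Rightarrow> real" where
  "laplacian0 M c f q = - (\<Sum>i\<in>UNIV. coord_field M c i q (\<lambda>r. coord_field M c i r f))"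

end

theory Submission
  imports Defs
begin

text \<open>
  Let \<open>P = A\<^sub>H - |H|\<^sup>2 I\<close>, a symmetric traceless field with eigenvalues \<open>\<plusminus> m\<close>, \<open>\<mu> = 2 m\<close>. Since \<open>|H|\<close> is
  constant, biconservativity is the Codazzi equation \<open>div P = 0\<close>. If \<open>X\<close>, \<open>Y\<close> are eigenfields of \<open>P\<close> of
  length \<open>1 / \<surd>\<mu>\<close>, this equation says precisely that \<open>[X, Y] = 0\<close>; so the dual coframe is closed, its
  potentials form a local diffeomorphism, and in the resulting chart \<open>X = \<partial>\<^sub>x\<close>, \<open>Y = \<partial>\<^sub>y\<close>. When \<open>n = 3\<close>, \<open>H\<close>
  spans the normal line because it is nonzero (a point with \<open>H = 0\<close> is pseudoumbilical), and the Gauss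
  equation follows by differentiating \<open>\<langle>\<phi>\<^sub>i, \<phi>\<^sub>j\<rangle> = \<delta>\<^sub>i\<^sub>j / \<mu>\<close> twice along \<open>\<phi>\<close>, without computing the curvature
  of \<open>M\<close>.
\<close>

subsection \<open>Smooth functions\<close>

text \<open>A traceless symmetric divergence-free tensor on a surface is the real part of a
  holomorphic quadratic differential, and the chart sought integrates a square root of that
  differential. This is the origin of the length \<open>1 / sqrt \<mu>\<close>: it gives
  \<open>g (P X) X = m / \<mu> = 1/2\<close>, so the quadratic form of \<open>P\<close> becomes the
  constant form \<open>(dx^2 - dy^2) / 2\<close>, and isothermal coordinates are an outcome of the
  eigenframe itself. The obstacle is the shape of the geometric notions. Curvature, second
  fundamental form, mean curvature vector and divergence are definite descriptions ranging over all
  extensions, charts or frames. Each is evaluated once in a chart, by showing that all choices give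
  the same value and that some choice exists; afterwards the geometry takes place between open sets
  of Euclidean spaces, with \<open>gmet\<close>, \<open>christoffel\<close>, \<open>curv\<close>,
  \<open>B\<close> and \<open>S\<close> as explicit smooth families.\<close>

abbreviation dder :: "('a::real_normed_vector \<Rightarrow> 'b::real_normed_vector) \<Rightarrow> 'a \<Rightarrow> 'a \<Rightarrow> 'b"
  where "dder f x \<equiv> frechet_derivative f (at x)"

lemma dder_works: "f differentiable (at x) \<Longrightarrow> (f has_derivative dder f x) (at x)"
  using frechet_derivative_works by blast

lemma dder_eqI: "(f has_derivative f') (at x) \<Longrightarrow> dder f x = f'"
  by (metis frechet_derivative_at)

lemma has_derivative_cong_open:
  assumes "open S" "x \<in> S" "\<And>y. y \<in> S \<Longrightarrow> f y = g y"
  shows "(f has_derivative f') (at x) \<longleftrightarrow> (g has_derivative f') (at x)"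
  using assms has_derivative_transform_within_open[of f f' x UNIV S g]
    has_derivative_transform_within_open[of g f' x UNIV S f] by auto

lemma dder_cong_open:
  assumes "open S" "x \<in> S" "\<And>y. y \<in> S \<Longrightarrow> f y = g y"
  shows "dder f x = dder g x"
  unfolding frechet_derivative_def using has_derivative_cong_open[OF assms] by simp

lemma differentiable_cong_open:
  assumes "open S" "x \<in> S" "\<And>y. y \<in> S \<Longrightarrow> f y = g y"
  shows "f differentiable (at x) \<longleftrightarrow> g differentiable (at x)"
  unfolding differentiable_def using has_derivative_cong_open[OF assms] by simp

lemma dder_linear: "f differentiable (at x) \<Longrightarrow> linear (dder f x)"
  by (rule linear_frechet_derivative)

section \<open>Finite differentiability classes on open sets\<close>

lemma Ck_on_cong:
  assumes "open S" "\<And>x. x \<in> S \<Longrightarrow> f x = g x"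
  shows "Ck_on k S f \<longleftrightarrow> Ck_on k S g"
  using assms(2)
proof (induction k arbitrary: f g)
  case 0
  then show ?case by (simp cong: continuous_on_cong)
next
  case (Suc k)
  have "dder f x v = dder g x v" if "x \<in> S" for x v
    using dder_cong_open[OF assms(1) that, of f g] Suc.prems by simp
  then have "Ck_on k S (\<lambda>x. dder f x v) \<longleftrightarrow> Ck_on k S (\<lambda>x. dder g x v)" for v
    by (intro Suc.IH)
  then show ?case
    using differentiable_cong_open[OF assms(1), of _ f g] Suc.prems by simp
qed

lemma Ck_on_mono: "Ck_on k S f \<Longrightarrow> T \<subseteq> S \<Longrightarrow> Ck_on k T f"
  by (induction k arbitrary: f) (auto intro: continuous_on_subset)

text \<open>The recursive clause asks only differentiability of \<open>f\<close> itself; the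
  continuity required at order 0 has to be extracted from it.\<close>

lemma Ck_on_SucD: "Ck_on (Suc k) S f \<Longrightarrow> Ck_on k S f"
proof (induction k arbitrary: f)
  case 0
  then show ?case
    by (auto intro!: continuous_at_imp_continuous_on differentiable_imp_continuous_within)
next
  case (Suc k)
  then show ?case by simp
qed

lemma Ck_on_local:
  assumes "\<And>x. x \<in> S \<Longrightarrow> \<exists>W. open W \<and> x \<in> W \<and> Ck_on k W f"
  shows "Ck_on k S f"
  using assms
proof (induction k arbitrary: f)
  case 0
  show ?case
    unfolding Ck_on.simps
  proof (rule continuous_at_imp_continuous_on, rule ballI)
    fix x assume "x \<in> S"
    from 0[OF this] show "isCont f x" by (auto simp: continuous_on_eq_continuous_at)
  qed
next
  case (Suc k)
  have "Ck_on k S (\<lambda>x. dder f x v)" for v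
  proof (rule Suc.IH)
    fix x assume "x \<in> S"
    from Suc.prems[OF this] show "\<exists>W. open W \<and> x \<in> W \<and> Ck_on k W (\<lambda>x. dder f x v)" by auto
  qed
  moreover have "f differentiable (at x)" if "x \<in> S" for x
    using Suc.prems[OF that] by auto
  ultimately show ?case by simp
qed

lemma Ck_on_const: "Ck_on k S (\<lambda>x. c)"
  by (induction k arbitrary: c) auto

lemma Ck_on_bounded_linear:
  assumes "open S" "bounded_linear L" "Ck_on k S f"
  shows "Ck_on k S (\<lambda>x. L (f x))"
  using assms(3)
proof (induction k arbitrary: f)
  case 0
  then show ?case using assms(2) by (simp add: bounded_linear.continuous_on)
next
  case (Suc k)
  have der: "((\<lambda>x. L (f x)) has_derivative (\<lambda>v. L (dder f x v))) (at x)" if "x \<in> S" for x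
    using Suc.prems that by (intro bounded_linear.has_derivative[OF assms(2)] dder_works) simp
  have "Ck_on k S (\<lambda>x. dder (\<lambda>x. L (f x)) x v) \<longleftrightarrow> Ck_on k S (\<lambda>x. L (dder f x v))" for v
    by (rule Ck_on_cong[OF assms(1)]) (simp add: dder_eqI[OF der])
  then show ?case using Suc Derivative.differentiableI[OF der] by simp
qed

lemma Ck_on_add:
  assumes "open S" "Ck_on k S f" "Ck_on k S g"
  shows "Ck_on k S (\<lambda>x. f x + g x)"
  using assms(2,3)
proof (induction k arbitrary: f g)
  case 0
  then show ?case by (simp add: continuous_on_add)
next
  case (Suc k)
  have der: "((\<lambda>x. f x + g x) has_derivative (\<lambda>v. dder f x v + dder g x v)) (at x)" if "x \<in> S" for x
    using Suc.prems that by (intro has_derivative_add dder_works) auto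
  have "Ck_on k S (\<lambda>x. dder (\<lambda>x. f x + g x) x v) \<longleftrightarrow> Ck_on k S (\<lambda>x. dder f x v + dder g x v)" for v
    by (rule Ck_on_cong[OF assms(1)]) (simp add: dder_eqI[OF der])
  then show ?case using Suc Derivative.differentiableI[OF der] by simp
qed

text \<open>A single Leibniz induction that covers products, scalar multiples and inner
  products.\<close>

lemma Ck_on_bilinear:
  assumes "open S" "bounded_bilinear B" "Ck_on k S f" "Ck_on k S g"
  shows "Ck_on k S (\<lambda>x. B (f x) (g x))"
  using assms(3,4)
proof (induction k arbitrary: f g)
  case 0
  then show ?case using assms(2) by (simp add: bounded_bilinear.continuous_on)
next
  case (Suc k)
  have der: "((\<lambda>x. B (f x) (g x)) has_derivative (\<lambda>v. B (f x) (dder g x v) + B (dder f x v) (g x))) (at x)"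
    if "x \<in> S" for x
    using Suc.prems that by (intro bounded_bilinear.FDERIV[OF assms(2)] dder_works) auto
  have "Ck_on k S (\<lambda>x. dder (\<lambda>x. B (f x) (g x)) x v) \<longleftrightarrow>
      Ck_on k S (\<lambda>x. B (f x) (dder g x v) + B (dder f x v) (g x))" for v
    by (rule Ck_on_cong[OF assms(1)]) (simp add: dder_eqI[OF der])
  moreover have "Ck_on k S (\<lambda>x. B (f x) (dder g x v) + B (dder f x v) (g x))" for v
    using Suc.prems Ck_on_SucD[OF Suc.prems(1)] Ck_on_SucD[OF Suc.prems(2)]
    by (intro Ck_on_add[OF assms(1)] Suc.IH) auto
  ultimately show ?case using Derivative.differentiableI[OF der] by simp
qed

lemma Ck_on_sum:
  assumes "open S" "\<And>i. i \<in> I \<Longrightarrow> Ck_on k S (f i)"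
  shows "Ck_on k S (\<lambda>x. \<Sum>i\<in>I. f i x)"
  using assms(2)
  by (induction I rule: infinite_finite_induct)
    (auto simp: Ck_on_const intro: Ck_on_add[OF assms(1)])

text \<open>In the chain rule both the base point and the direction of \<open>dder f\<close> vary
  with \<open>x\<close>; expanding the direction in the basis leaves sums of products to which the
  induction applies. The asymmetry, \<open>g\<close> of finite class and \<open>f\<close> smooth, is
  what the regularity of an inverse function calls for: there \<open>g\<close> is the inverse, known
  only up to order \<open>k\<close>.\<close>

lemma Ck_on_compose:
  fixes g :: "'a::real_normed_vector \<Rightarrow> 'b::euclidean_space"
  assumes "open S" "open T" "g ` S \<subseteq> T" "Ck_on k S g" "smooth_on T f"
  shows "Ck_on k S (\<lambda>x. f (g x))"
  using assms(4,5)
proof (induction k arbitrary: f)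
  case 0
  have "continuous_on T f" using 0(2) by (metis smooth_on_def Ck_on.simps(1))
  then show ?case using 0(1) assms(3) by (auto intro: continuous_on_compose2)
next
  case (Suc k)
  have fT: "f differentiable (at y)" if "y \<in> T" for y
    using Suc.prems(2) that by (simp only: smooth_on_def) (metis Ck_on.simps(2))
  have smf: "smooth_on T (\<lambda>y. dder f y v)" for v
    using Suc.prems(2) by (simp only: smooth_on_def) (metis Ck_on.simps(2))
  have der: "((\<lambda>x. f (g x)) has_derivative (\<lambda>v. dder f (g x) (dder g x v))) (at x)" if "x \<in> S" for x
    using Suc.prems that assms(3) fT
    by (intro has_derivative_compose[of g _ x UNIV f, simplified] dder_works) auto
  have eq: "dder (\<lambda>x. f (g x)) x v = (\<Sum>b\<in>Basis. (dder g x v \<bullet> b) *\<^sub>R dder f (g x) b)"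
    if "x \<in> S" for x v
  proof -
    interpret linear "dder f (g x)"
      using fT that assms(3) by (auto intro: dder_linear)
    have "dder f (g x) (dder g x v) = dder f (g x) (\<Sum>b\<in>Basis. (dder g x v \<bullet> b) *\<^sub>R b)"
      by (simp add: euclidean_representation)
    then show ?thesis by (simp add: dder_eqI[OF der[OF that]] sum scale)
  qed
  have "Ck_on k S (\<lambda>x. dder (\<lambda>x. f (g x)) x v) \<longleftrightarrow>
      Ck_on k S (\<lambda>x. \<Sum>b\<in>Basis. (dder g x v \<bullet> b) *\<^sub>R dder f (g x) b)" for v
    by (rule Ck_on_cong[OF assms(1)]) (rule eq)
  moreover have "Ck_on k S (\<lambda>x. \<Sum>b\<in>Basis. (dder g x v \<bullet> b) *\<^sub>R dder f (g x) b)" for v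
    using Suc.prems(1) Ck_on_SucD[OF Suc.prems(1)]
    by (intro Ck_on_sum[OF assms(1)] Ck_on_bilinear[OF assms(1) bounded_bilinear_scaleR]
        Ck_on_bounded_linear[OF assms(1) bounded_linear_inner_left] Suc.IH smf) auto
  ultimately show ?case using Derivative.differentiableI[OF der] by simp
qed

section \<open>Smooth functions on open sets\<close>

lemma smooth_on_cong:
  "open S \<Longrightarrow> (\<And>x. x \<in> S \<Longrightarrow> f x = g x) \<Longrightarrow> smooth_on S f \<longleftrightarrow> smooth_on S g"
  unfolding smooth_on_def using Ck_on_cong by blast

lemma smooth_on_mono: "smooth_on S f \<Longrightarrow> T \<subseteq> S \<Longrightarrow> smooth_on T f"
  unfolding smooth_on_def using Ck_on_mono by blast

lemma smooth_on_local:
  assumes "\<And>x. x \<in> S \<Longrightarrow> \<exists>W. open W \<and> x \<in> W \<and> smooth_on W f"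
  shows "smooth_on S f"
  unfolding smooth_on_def
proof
  show "Ck_on k S f" for k
    by (rule Ck_on_local) (meson assms smooth_on_def)
qed

lemma smooth_on_differentiable: "smooth_on S f \<Longrightarrow> x \<in> S \<Longrightarrow> f differentiable (at x)"
  by (simp only: smooth_on_def) (metis Ck_on.simps(2))

lemma smooth_on_has_derivative: "smooth_on S f \<Longrightarrow> x \<in> S \<Longrightarrow> (f has_derivative dder f x) (at x)"
  by (simp add: smooth_on_differentiable dder_works)

lemma smooth_on_linear_dder: "smooth_on S f \<Longrightarrow> x \<in> S \<Longrightarrow> linear (dder f x)"
  by (simp add: smooth_on_differentiable dder_linear)

lemma smooth_on_continuous_on: "smooth_on S f \<Longrightarrow> continuous_on S f"
  by (metis smooth_on_def Ck_on.simps(1))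

lemma smooth_on_dder: "smooth_on S f \<Longrightarrow> smooth_on S (\<lambda>x. dder f x v)"
  by (simp only: smooth_on_def) (metis Ck_on.simps(2))

text \<open>Smooth derivatives give one order more than is asked, and dropping it supplies the
  continuity of \<open>f\<close>.\<close>

lemma smooth_on_dderI:
  assumes "\<And>x. x \<in> S \<Longrightarrow> f differentiable (at x)" "\<And>v. smooth_on S (\<lambda>x. dder f x v)"
  shows "smooth_on S f"
  unfolding smooth_on_def
proof
  fix k
  show "Ck_on k S f"
    by (rule Ck_on_SucD) (use assms in \<open>simp add: smooth_on_def\<close>)
qed

lemma smooth_on_const: "smooth_on S (\<lambda>x. c)"
  by (simp add: smooth_on_def Ck_on_const)

lemma smooth_on_bounded_linear:
  "open S \<Longrightarrow> bounded_linear L \<Longrightarrow> smooth_on S f \<Longrightarrow> smooth_on S (\<lambda>x. L (f x))"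
  by (simp add: smooth_on_def Ck_on_bounded_linear)

lemma smooth_on_id: "smooth_on S (\<lambda>x. x)"
  by (rule smooth_on_dderI) (simp_all add: smooth_on_const)

lemma smooth_on_bilinear:
  "open S \<Longrightarrow> bounded_bilinear B \<Longrightarrow> smooth_on S f \<Longrightarrow> smooth_on S g \<Longrightarrow>
    smooth_on S (\<lambda>x. B (f x) (g x))"
  by (simp add: smooth_on_def Ck_on_bilinear)

lemma smooth_on_add:
  "open S \<Longrightarrow> smooth_on S f \<Longrightarrow> smooth_on S g \<Longrightarrow> smooth_on S (\<lambda>x. f x + g x)"
  by (simp add: smooth_on_def Ck_on_add)

lemma smooth_on_sum:
  "open S \<Longrightarrow> (\<And>i. i \<in> I \<Longrightarrow> smooth_on S (f i)) \<Longrightarrow> smooth_on S (\<lambda>x. \<Sum>i\<in>I. f i x)"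
  by (simp add: smooth_on_def Ck_on_sum)

lemma smooth_on_uminus: "open S \<Longrightarrow> smooth_on S f \<Longrightarrow> smooth_on S (\<lambda>x. - f x)"
  using smooth_on_bounded_linear[OF _ bounded_linear_minus[OF bounded_linear_ident]] .

lemma smooth_on_diff:
  "open S \<Longrightarrow> smooth_on S f \<Longrightarrow> smooth_on S g \<Longrightarrow> smooth_on S (\<lambda>x. f x - g x)"
  using smooth_on_add[of S f "\<lambda>x. - g x"] by (simp add: smooth_on_uminus)

lemma smooth_on_scaleR:
  "open S \<Longrightarrow> smooth_on S f \<Longrightarrow> smooth_on S g \<Longrightarrow> smooth_on S (\<lambda>x. f x *\<^sub>R g x)"
  using smooth_on_bilinear[OF _ bounded_bilinear_scaleR] .

lemma smooth_on_mult:
  fixes f g :: "'a::real_normed_vector \<Rightarrow> real"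
  shows "open S \<Longrightarrow> smooth_on S f \<Longrightarrow> smooth_on S g \<Longrightarrow> smooth_on S (\<lambda>x. f x * g x)"
  using smooth_on_bilinear[OF _ bounded_bilinear_mult] .

lemma smooth_on_power2:
  fixes f :: "'a::real_normed_vector \<Rightarrow> real"
  shows "open S \<Longrightarrow> smooth_on S f \<Longrightarrow> smooth_on S (\<lambda>x. (f x)\<^sup>2)"
  by (simp add: power2_eq_square smooth_on_mult)

lemma smooth_on_inner:
  "open S \<Longrightarrow> smooth_on S f \<Longrightarrow> smooth_on S g \<Longrightarrow> smooth_on S (\<lambda>x. f x \<bullet> g x)"
  using smooth_on_bilinear[OF _ bounded_bilinear_inner] .

lemma smooth_on_vec_nth: "open S \<Longrightarrow> smooth_on S f \<Longrightarrow> smooth_on S (\<lambda>x. f x $ i)"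
  using smooth_on_bounded_linear[OF _ bounded_linear_vec_nth] .

lemma smooth_on_vec_iff:
  fixes f :: "'a::real_normed_vector \<Rightarrow> real^'m"
  assumes "open S"
  shows "smooth_on S f \<longleftrightarrow> (\<forall>i. smooth_on S (\<lambda>x. f x $ i))"
proof
  assume *: "\<forall>i. smooth_on S (\<lambda>x. f x $ i)"
  have "smooth_on S (\<lambda>x. \<Sum>i\<in>UNIV. (f x $ i) *\<^sub>R (axis i 1 :: real^'m))"
    using * by (intro smooth_on_sum assms smooth_on_scaleR smooth_on_const) auto
  moreover have "(\<Sum>i\<in>UNIV. (f x $ i) *\<^sub>R (axis i 1 :: real^'m)) = f x" for x
    using basis_expansion[of "f x"] by (simp add: scalar_mult_eq_scaleR)
  ultimately show "smooth_on S f" by (simp only:)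
qed (auto simp: assms smooth_on_vec_nth)

lemma smooth_on_compose:
  fixes g :: "'a::real_normed_vector \<Rightarrow> 'b::euclidean_space"
  assumes "open S" "open T" "g ` S \<subseteq> T" "smooth_on S g" "smooth_on T f"
  shows "smooth_on S (\<lambda>x. f (g x))"
  unfolding smooth_on_def using assms Ck_on_compose[of S T g] by (auto simp: smooth_on_def[of S g])

lemma dder_compose:
  assumes "smooth_on S g" "x \<in> S" "smooth_on T f" "g x \<in> T"
  shows "dder (\<lambda>x. f (g x)) x v = dder f (g x) (dder g x v)"
    "((\<lambda>x. f (g x)) has_derivative (\<lambda>v. dder f (g x) (dder g x v))) (at x)"
proof -
  show "((\<lambda>x. f (g x)) has_derivative (\<lambda>v. dder f (g x) (dder g x v))) (at x)"
    using assms by (intro has_derivative_compose[of g _ x UNIV f, simplified] smooth_on_has_derivative)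
  then show "dder (\<lambda>x. f (g x)) x v = dder f (g x) (dder g x v)"
    by (simp add: dder_eqI)
qed

text \<open>Real powers are closed under differentiation up to a constant factor, whence the
  \<open>c\<close> in the induction. The exponents \<open>1/2\<close> and \<open>-1\<close> provide
  square roots and reciprocals.\<close>

lemma smooth_on_powr: "smooth_on {0<..} (\<lambda>x::real. x powr a)"
proof -
  have "Ck_on k {0<..} (\<lambda>x::real. c * x powr a)" for k c
  proof (induction k arbitrary: c a)
    case 0
    then show ?case by (auto intro!: continuous_intros)
  next
    case (Suc k)
    have der: "((\<lambda>x. c * x powr a) has_derivative (\<lambda>v. (c * v * a) * x powr (a - 1))) (at x)"
      if "x > 0" for x :: real
    proof -
      have "((\<lambda>x. c * x powr a) has_real_derivative c * (a * x powr (a - 1))) (at x)"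
        using that by (intro DERIV_cmult has_real_derivative_powr) auto
      from has_derivative_eq_rhs[OF this[unfolded has_field_derivative_def]] show ?thesis
        by (simp add: fun_eq_iff mult_ac)
    qed
    have "Ck_on k {0<..} (\<lambda>x. dder (\<lambda>x. c * x powr a) x v) \<longleftrightarrow>
        Ck_on k {0<..} (\<lambda>x::real. (c * v * a) * x powr (a - 1))" for v
      by (rule Ck_on_cong) (auto simp add: dder_eqI[OF der])
    then show ?case using Suc Derivative.differentiableI[OF der] by simp
  qed
  from this[of _ 1] show ?thesis by (simp add: smooth_on_def)
qed

lemma smooth_on_powr_compose:
  fixes f :: "'a::real_normed_vector \<Rightarrow> real"
  assumes "open S" "smooth_on S f" "\<And>x. x \<in> S \<Longrightarrow> f x > 0"
  shows "smooth_on S (\<lambda>x. f x powr a)"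
  by (rule smooth_on_compose[of S "{0<..}"]) (use assms smooth_on_powr in auto)

lemma smooth_on_sqrt:
  fixes f :: "'a::real_normed_vector \<Rightarrow> real"
  assumes "open S" "smooth_on S f" "\<And>x. x \<in> S \<Longrightarrow> f x > 0"
  shows "smooth_on S (\<lambda>x. sqrt (f x))"
  using smooth_on_powr_compose[OF assms, of "1/2"] smooth_on_cong[OF assms(1), of "\<lambda>x. f x powr (1/2)" "\<lambda>x. sqrt (f x)"]
  by (simp add: powr_half_sqrt less_imp_le assms(3))

lemma smooth_on_inverse:
  fixes f :: "'a::real_normed_vector \<Rightarrow> real"
  assumes "open S" "smooth_on S f" "\<And>x. x \<in> S \<Longrightarrow> f x > 0"
  shows "smooth_on S (\<lambda>x. inverse (f x))"
  using smooth_on_powr_compose[OF assms, of "-1"] smooth_on_cong[OF assms(1), of "\<lambda>x. f x powr (-1)" "\<lambda>x. inverse (f x)"]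
  by (simp add: powr_minus less_imp_le assms(3))

lemma smooth_on_divide:
  fixes f g :: "'a::real_normed_vector \<Rightarrow> real"
  assumes "open S" "smooth_on S g" "smooth_on S f" "\<And>x. x \<in> S \<Longrightarrow> f x > 0"
  shows "smooth_on S (\<lambda>x. g x / f x)"
  using assms by (auto simp: divide_inverse intro!: smooth_on_mult smooth_on_inverse)

lemmas smooth_intros = smooth_on_const smooth_on_id smooth_on_add smooth_on_diff smooth_on_uminus
  smooth_on_mult smooth_on_scaleR smooth_on_power2 smooth_on_inner smooth_on_vec_nth smooth_on_sum smooth_on_dder
  smooth_on_sqrt smooth_on_inverse smooth_on_divide

subsection \<open>Smooth families of linear and bilinear maps\<close>

text \<open>Smoothness is tested on fixed arguments. For a Euclidean argument space this amounts to
  smoothness of the operator itself, without matrices or operator norms.\<close>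

definition smooth_lin :: "'a::real_normed_vector set \<Rightarrow> ('a \<Rightarrow> 'b::euclidean_space \<Rightarrow> 'c::real_normed_vector) \<Rightarrow> bool"
  where "smooth_lin S L \<longleftrightarrow> (\<forall>x\<in>S. linear (L x)) \<and> (\<forall>v. smooth_on S (\<lambda>x. L x v))"

definition smooth_bil :: "'a::real_normed_vector set \<Rightarrow>
    ('a \<Rightarrow> 'b::euclidean_space \<Rightarrow> 'd::euclidean_space \<Rightarrow> 'c::real_normed_vector) \<Rightarrow> bool"
  where "smooth_bil S B \<longleftrightarrow> (\<forall>x\<in>S. bilinear (B x)) \<and> (\<forall>v w. smooth_on S (\<lambda>x. B x v w))"

lemma smooth_lin_linear: "smooth_lin S L \<Longrightarrow> x \<in> S \<Longrightarrow> linear (L x)"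
  unfolding smooth_lin_def by blast

lemma smooth_bil_bilinear: "smooth_bil S L \<Longrightarrow> x \<in> S \<Longrightarrow> bilinear (L x)"
  unfolding smooth_bil_def by blast

lemma linear_eucl_expand:
  assumes "linear L"
  shows "L (v::'a::euclidean_space) = (\<Sum>b\<in>Basis. (v \<bullet> b) *\<^sub>R L b)"
proof -
  interpret linear L by (rule assms)
  have "L v = L (\<Sum>b\<in>Basis. (v \<bullet> b) *\<^sub>R b)" by (simp add: euclidean_representation)
  then show ?thesis by (simp add: sum scale)
qed

lemma smooth_lin_apply:
  assumes "open S" "smooth_lin S L" "smooth_on S f"
  shows "smooth_on S (\<lambda>x. L x (f x))"
proof -
  have "smooth_on S (\<lambda>x. \<Sum>b\<in>Basis. (f x \<bullet> b) *\<^sub>R L x b)"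
    using assms by (intro smooth_intros) (auto simp: smooth_lin_def)
  then show ?thesis
    using assms smooth_on_cong[OF assms(1), of "\<lambda>x. L x (f x)"  "\<lambda>x. \<Sum>b\<in>Basis. (f x \<bullet> b) *\<^sub>R L x b"]
    by (simp add: smooth_lin_def linear_eucl_expand[symmetric])
qed

text \<open>The product rule behind all covariant derivatives below: the first term differentiates
  the operator with its argument frozen at \<open>f x\<close>, the second only the argument. A basis
  expansion reduces it to products of a scalar and a vector.\<close>

lemma smooth_lin_has_derivative:
  assumes "open S" "smooth_lin S L" "(f has_derivative f') (at x)" "x \<in> S"
  shows "((\<lambda>x. L x (f x)) has_derivative (\<lambda>v. dder (\<lambda>y. L y (f x)) x v + L x (f' v))) (at x)"
proof -
  have lin: "linear (L y)" if "y \<in> S" for y using assms that by (simp add: smooth_lin_def)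
  have Lb: "((\<lambda>y. L y b) has_derivative (dder (\<lambda>y. L y b) x)) (at x)" for b
    using assms by (auto simp: smooth_lin_def intro: smooth_on_has_derivative)
  have "((\<lambda>y. \<Sum>b\<in>Basis. (f x \<bullet> b) *\<^sub>R L y b) has_derivative
      (\<lambda>v. \<Sum>b\<in>Basis. (f x \<bullet> b) *\<^sub>R dder (\<lambda>y. L y b) x v)) (at x)"
    by (intro has_derivative_sum has_derivative_scaleR_right Lb)
  then have "((\<lambda>y. L y (f x)) has_derivative (\<lambda>v. \<Sum>b\<in>Basis. (f x \<bullet> b) *\<^sub>R dder (\<lambda>y. L y b) x v)) (at x)"
    using has_derivative_cong_open[OF assms(1,4), of "\<lambda>y. L y (f x)" "\<lambda>y. \<Sum>b\<in>Basis. (f x \<bullet> b) *\<^sub>R L y b"]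
      linear_eucl_expand[OF lin] by simp
  note e1 = dder_eqI[OF this]
  have "((\<lambda>y. \<Sum>b\<in>Basis. (f y \<bullet> b) *\<^sub>R L y b) has_derivative
      (\<lambda>v. \<Sum>b\<in>Basis. (f x \<bullet> b) *\<^sub>R dder (\<lambda>y. L y b) x v + (f' v \<bullet> b) *\<^sub>R L x b)) (at x)"
    by (intro has_derivative_sum has_derivative_scaleR has_derivative_inner_left Lb assms)
  moreover have "(\<Sum>b\<in>Basis. (f x \<bullet> b) *\<^sub>R dder (\<lambda>y. L y b) x v + (f' v \<bullet> b) *\<^sub>R L x b) =
      dder (\<lambda>y. L y (f x)) x v + L x (f' v)" for v
    by (simp add: e1 sum.distrib linear_eucl_expand[OF lin[OF assms(4)], of "f' v"])
  ultimately show ?thesis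
    using has_derivative_cong_open[OF assms(1,4), of "\<lambda>y. L y (f y)" "\<lambda>y. \<Sum>b\<in>Basis. (f y \<bullet> b) *\<^sub>R L y b"]
      linear_eucl_expand[OF lin] by simp
qed

lemma smooth_bil_lin1: "smooth_bil S B \<Longrightarrow> smooth_lin S (\<lambda>x v. B x v w)"
  by (auto simp: smooth_bil_def smooth_lin_def bilinear_def)

lemma smooth_bil_lin2: "smooth_bil S B \<Longrightarrow> smooth_lin S (\<lambda>x w. B x v w)"
  by (auto simp: smooth_bil_def smooth_lin_def bilinear_def)

lemma smooth_bil_lin2':
  assumes "open S" "smooth_bil S B" "smooth_on S f" shows "smooth_lin S (\<lambda>x w. B x (f x) w)"
  using smooth_lin_apply[OF assms(1) smooth_bil_lin1[OF assms(2)] assms(3)] assms(2)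
  by (auto simp: smooth_lin_def smooth_bil_def bilinear_def)

lemma smooth_bil_apply:
  assumes "open S" "smooth_bil S B" "smooth_on S f" "smooth_on S g"
  shows "smooth_on S (\<lambda>x. B x (f x) (g x))"
  by (rule smooth_lin_apply[OF assms(1) smooth_bil_lin2'[OF assms(1,2,3)] assms(4)])

lemma smooth_bil_has_derivative:
  assumes "open S" "smooth_bil S B" "smooth_on S f" "smooth_on S g" "x \<in> S"
  shows "((\<lambda>x. B x (f x) (g x)) has_derivative
    (\<lambda>v. dder (\<lambda>y. B y (f x) (g x)) x v + B x (dder f x v) (g x) + B x (f x) (dder g x v))) (at x)"
proof -
  note g = smooth_on_has_derivative[OF assms(4,5)] and f = smooth_on_has_derivative[OF assms(3,5)]
  have e: "dder (\<lambda>y. B y (f y) (g x)) x v = dder (\<lambda>y. B y (f x) (g x)) x v + B x (dder f x v) (g x)" for v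
    using dder_eqI[OF smooth_lin_has_derivative[OF assms(1) smooth_bil_lin1[OF assms(2)] f assms(5)]] by simp
  show ?thesis
    using smooth_lin_has_derivative[OF assms(1) smooth_bil_lin2'[OF assms(1,2,3)] g assms(5)] by (simp add: e)
qed

lemma smooth_bil_dder:
  assumes "open S" "smooth_bil S B" "smooth_on S f" "smooth_on S g" "x \<in> S"
  shows "dder (\<lambda>x. B x (f x) (g x)) x v =
    dder (\<lambda>y. B y (f x) (g x)) x v + B x (dder f x v) (g x) + B x (f x) (dder g x v)"
  using dder_eqI[OF smooth_bil_has_derivative[OF assms]] by simp

lemma smooth_lin_dder:
  assumes "open S" "smooth_lin S L" "smooth_on S f" "x \<in> S"
  shows "dder (\<lambda>x. L x (f x)) x v = dder (\<lambda>y. L y (f x)) x v + L x (dder f x v)"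
  using dder_eqI[OF smooth_lin_has_derivative[OF assms(1,2) smooth_on_has_derivative[OF assms(3,4)] assms(4)]] by simp

lemma smooth_lin_D: "open S \<Longrightarrow> smooth_on S f \<Longrightarrow> smooth_lin S (\<lambda>x. dder f x)"
  by (auto simp: smooth_lin_def smooth_on_linear_dder smooth_on_dder)

lemma smooth_lin_compose:
  fixes g :: "'a::real_normed_vector \<Rightarrow> 'b::euclidean_space"
  assumes "open S" "open T" "g ` S \<subseteq> T" "smooth_on S g" "smooth_lin T L"
  shows "smooth_lin S (\<lambda>x. L (g x))"
  using assms by (auto simp: smooth_lin_def intro!: smooth_on_compose[of S T g])

lemma smooth_bil_compose:
  fixes g :: "'a::real_normed_vector \<Rightarrow> 'b::euclidean_space"
  assumes "open S" "open T" "g ` S \<subseteq> T" "smooth_on S g" "smooth_bil T B"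
  shows "smooth_bil S (\<lambda>x. B (g x))"
  using assms by (auto simp: smooth_bil_def intro!: smooth_on_compose[of S T g])

lemma smooth_bil_mono: "smooth_bil S B \<Longrightarrow> T \<subseteq> S \<Longrightarrow> smooth_bil T B"
  unfolding smooth_bil_def using smooth_on_mono by blast

lemma smooth_lin_mono: "smooth_lin S B \<Longrightarrow> T \<subseteq> S \<Longrightarrow> smooth_lin T B"
  unfolding smooth_lin_def using smooth_on_mono by blast

subsection \<open>Symmetry of second derivatives\<close>

lemma dder_line:
  fixes f :: "'a::real_normed_vector \<Rightarrow> real"
  assumes "f differentiable (at (y + s *\<^sub>R w))"
  shows "((\<lambda>s. f (y + s *\<^sub>R w)) has_real_derivative dder f (y + s *\<^sub>R w) w) (at s)"
proof -
  have "((\<lambda>s. f (y + s *\<^sub>R w)) has_derivative (\<lambda>h. dder f (y + s *\<^sub>R w) (h *\<^sub>R w))) (at s)"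
    by (rule has_derivative_compose[of "\<lambda>s. y + s *\<^sub>R w" _ s UNIV f, simplified])
      (auto intro!: derivative_eq_intros dder_works assms)
  moreover have "dder f (y + s *\<^sub>R w) (h *\<^sub>R w) = h * dder f (y + s *\<^sub>R w) w" for h
    using linear_cmul[OF dder_linear[OF assms]] by simp
  ultimately have "((\<lambda>s. f (y + s *\<^sub>R w)) has_derivative (\<lambda>h. h * dder f (y + s *\<^sub>R w) w)) (at s)"
    by simp
  then show ?thesis
    unfolding has_field_derivative_def by (rule has_derivative_eq_rhs) (simp add: fun_eq_iff)
qed

text \<open>The second difference is symmetric in \<open>v\<close> and \<open>w\<close>, while two
  applications of the mean value theorem write it as a mixed derivative in one prescribed order at a
  nearby point.\<close>

lemma second_difference_mvt:
  fixes f :: "'a::real_normed_vector \<Rightarrow> real"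
  assumes "ball x r \<subseteq> S" "smooth_on S f" "h > 0" "h * (norm v + norm w) < r"
  shows "\<exists>y\<in>ball x r. norm (y - x) \<le> h * (norm v + norm w) \<and>
    f (x + h *\<^sub>R w + h *\<^sub>R v) - f (x + h *\<^sub>R w) - f (x + h *\<^sub>R v) + f x = h * h * dder (\<lambda>y. dder f y w) y v"
proof -
  have bnd: "norm (s *\<^sub>R w + t *\<^sub>R v) \<le> h * (norm v + norm w)" if "0 \<le> s" "s \<le> h" "0 \<le> t" "t \<le> h" for s t
  proof -
    have "norm (s *\<^sub>R w + t *\<^sub>R v) \<le> norm (s *\<^sub>R w) + norm (t *\<^sub>R v)" by (rule norm_triangle_ineq)
    also have "\<dots> \<le> h * norm w + h * norm v"
      using that by (auto intro!: add_mono mult_right_mono)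
    finally show ?thesis by (simp add: algebra_simps)
  qed
  have inb: "x + s *\<^sub>R w + t *\<^sub>R v \<in> ball x r" if "0 \<le> s" "s \<le> h" "0 \<le> t" "t \<le> h" for s t
    using bnd[OF that] assms(4) by (simp add: dist_norm add.assoc norm_minus_commute)
      (metis add.commute add_diff_cancel_left' diff_add_eq_diff_diff_swap norm_minus_commute order_le_less_trans add.assoc)
  have inS: "x + s *\<^sub>R w + t *\<^sub>R v \<in> S" if "0 \<le> s" "s \<le> h" "0 \<le> t" "t \<le> h" for s t
    using inb[OF that] assms(1) by auto
  \<comment> \<open>The difference in direction \<open>v\<close>, regarded as a function of the
    displacement along \<open>w\<close>; the second mean value then acts along
    \<open>v\<close>.\<close>
  define E where "E s = f (x + h *\<^sub>R v + s *\<^sub>R w) - f (x + s *\<^sub>R w)" for s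
  have dE: "(E has_real_derivative dder f (x + h *\<^sub>R v + s *\<^sub>R w) w - dder f (x + s *\<^sub>R w) w) (at s)"
    if "0 \<le> s" "s \<le> h" for s
    unfolding E_def using inS[OF that, of h] inS[OF that, of 0] assms(3)
    by (intro DERIV_diff dder_line smooth_on_differentiable[OF assms(2)]) (auto simp: algebra_simps)
  obtain s where s: "0 < s" "s < h" "E h - E 0 = (h - 0) * (dder f (x + h *\<^sub>R v + s *\<^sub>R w) w - dder f (x + s *\<^sub>R w) w)"
    using MVT2[OF assms(3), of E, OF dE] by auto
  have dF: "((\<lambda>t. dder f (x + s *\<^sub>R w + t *\<^sub>R v) w) has_real_derivative dder (\<lambda>y. dder f y w) (x + s *\<^sub>R w + t *\<^sub>R v) v) (at t)"
    if "0 \<le> t" "t \<le> h" for t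
    using inS[of s t] that s
    by (intro dder_line smooth_on_differentiable[OF smooth_on_dder[OF assms(2)]]) auto
  obtain t where t: "0 < t" "t < h" "dder f (x + s *\<^sub>R w + h *\<^sub>R v) w - dder f (x + s *\<^sub>R w + 0 *\<^sub>R v) w =
      (h - 0) * dder (\<lambda>y. dder f y w) (x + s *\<^sub>R w + t *\<^sub>R v) v"
    using MVT2[OF assms(3), of "\<lambda>t. dder f (x + s *\<^sub>R w + t *\<^sub>R v) w", OF dF] by auto
  have "E h - E 0 = h * (h * dder (\<lambda>y. dder f y w) (x + s *\<^sub>R w + t *\<^sub>R v) v)"
    using s(3) t(3) by (simp add: algebra_simps)
  then show ?thesis
    using s t inb[of s t] bnd[of s t]
    by (intro bexI[of _ "x + s *\<^sub>R w + t *\<^sub>R v"]) (auto simp: E_def algebra_simps)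
qed

text \<open>Both mixed derivatives, each at some nearby point, equal the same second difference; by
  continuity they could not differ at \<open>x\<close>.\<close>

lemma dder_dder_commute_real:
  fixes f :: "'a::real_normed_vector \<Rightarrow> real"
  assumes "open S" "smooth_on S f" "x \<in> S"
  shows "dder (\<lambda>y. dder f y w) x v = dder (\<lambda>y. dder f y v) x w"
proof (rule ccontr)
  assume ne: "\<not> ?thesis"
  \<comment> \<open>Half of the supposed gap: values within \<open>e\<close> of the two sides cannot
    coincide.\<close>
  define e where "e = \<bar>dder (\<lambda>y. dder f y w) x v - dder (\<lambda>y. dder f y v) x w\<bar> / 2"
  have e: "e > 0" using ne by (simp add: e_def)
  have cont: "isCont (\<lambda>y. dder (\<lambda>y. dder f y a) y b) x" for a b
    using smooth_on_continuous_on[OF smooth_on_dder[OF smooth_on_dder[OF assms(2)]]] assms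
    by (simp add: continuous_on_eq_continuous_at)
  obtain d1 where d1: "d1 > 0" "\<And>y. dist y x < d1 \<Longrightarrow> \<bar>dder (\<lambda>y. dder f y w) y v - dder (\<lambda>y. dder f y w) x v\<bar> < e"
    using cont[of w v, unfolded continuous_at_eps_delta] e by (auto simp: dist_real_def)
  obtain d2 where d2: "d2 > 0" "\<And>y. dist y x < d2 \<Longrightarrow> \<bar>dder (\<lambda>y. dder f y v) y w - dder (\<lambda>y. dder f y v) x w\<bar> < e"
    using cont[of v w, unfolded continuous_at_eps_delta] e by (auto simp: dist_real_def)
  obtain r where r: "r > 0" "ball x r \<subseteq> S" using assms(1,3) by (auto simp: open_contains_ball)
  define \<delta> where "\<delta> = min r (min d1 d2)"
  \<comment> \<open>The summand 1 keeps the denominator positive even if both directions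
    vanish.\<close>
  define h where "h = \<delta> / (2 * (norm v + norm w + 1))"
  have "\<delta> > 0" using r d1 d2 by (simp add: \<delta>_def)
  have pos: "norm v + norm w + 1 > 0" by (smt (verit) norm_ge_zero)
  then have h: "h > 0" using \<open>\<delta> > 0\<close> by (simp add: h_def)
  have "norm v + norm w < 2 * (norm v + norm w + 1)" using pos by argo
  from mult_strict_left_mono[OF this h]
  have "h * (norm v + norm w) < h * (2 * (norm v + norm w + 1))" .
  also have "\<dots> = \<delta>" using pos by (simp add: h_def)
  finally have hd: "h * (norm v + norm w) < \<delta>" .
  then have hr: "h * (norm v + norm w) < r" by (simp add: \<delta>_def)
  obtain y1 where y1: "norm (y1 - x) \<le> h * (norm v + norm w)"
    "f (x + h *\<^sub>R w + h *\<^sub>R v) - f (x + h *\<^sub>R w) - f (x + h *\<^sub>R v) + f x = h * h * dder (\<lambda>y. dder f y w) y1 v"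
    using second_difference_mvt[OF r(2) assms(2) h hr] by blast
  obtain y2 where y2: "norm (y2 - x) \<le> h * (norm w + norm v)"
    "f (x + h *\<^sub>R v + h *\<^sub>R w) - f (x + h *\<^sub>R v) - f (x + h *\<^sub>R w) + f x = h * h * dder (\<lambda>y. dder f y v) y2 w"
    using second_difference_mvt[OF r(2) assms(2) h, of w v] hr by (auto simp: add.commute)
  have "h * h * dder (\<lambda>y. dder f y w) y1 v = h * h * dder (\<lambda>y. dder f y v) y2 w"
    using y1(2) y2(2) by (simp add: algebra_simps)
  then have eq: "dder (\<lambda>y. dder f y w) y1 v = dder (\<lambda>y. dder f y v) y2 w" using h by simp
  have "\<bar>dder (\<lambda>y. dder f y w) y1 v - dder (\<lambda>y. dder f y w) x v\<bar> < e"
    using y1(1) hd by (intro d1(2)) (simp add: \<delta>_def dist_norm)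
  moreover have "\<bar>dder (\<lambda>y. dder f y v) y2 w - dder (\<lambda>y. dder f y v) x w\<bar> < e"
    using y2(1) hd by (intro d2(2)) (simp add: \<delta>_def dist_norm add.commute)
  ultimately show False using eq by (simp add: e_def abs_if split: if_splits)
qed

lemma dder_inner:
  assumes "f differentiable (at x)" shows "dder (\<lambda>y. f y \<bullet> b) x v = dder f x v \<bullet> b"
  using dder_eqI[OF has_derivative_inner_left[OF dder_works[OF assms]], of b] by simp

lemma dder_dder_commute:
  fixes f :: "'a::real_normed_vector \<Rightarrow> 'b::euclidean_space"
  assumes S: "open S" "smooth_on S f" "x \<in> S"
  shows "dder (\<lambda>y. dder f y w) x v = dder (\<lambda>y. dder f y v) x w"
proof (rule euclidean_eqI)
  fix b :: 'b
  have *: "dder (\<lambda>y. dder f y w) x v \<bullet> b = dder (\<lambda>y. dder (\<lambda>y. f y \<bullet> b) y w) x v" for v w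
  proof -
    have "dder (\<lambda>y. dder f y w \<bullet> b) x v = dder (\<lambda>y. dder (\<lambda>y. f y \<bullet> b) y w) x v"
      using dder_cong_open[OF S(1,3), of "\<lambda>y. dder f y w \<bullet> b" "\<lambda>y. dder (\<lambda>y. f y \<bullet> b) y w"]
        dder_inner[OF smooth_on_differentiable[OF S(2)]] by simp
    then show ?thesis
      using dder_inner[OF smooth_on_differentiable[OF smooth_on_dder[OF S(2)] S(3)]] by simp
  qed
  show "dder (\<lambda>y. dder f y w) x v \<bullet> b = dder (\<lambda>y. dder f y v) x w \<bullet> b"
    unfolding *
    by (rule dder_dder_commute_real[OF S(1) smooth_on_inner[OF S(1,2) smooth_on_const] S(3)])
qed

subsection \<open>Closed one-forms and local diffeomorphisms\<close>

text \<open>Poincare lemma on a ball, the one-form being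
  \<open>v \<mapsto> \<theta> x \<bullet> v\<close>. The potential integrates the form along the
  radii from the centre, and is differentiated under the integral sign.\<close>

lemma closed_form_potential:
  fixes \<theta> :: "'a::euclidean_space \<Rightarrow> 'a"
  assumes sm: "smooth_on (ball x0 r) \<theta>"
    and closed: "\<And>x v w. x \<in> ball x0 r \<Longrightarrow> dder \<theta> x v \<bullet> w = dder \<theta> x w \<bullet> v"
  shows "\<exists>f::'a \<Rightarrow> real. \<forall>x\<in>ball x0 r. (f has_derivative (\<lambda>v. \<theta> x \<bullet> v)) (at x)"
proof -
  define \<gamma> where "\<gamma> x t = x0 + t *\<^sub>R (x - x0)" for x :: 'a and t :: real
  \<comment> \<open>This is the derivative in \<open>t\<close> of
    \<open>t *\<^sub>R \<theta> (\<gamma> x t)\<close>, so its integral is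
    \<open>\<theta> x\<close>. By closedness it also represents the derivative in \<open>x\<close>
    of the integrand of \<open>F\<close>.\<close>
  define \<omega> where "\<omega> x t = \<theta> (\<gamma> x t) + t *\<^sub>R dder \<theta> (\<gamma> x t) (x - x0)" for x and t :: real
  define F where "F x = integral (cbox 0 1) (\<lambda>t::real. \<theta> (\<gamma> x t) \<bullet> (x - x0))" for x
  have inb: "\<gamma> x t \<in> ball x0 r" if "x \<in> ball x0 r" "t \<in> cbox 0 1" for x t
  proof -
    have "norm (t *\<^sub>R (x - x0)) \<le> 1 * norm (x - x0)"
      using that by (simp add: mult_left_le_one_le)
    then show ?thesis using that(1) by (simp add: \<gamma>_def dist_norm norm_minus_commute)
  qed
  have c\<gamma>: "continuous_on (ball x0 r \<times> cbox 0 1) (\<lambda>z. \<gamma> (fst z) (snd z))"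
    unfolding \<gamma>_def by (intro continuous_intros)
  have c\<theta>: "continuous_on (ball x0 r \<times> cbox 0 1) (\<lambda>z. \<theta> (\<gamma> (fst z) (snd z)))"
    by (rule continuous_on_compose2[OF smooth_on_continuous_on[OF sm] c\<gamma>]) (use inb in auto)
  have cd: "continuous_on (ball x0 r \<times> cbox 0 1) (\<lambda>z. dder \<theta> (\<gamma> (fst z) (snd z)) b)" for b
    by (rule continuous_on_compose2[OF smooth_on_continuous_on[OF smooth_on_dder[OF sm]] c\<gamma>]) (use inb in auto)
  have "continuous_on (ball x0 r \<times> cbox 0 1)
     (\<lambda>z. \<Sum>b\<in>Basis. ((fst z - x0) \<bullet> b) *\<^sub>R dder \<theta> (\<gamma> (fst z) (snd z)) b)"
    by (intro continuous_intros cd)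
  moreover have "(\<Sum>b\<in>Basis. ((fst z - x0) \<bullet> b) *\<^sub>R dder \<theta> (\<gamma> (fst z) (snd z)) b) =
      dder \<theta> (\<gamma> (fst z) (snd z)) (fst z - x0)" if "z \<in> ball x0 r \<times> cbox 0 1" for z
    using that inb by (intro linear_eucl_expand[symmetric] smooth_on_linear_dder[OF sm]) auto
  ultimately have cD: "continuous_on (ball x0 r \<times> cbox 0 1) (\<lambda>z. dder \<theta> (\<gamma> (fst z) (snd z)) (fst z - x0))"
    by (simp cong: continuous_on_cong)
  have c\<omega>: "continuous_on (ball x0 r \<times> cbox 0 1) (\<lambda>z. \<omega> (fst z) (snd z))"
    unfolding \<omega>_def by (intro continuous_intros c\<theta> cD)
  have Pair_sub: "Pair x ` cbox 0 1 \<subseteq> ball x0 r \<times> cbox 0 1" if "x \<in> ball x0 r" for x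
    using that by auto
  have c\<omega>x: "continuous_on (cbox 0 1) (\<omega> x)" if "x \<in> ball x0 r" for x
    using continuous_on_compose2[OF c\<omega> continuous_on_Pair[OF continuous_on_const[of _ x] continuous_on_id] Pair_sub[OF that]] by simp
  have c\<theta>x: "continuous_on (cbox 0 1) (\<lambda>t. \<theta> (\<gamma> x t))" if "x \<in> ball x0 r" for x
    using continuous_on_compose2[OF c\<theta> continuous_on_Pair[OF continuous_on_const[of _ x] continuous_on_id] Pair_sub[OF that]] by simp
  have int\<omega>: "(\<omega> x has_integral \<theta> x) (cbox 0 1)" if x: "x \<in> ball x0 r" for x
  proof -
    have "((\<lambda>t. t *\<^sub>R \<theta> (\<gamma> x t)) has_vector_derivative \<omega> x t) (at t within cbox 0 1)" if "t \<in> cbox 0 1" for t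
    proof -
      have "((\<lambda>t. \<theta> (\<gamma> x t)) has_derivative (\<lambda>h. dder \<theta> (\<gamma> x t) (h *\<^sub>R (x - x0)))) (at t)"
        unfolding \<gamma>_def
        by (rule has_derivative_compose[of "\<lambda>t. x0 + t *\<^sub>R (x - x0)" _ t UNIV \<theta>, simplified])
          (use inb[OF x that, unfolded \<gamma>_def] in \<open>auto intro!: derivative_eq_intros smooth_on_has_derivative[OF sm]\<close>)
      then have d: "((\<lambda>t. \<theta> (\<gamma> x t)) has_derivative (\<lambda>h. h *\<^sub>R dder \<theta> (\<gamma> x t) (x - x0))) (at t)"
        using linear_cmul[OF smooth_on_linear_dder[OF sm inb[OF x that]]] by simp
      have "((\<lambda>t. t *\<^sub>R \<theta> (\<gamma> x t)) has_derivative (\<lambda>h. t *\<^sub>R (h *\<^sub>R dder \<theta> (\<gamma> x t) (x - x0)) + h *\<^sub>R \<theta> (\<gamma> x t))) (at t)"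
        by (rule has_derivative_scaleR[OF has_derivative_ident d])
      then have "((\<lambda>t. t *\<^sub>R \<theta> (\<gamma> x t)) has_derivative (\<lambda>h. h *\<^sub>R \<omega> x t)) (at t)"
        by (rule has_derivative_eq_rhs) (simp add: \<omega>_def fun_eq_iff algebra_simps)
      then show ?thesis
        unfolding has_vector_derivative_def by (rule has_derivative_at_withinI)
    qed
    then have "(\<omega> x has_integral (1 *\<^sub>R \<theta> (\<gamma> x 1) - 0 *\<^sub>R \<theta> (\<gamma> x 0))) {0..1}"
      by (intro fundamental_theorem_of_calculus) auto
    then show ?thesis by (simp add: \<gamma>_def)
  qed
  have "(F has_derivative (\<lambda>v. \<theta> x \<bullet> v)) (at x)" if x: "x \<in> ball x0 r" for x
  proof -
    have "((\<lambda>x. integral (cbox 0 1) (\<lambda>t. \<theta> (\<gamma> x t) \<bullet> (x - x0))) has_derivative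
        blinfun_apply (integral (cbox 0 1) (\<lambda>t. blinfun_inner_right (\<omega> x t)))) (at x within ball x0 r)"
    proof (rule leibniz_rule[OF _ _ _ x convex_ball])
      fix y and t :: real assume yt: "y \<in> ball x0 r" "t \<in> cbox 0 1"
      have "((\<lambda>y. \<theta> (\<gamma> y t)) has_derivative (\<lambda>h. dder \<theta> (\<gamma> y t) (t *\<^sub>R h))) (at y)"
        unfolding \<gamma>_def
        by (rule has_derivative_compose[of "\<lambda>y. x0 + t *\<^sub>R (y - x0)" _ y UNIV \<theta>, simplified])
          (use inb[OF yt, unfolded \<gamma>_def] in \<open>auto intro!: derivative_eq_intros smooth_on_has_derivative[OF sm]\<close>)
      moreover have "((\<lambda>y. y - x0) has_derivative (\<lambda>h. h)) (at y)" by (auto intro!: derivative_eq_intros)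
      ultimately have "((\<lambda>y. \<theta> (\<gamma> y t) \<bullet> (y - x0)) has_derivative
          (\<lambda>h. \<theta> (\<gamma> y t) \<bullet> h + dder \<theta> (\<gamma> y t) (t *\<^sub>R h) \<bullet> (y - x0))) (at y)"
        by (rule has_derivative_inner)
      \<comment> \<open>Closedness enters here, to interchange \<open>h\<close> and
        \<open>y - x0\<close>.\<close>
      moreover have "\<theta> (\<gamma> y t) \<bullet> h + dder \<theta> (\<gamma> y t) (t *\<^sub>R h) \<bullet> (y - x0) = \<omega> y t \<bullet> h" for h
        using closed[OF inb[OF yt], of h "y - x0"] linear_cmul[OF smooth_on_linear_dder[OF sm inb[OF yt]], of t h]
        by (simp add: \<omega>_def inner_add_left)
      ultimately show "((\<lambda>y. \<theta> (\<gamma> y t) \<bullet> (y - x0)) has_derivative blinfun_apply (blinfun_inner_right (\<omega> y t))) (at y within ball x0 r)"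
        by (simp add: has_derivative_at_withinI)
    next
      fix y assume "y \<in> ball x0 r"
      then show "(\<lambda>t. \<theta> (\<gamma> y t) \<bullet> (y - x0)) integrable_on cbox 0 1"
        by (intro integrable_continuous continuous_intros c\<theta>x)
    next
      show "continuous_on (ball x0 r \<times> cbox 0 1) (\<lambda>(x, t). blinfun_inner_right (\<omega> x t))"
        using c\<omega> by (auto simp: split_beta intro!: continuous_intros)
    qed
    moreover have "integral (cbox 0 1) (\<lambda>t. blinfun_inner_right (\<omega> x t)) = blinfun_inner_right (\<theta> x)"
      using integral_linear[OF has_integral_integrable[OF int\<omega>[OF x]] bounded_linear_blinfun_inner_right]
        integral_unique[OF int\<omega>[OF x]] by (simp add: o_def)
    ultimately show ?thesis
      using x by (simp add: F_def[abs_def] at_within_open[OF x])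
  qed
  then show ?thesis by blast
qed

text \<open>The inverse of the derivative is supplied as a smooth family \<open>E\<close>. In the
  application it is known explicitly from the frame, and no smoothness of matrix inversion has to be
  discussed.\<close>

lemma smooth_local_diffeomorphism:
  fixes f :: "'a::euclidean_space \<Rightarrow> 'a"
  assumes S: "open S" "x0 \<in> S" and f: "smooth_on S f" and E: "smooth_lin S E"
    and inv: "\<And>x v. x \<in> S \<Longrightarrow> dder f x (E x v) = v" "\<And>x v. x \<in> S \<Longrightarrow> E x (dder f x v) = v"
  shows "\<exists>U. open U \<and> x0 \<in> U \<and> U \<subseteq> S \<and> inj_on f U \<and> open (f ` U) \<and> smooth_on (f ` U) (inv_into U f)"
proof -
  define f' where "f' x = Blinfun (dder f x)" for x
  have bl: "bounded_linear (dder f x)" if "x \<in> S" for x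
    using smooth_on_linear_dder[OF f that] by (simp add: linear_conv_bounded_linear)
  have f'[simp]: "blinfun_apply (f' x) = dder f x" if "x \<in> S" for x
    by (simp add: f'_def bounded_linear_Blinfun_apply bl that)
  have blE: "bounded_linear (E x)" if "x \<in> S" for x
    using E that by (simp add: smooth_lin_def linear_conv_bounded_linear)
  have cont: "continuous_on S f'"
  proof (rule continuous_on_blinfun_componentwise)
    fix i :: 'a
    show "continuous_on S (\<lambda>x. blinfun_apply (f' x) i)"
      using smooth_on_continuous_on[OF smooth_on_dder[OF f]] by (simp cong: continuous_on_cong)
  qed
  have inv0: "Blinfun (E x0) o\<^sub>L f' x0 = id_blinfun"
    by (rule blinfun_eqI) (simp add: S inv bounded_linear_Blinfun_apply blE)
  obtain U V g g' where U: "open U" "U \<subseteq> S" "x0 \<in> U" "open V" "homeomorphism U V f g"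
    and g: "\<And>y. y \<in> V \<Longrightarrow> (g has_derivative (g' y)) (at y)"
      "\<And>y. y \<in> V \<Longrightarrow> g' y = inv (blinfun_apply (f' (g y)))"
    using inverse_function_theorem[OF S(1) _ cont S(2) inv0] smooth_on_has_derivative[OF f] f'
    by metis
  have V: "V = f ` U" using U(5) by (auto simp: homeomorphism_def)
  have gU: "g y \<in> U" if "y \<in> V" for y using U(5) that by (auto simp: homeomorphism_def)
  have inj: "inj_on f U" using U(5) by (metis homeomorphism_apply1 inj_on_inverseI)
  have gE: "(g has_derivative E (g y)) (at y)" if "y \<in> V" for y
  proof -
    have "inv (dder f (g y)) = E (g y)"
      by (rule inv_equality) (use inv gU[OF that] U(2) in auto)
    then show ?thesis using g[OF that] gU[OF that] U(2) by auto
  qed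
  \<comment> \<open>Bootstrapping: the derivative of \<open>g\<close> is \<open>E\<close> composed
    with \<open>g\<close>, hence of the same class as \<open>g\<close>, and \<open>g\<close> gains
    one order.\<close>
  have "Ck_on k V g" for k
  proof (induction k)
    case 0
    then show ?case using U(5) by (simp add: homeomorphism_def)
  next
    case (Suc k)
    have "Ck_on k V (\<lambda>y. E (g y) v)" for v
      by (rule Ck_on_compose[OF U(4,1) _ Suc]) (use gU U(2) E in \<open>auto simp: smooth_lin_def intro: smooth_on_mono\<close>)
    then have "Ck_on k V (\<lambda>y. dder g y v)" for v
      using Ck_on_cong[OF U(4), of "\<lambda>y. dder g y v" "\<lambda>y. E (g y) v" k] dder_eqI[OF gE] by simp
    then show ?case using Derivative.differentiableI[OF gE] by simp
  qed
  then have "smooth_on V g" by (simp add: smooth_on_def)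
  moreover have "g y = inv_into U f y" if "y \<in> V" for y
    using U(5) that gU[OF that] inj by (metis homeomorphism_apply2 inv_into_f_f)
  ultimately have "smooth_on V (inv_into U f)"
    using smooth_on_cong[OF U(4), of g "inv_into U f"] by simp
  then show ?thesis using U inj V by (intro exI[of _ U]) auto
qed

subsection \<open>Inner products on the plane\<close>

definition inner_form :: "('a::real_vector \<Rightarrow> 'a \<Rightarrow> real) \<Rightarrow> bool" where
  "inner_form g \<longleftrightarrow> bilinear g \<and> (\<forall>v w. g v w = g w v) \<and> (\<forall>v. v \<noteq> 0 \<longrightarrow> g v v > 0)"

lemma bilinear_simps:
  assumes "bilinear B"
  shows "B (x + y) z = B x z + B y z" "B z (x + y) = B z x + B z y"
    "B (x - y) z = B x z - B y z" "B z (x - y) = B z x - B z y"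
    "B (c *\<^sub>R x) z = c *\<^sub>R B x z" "B z (c *\<^sub>R x) = c *\<^sub>R B z x"
    "B 0 z = 0" "B z 0 = 0" "B (- x) z = - B x z" "B z (- x) = - B z x"
  using assms by (simp_all add: bilinear_ladd bilinear_radd bilinear_lsub bilinear_rsub bilinear_lmul
    bilinear_rmul bilinear_lzero bilinear_rzero bilinear_lneg bilinear_rneg)

lemma inner_form_bilinear: "inner_form g \<Longrightarrow> bilinear g"
  by (simp add: inner_form_def)

lemma inner_form_sym: "inner_form g \<Longrightarrow> g v w = g w v"
  by (simp add: inner_form_def)

lemma inner_form_pos: "inner_form g \<Longrightarrow> v \<noteq> 0 \<Longrightarrow> g v v > 0"
  by (simp add: inner_form_def)

lemma inner_form_eqI:
  assumes "inner_form g" "\<And>w. g v w = g v' w"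
  shows "v = v'"
proof (rule ccontr)
  assume "v \<noteq> v'"
  then have "g (v - v') (v - v') > 0" using assms(1) by (simp add: inner_form_pos)
  then show False using assms(2)[of "v - v'"] by (simp add: bilinear_simps(3)[OF inner_form_bilinear[OF assms(1)]])
qed

definition on_pair :: "('a::real_vector \<Rightarrow> 'a \<Rightarrow> real) \<Rightarrow> 'a \<Rightarrow> 'a \<Rightarrow> bool" where
  "on_pair g a b \<longleftrightarrow> g a a = 1 \<and> g b b = 1 \<and> g a b = 0"

text \<open>The pair is not normalised, because the adapted frame has length
  \<open>1 / sqrt (2 * m)\<close>.\<close>

lemma orthogonal_pair_expansion:
  fixes a b :: "real^2"
  assumes g: "inner_form g" and ab: "g a a \<noteq> 0" "g b b \<noteq> 0" "g a b = 0"
  shows "v = (g v a / g a a) *\<^sub>R a + (g v b / g b b) *\<^sub>R b"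
proof -
  note b = bilinear_simps[OF inner_form_bilinear[OF g]]
  have ne: "a \<noteq> 0" "b \<noteq> 0" using ab b by auto
  have nb: "a \<noteq> b" using ab by auto
  have ind: "independent {a, b}"
  proof (rule ccontr)
    assume "\<not> independent {a, b}"
    then obtain c where "a = c *\<^sub>R b"
      using ne nb by (auto simp: independent_insert dependent_single span_singleton split: if_splits)
    then show False using ab ne b by simp
  qed
  have "card {a, b} = dim (UNIV :: (real^2) set)" using nb by simp
  then have "span {a, b} = UNIV"
    using card_ge_dim_independent[of "{a, b}" UNIV] ind by auto
  then have "v \<in> span {a, b}" by simp
  then obtain s t where v: "v = s *\<^sub>R a + t *\<^sub>R b"
    by (auto simp: span_insert span_singleton algebra_simps)
  have "g v a = s * g a a" "g v b = t * g b b"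
    using ab(3) inner_form_sym[OF g, of b a] by (simp_all add: v b)
  then show ?thesis using v ab by simp
qed

lemma on_pair_expansion:
  fixes a b :: "real^2"
  assumes "inner_form g" "on_pair g a b"
  shows "v = g v a *\<^sub>R a + g v b *\<^sub>R b"
  using orthogonal_pair_expansion[OF assms(1), of a b v] assms(2) by (simp add: on_pair_def)

lemma on_pair_exists:
  fixes e :: "real^2"
  assumes g: "inner_form g" and e: "e \<noteq> 0"
  shows "\<exists>b. on_pair g ((1 / sqrt (g e e)) *\<^sub>R e) b"
proof -
  note b = bilinear_simps[OF inner_form_bilinear[OF g]]
  have pos: "g e e > 0" using inner_form_pos[OF g e] .
  obtain w where w: "w \<notin> range (\<lambda>c. c *\<^sub>R e)"
  proof -
    have "span {e} \<noteq> UNIV"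
    proof
      assume "span {e} = UNIV"
      then have "dim (span {e}) = 2" by simp
      then show False using dim_le_card'[of "{e}"] by (simp add: dim_span)
    qed
    then show ?thesis using that by (auto simp: span_singleton)
  qed
  define u where "u = w - (g w e / g e e) *\<^sub>R e"
  have "u \<noteq> 0" using w by (auto simp: u_def)
  then have up: "g u u > 0" using inner_form_pos[OF g] by simp
  have "g e u = 0" using pos inner_form_sym[OF g, of w e] by (simp add: u_def b)
  then have "on_pair g ((1 / sqrt (g e e)) *\<^sub>R e) ((1 / sqrt (g u u)) *\<^sub>R u)"
    using pos up by (simp add: on_pair_def b)
  then show ?thesis by blast
qed

text \<open>Reading the eigenvalue off one fixed vector makes it visibly smooth in families.\<close>

lemma traceless_symmetric_square:
  fixes e :: "real^2"
  assumes g: "inner_form g" and P: "linear P" "\<And>v w. g (P v) w = g v (P w)"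
    and tr: "\<And>a b. on_pair g a b \<Longrightarrow> g (P a) a + g (P b) b = 0" and e: "e \<noteq> 0"
  shows "P (P v) = (g (P e) (P e) / g e e) *\<^sub>R v"
    "g (P v) (P v) = (g (P e) (P e) / g e e) * g v v"
proof -
  note b = bilinear_simps[OF inner_form_bilinear[OF g]]
  note lin = linear_add[OF P(1)] linear_cmul[OF P(1)] linear_diff[OF P(1)]
  have pos: "g e e > 0" using inner_form_pos[OF g e] .
  define a where "a = (1 / sqrt (g e e)) *\<^sub>R e"
  obtain c where on: "on_pair g a c" using on_pair_exists[OF g e] a_def by blast
  have ea: "e = sqrt (g e e) *\<^sub>R a" using pos by (simp add: a_def)
  define s t where "s = g (P a) a" and "t = g (P a) c"
  have Pa: "P a = s *\<^sub>R a + t *\<^sub>R c"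
    unfolding s_def t_def by (rule on_pair_expansion[OF g on])
  \<comment> \<open>Symmetry determines the off-diagonal entry and the vanishing trace the diagonal
    one. The matrix has rows \<open>(s, t)\<close> and \<open>(t, - s)\<close>, and its square is
    scalar.\<close>
  have Pc: "P c = t *\<^sub>R a + (- s) *\<^sub>R c"
  proof -
    have "g (P c) c = - g (P a) a" using tr[OF on] by linarith
    then show ?thesis
      using on_pair_expansion[OF g on, of "P c"] P(2)[of c a] inner_form_sym[OF g, of c "P a"]
      by (simp add: s_def t_def)
  qed
  have sq: "P (P v) = (s\<^sup>2 + t\<^sup>2) *\<^sub>R v" for v
  proof -
    have "P (P a) = (s\<^sup>2 + t\<^sup>2) *\<^sub>R a" "P (P c) = (s\<^sup>2 + t\<^sup>2) *\<^sub>R c"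
      by (simp_all add: Pa Pc lin algebra_simps power2_eq_square)
    then show ?thesis
      by (subst (1 2) on_pair_expansion[OF g on, of v]) (simp add: lin algebra_simps)
  qed
  have "g (P e) (P e) = (s\<^sup>2 + t\<^sup>2) * g e e"
    by (simp add: P(2) sq b)
  then have eq: "g (P e) (P e) / g e e = s\<^sup>2 + t\<^sup>2" using pos by simp
  show "P (P v) = (g (P e) (P e) / g e e) *\<^sub>R v" by (simp add: eq sq)
  show "g (P v) (P v) = (g (P e) (P e) / g e e) * g v v" unfolding eq by (simp add: P(2) sq b)
qed

subsection \<open>Adapted coordinates\<close>

text \<open>\<open>G x u v\<close> stands for the Christoffel symbols of the metric \<open>g\<close>, and \<open>A_div\<close> says \<open>div A = 0\<close>.\<close>

locale codazzi_data =
  fixes \<Omega> :: "(real^2) set" and g :: "real^2 \<Rightarrow> real^2 \<Rightarrow> real^2 \<Rightarrow> real"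
    and G :: "real^2 \<Rightarrow> real^2 \<Rightarrow> real^2 \<Rightarrow> real^2" and A :: "real^2 \<Rightarrow> real^2 \<Rightarrow> real^2" and k :: real
  assumes open_\<Omega>: "open \<Omega>"
    and smg: "smooth_bil \<Omega> g" and smG: "smooth_bil \<Omega> G" and smA: "smooth_lin \<Omega> A"
    and g: "x \<in> \<Omega> \<Longrightarrow> inner_form (g x)"
    and G_sym: "x \<in> \<Omega> \<Longrightarrow> G x u v = G x v u"
    and compat: "x \<in> \<Omega> \<Longrightarrow> dder (\<lambda>y. g y v w) x u = g x (G x u v) w + g x v (G x u w)"
    and A_sym: "x \<in> \<Omega> \<Longrightarrow> g x (A x v) w = g x v (A x w)"
    and A_trace: "x \<in> \<Omega> \<Longrightarrow> on_pair (g x) a b \<Longrightarrow> g x (A x a) a + g x (A x b) b = 2 * k"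
    and A_div: "x \<in> \<Omega> \<Longrightarrow> on_pair (g x) a b \<Longrightarrow>
      (dder (\<lambda>y. A y a) x a + G x a (A x a) - A x (G x a a)) +
      (dder (\<lambda>y. A y b) x b + G x b (A x b) - A x (G x b b)) = 0"
begin

definition "P x v = A x v - k *\<^sub>R v"
definition "cov x u Y = dder Y x u + G x u (Y x)"

lemmas gb = bilinear_simps[OF inner_form_bilinear[OF g]]

lemma smP: "smooth_lin \<Omega> P"
  using smA open_\<Omega> unfolding smooth_lin_def P_def
  by (auto intro!: smooth_intros linearI simp: linear_add linear_cmul algebra_simps)

lemma linP: "x \<in> \<Omega> \<Longrightarrow> linear (P x)"
  using smP by (simp add: smooth_lin_def)

lemma bilG: "x \<in> \<Omega> \<Longrightarrow> bilinear (G x)"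
  using smG by (simp add: smooth_bil_def)

lemma P_sym: "x \<in> \<Omega> \<Longrightarrow> g x (P x v) w = g x v (P x w)"
  by (simp add: P_def gb A_sym)

lemma P_trace: "x \<in> \<Omega> \<Longrightarrow> on_pair (g x) a b \<Longrightarrow> g x (P x a) a + g x (P x b) b = 0"
  using A_trace[of x a b] by (simp add: P_def gb on_pair_def)

lemma dder_P: "x \<in> \<Omega> \<Longrightarrow> dder (\<lambda>y. P y v) x u = dder (\<lambda>y. A y v) x u"
proof -
  assume x: "x \<in> \<Omega>"
  have "smooth_on \<Omega> (\<lambda>y. A y v)" using smA by (simp add: smooth_lin_def)
  from has_derivative_diff[OF smooth_on_has_derivative[OF this x] has_derivative_const[of "k *\<^sub>R v"]]
  show ?thesis unfolding P_def by (simp add: dder_eqI)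
qed

lemma P_div:
  assumes "x \<in> \<Omega>" "on_pair (g x) a b"
  shows "(dder (\<lambda>y. P y a) x a + G x a (P x a) - P x (G x a a)) +
      (dder (\<lambda>y. P y b) x b + G x b (P x b) - P x (G x b b)) = 0"
proof -
  have "G x a (P x a) - P x (G x a a) = G x a (A x a) - A x (G x a a)" for a
    using bilinear_simps[OF bilG[OF assms(1)]] by (simp add: P_def)
  then show ?thesis using A_div[OF assms] by (simp add: dder_P assms(1) add_diff_eq[symmetric])
qed

text \<open>Tensoriality: the left side extends \<open>Y x\<close> by a constant, the right side
  uses the field \<open>Y\<close>. This allows the divergence to be evaluated on an eigenframe with
  variable components.\<close>

lemma cov_P:
  assumes "open W" "W \<subseteq> \<Omega>" "x \<in> W" "smooth_on W Y"
  shows "dder (\<lambda>y. P y (Y x)) x u + G x u (P x (Y x)) - P x (G x u (Y x)) =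
    cov x u (\<lambda>y. P y (Y y)) - P x (cov x u Y)"
proof -
  have x: "x \<in> \<Omega>" using assms by auto
  have "dder (\<lambda>y. P y (Y y)) x u = dder (\<lambda>y. P y (Y x)) x u + P x (dder Y x u)"
    using smooth_lin_dder[OF assms(1) smooth_lin_mono[OF smP assms(2)] assms(4,3)] .
  then show ?thesis by (simp add: cov_def linear_add[OF linP[OF x]])
qed

lemma cov_metric:
  assumes "open W" "W \<subseteq> \<Omega>" "x \<in> W" "smooth_on W Y" "smooth_on W Z"
  shows "dder (\<lambda>y. g y (Y y) (Z y)) x u = g x (cov x u Y) (Z x) + g x (Y x) (cov x u Z)"
proof -
  have x: "x \<in> \<Omega>" using assms by auto
  show ?thesis
    using smooth_bil_dder[OF assms(1) smooth_bil_mono[OF smg assms(2)] assms(4,5,3), of u]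
    by (simp add: compat[OF x] cov_def gb[OF x])
qed

lemma cov_scaleR:
  assumes "x \<in> W" "smooth_on W f" "smooth_on W Y" "W \<subseteq> \<Omega>"
  shows "cov x u (\<lambda>y. f y *\<^sub>R Y y) = dder f x u *\<^sub>R Y x + f x *\<^sub>R cov x u Y"
proof -
  have "((\<lambda>y. f y *\<^sub>R Y y) has_derivative (\<lambda>u. f x *\<^sub>R dder Y x u + dder f x u *\<^sub>R Y x)) (at x)"
    using assms by (intro has_derivative_scaleR smooth_on_has_derivative)
  from dder_eqI[OF this] show ?thesis
    using bilinear_simps[OF bilG[of x]] assms by (auto simp add: cov_def algebra_simps)
qed

lemma cov_cong:
  assumes "open W" "x \<in> W" "\<And>y. y \<in> W \<Longrightarrow> Y y = Z y"
  shows "cov x u Y = cov x u Z"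
  using dder_cong_open[OF assms] assms by (simp add: cov_def)

text \<open>In an eigenframe the equation \<open>div P = 0\<close> expresses the derivatives of \<open>m\<close> through the connection,
  and they exactly cancel the bracket of the rescaled frame.\<close>

lemma eigenframe_commutes:
  assumes W: "open W" "W \<subseteq> \<Omega>" "x \<in> W"
    and sm: "smooth_on W m" "smooth_on W X" "smooth_on W Y"
    and m: "\<And>y. y \<in> W \<Longrightarrow> m y > 0"
    and PX: "\<And>y. y \<in> W \<Longrightarrow> P y (X y) = m y *\<^sub>R X y" and PY: "\<And>y. y \<in> W \<Longrightarrow> P y (Y y) = - m y *\<^sub>R Y y"
    and XX: "\<And>y. y \<in> W \<Longrightarrow> g y (X y) (X y) = 1 / (2 * m y)" and YY: "\<And>y. y \<in> W \<Longrightarrow> g y (Y y) (Y y) = 1 / (2 * m y)"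
    and XY: "\<And>y. y \<in> W \<Longrightarrow> g y (X y) (Y y) = 0"
  shows "dder Y x (X x) = dder X x (Y x)"
proof -
  have x: "x \<in> \<Omega>" using W by auto
  have mx: "m x > 0" using m W by simp
  note gb = gb[OF x] and sym = inner_form_sym[OF g[OF x]]
  \<comment> \<open>The divergence equation is available on orthonormal pairs only, so the frame is
    scaled to unit length; the common factor \<open>r * r\<close> then drops out because
    \<open>Q\<close> is quadratic.\<close>
  define r where "r = sqrt (2 * m x)"
  have r: "r * r = 2 * m x" using mx by (simp add: r_def)
  have on: "on_pair (g x) (r *\<^sub>R X x) (r *\<^sub>R Y x)"
    using r mx XX[OF W(3)] YY[OF W(3)] XY[OF W(3)] unfolding on_pair_def
    by (simp add: gb mult.assoc[symmetric])
  define Q where "Q u v = dder (\<lambda>y. P y v) x u + G x u (P x v) - P x (G x u v)" for u v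
  have Qsc: "Q (c *\<^sub>R v) (c *\<^sub>R v) = (c * c) *\<^sub>R Q v v" for c v
  proof -
    have smv: "smooth_on \<Omega> (\<lambda>y. P y v)" using smP by (simp add: smooth_lin_def)
    have "((\<lambda>y. c *\<^sub>R P y v) has_derivative (\<lambda>u. c *\<^sub>R dder (\<lambda>y. P y v) x u)) (at x)"
      by (intro has_derivative_scaleR_right smooth_on_has_derivative[OF smv x])
    moreover have "c *\<^sub>R P y v = P y (c *\<^sub>R v)" if "y \<in> \<Omega>" for y
      using linear_cmul[OF linP[OF that]] by simp
    ultimately have "((\<lambda>y. P y (c *\<^sub>R v)) has_derivative (\<lambda>u. c *\<^sub>R dder (\<lambda>y. P y v) x u)) (at x)"
      using has_derivative_cong_open[OF open_\<Omega> x, of "\<lambda>y. c *\<^sub>R P y v"] by simp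
    from dder_eqI[OF this] show ?thesis
      using linear_cmul[OF smooth_on_linear_dder[OF smv x]] linear_cmul[OF linP[OF x]]
      by (simp add: Q_def bilinear_simps[OF bilG[OF x]] algebra_simps)
  qed
  have "(r * r) *\<^sub>R (Q (X x) (X x) + Q (Y x) (Y x)) = 0"
    using P_div[OF x on] unfolding Q_def[symmetric] Qsc by (simp add: scaleR_add_right)
  then have div0: "Q (X x) (X x) + Q (Y x) (Y x) = 0" using r mx by simp
  have QX: "Q (X x) (X x) = dder m x (X x) *\<^sub>R X x + m x *\<^sub>R cov x (X x) X - P x (cov x (X x) X)"
    using cov_P[OF W sm(2), of "X x"] cov_cong[OF W(1,3), of "\<lambda>y. P y (X y)" "\<lambda>y. m y *\<^sub>R X y", OF PX]
      cov_scaleR[OF W(3) sm(1,2) W(2)] by (simp add: Q_def)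
  have QY: "Q (Y x) (Y x) = - dder m x (Y x) *\<^sub>R Y x - m x *\<^sub>R cov x (Y x) Y - P x (cov x (Y x) Y)"
  proof -
    have "dder (\<lambda>y. - m y) x u = - dder m x u" for u
      using dder_eqI[OF has_derivative_minus[OF smooth_on_has_derivative[OF sm(1) W(3)]]] by simp
    then show ?thesis
      using cov_P[OF W sm(3), of "Y x"] cov_cong[OF W(1,3), of "\<lambda>y. P y (Y y)" "\<lambda>y. - m y *\<^sub>R Y y", OF PY]
        cov_scaleR[OF W(3) smooth_on_uminus[OF W(1) sm(1)] sm(3) W(2)] by (simp add: Q_def)
  qed
  have dinv: "dder (\<lambda>y. g y (Z y) (Z y)) x u = - dder m x u / (2 * (m x)\<^sup>2)"
    if Z: "\<And>y. y \<in> W \<Longrightarrow> g y (Z y) (Z y) = 1 / (2 * m y)" for Z u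
  proof -
    have "((\<lambda>y. 1 / (2 * m y)) has_derivative (\<lambda>u. - dder m x u / (2 * (m x)\<^sup>2))) (at x)"
    proof -
      have "((\<lambda>z::real. 1 / (2 * z)) has_real_derivative - 1 / (2 * (m x)\<^sup>2)) (at (m x))"
        using mx by (auto intro!: derivative_eq_intros simp: power2_eq_square)
      from has_derivative_eq_rhs[OF DERIV_compose_FDERIV[OF this smooth_on_has_derivative[OF sm(1) W(3)]]]
      show ?thesis by (simp add: fun_eq_iff)
    qed
    then show ?thesis
      using dder_cong_open[OF W(1,3), of "\<lambda>y. g y (Z y) (Z y)" "\<lambda>y. 1 / (2 * m y)"] Z by (simp add: dder_eqI)
  qed
  have dX: "2 * g x (cov x u X) (X x) = - dder m x u / (2 * (m x)\<^sup>2)" for u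
    using cov_metric[OF W sm(2,2), of u] dinv[OF XX, of u] sym[of "X x" "cov x u X"] by simp
  have dY: "2 * g x (cov x u Y) (Y x) = - dder m x u / (2 * (m x)\<^sup>2)" for u
    using cov_metric[OF W sm(3,3), of u] dinv[OF YY, of u] sym[of "Y x" "cov x u Y"] by simp
  have dXY: "g x (cov x u X) (Y x) + g x (X x) (cov x u Y) = 0" for u
    using cov_metric[OF W sm(2,3), of u] dder_cong_open[OF W(1,3), of "\<lambda>y. g y (X y) (Y y)" "\<lambda>y. 0"] XY by simp
  note Px = PX[OF W(3)] PY[OF W(3)]
  \<comment> \<open>Paired with \<open>X\<close>, the two terms containing
    \<open>cov x (X x) X\<close> cancel since \<open>X\<close> belongs to the eigenvalue
    \<open>m\<close>, while those containing \<open>cov x (Y x) Y\<close> double since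
    \<open>Y\<close> belongs to \<open>- m\<close>.\<close>
  have e1: "dder m x (X x) / (2 * m x) = 2 * m x * g x (cov x (Y x) Y) (X x)"
  proof -
    have "g x (Q (X x) (X x) + Q (Y x) (Y x)) (X x) = 0" by (simp add: div0 gb)
    then show ?thesis
      using XX[OF W(3)] XY[OF W(3)] sym[of "Y x" "X x"] by (simp add: QX QY gb P_sym[OF x] Px)
  qed
  have e2: "dder m x (Y x) / (2 * m x) = 2 * m x * g x (cov x (X x) X) (Y x)"
  proof -
    have "g x (Q (X x) (X x) + Q (Y x) (Y x)) (Y x) = 0" by (simp add: div0 gb)
    then show ?thesis
      using YY[OF W(3)] XY[OF W(3)] by (simp add: QX QY gb P_sym[OF x] Px)
  qed
  \<comment> \<open>By symmetry of \<open>G\<close> this is the Lie bracket of \<open>X\<close> and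
    \<open>Y\<close>.\<close>
  define D where "D = cov x (X x) Y - cov x (Y x) X"
  \<comment> \<open>Differentiating the orthogonality gives
    \<open>- g x (cov x (X x) X) (Y x)\<close>, and differentiating the squared length
    \<open>1 / (2 * m)\<close> gives a multiple of the derivative of \<open>m\<close> along
    \<open>Y\<close>. By \<open>e2\<close> the two are opposite: the scaling of the frame is chosen
    for this.\<close>
  have "g x D (X x) = 0"
  proof -
    have "g x (cov x (X x) Y) (X x) = - g x (cov x (X x) X) (Y x)"
      using dXY[of "X x"] sym[of "X x" "cov x (X x) Y"] by simp
    moreover have "g x (cov x (Y x) X) (X x) = - dder m x (Y x) / (2 * m x) / (2 * m x)"
      using dX[of "Y x"] mx by (simp add: power2_eq_square field_simps)
    ultimately show ?thesis unfolding minus_divide_left[symmetric] e2 using mx by (simp add: D_def gb)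
  qed
  moreover have "g x D (Y x) = 0"
  proof -
    have "g x (cov x (Y x) X) (Y x) = - g x (cov x (Y x) Y) (X x)"
      using dXY[of "Y x"] sym[of "X x" "cov x (Y x) Y"] by simp
    moreover have "g x (cov x (X x) Y) (Y x) = - dder m x (X x) / (2 * m x) / (2 * m x)"
      using dY[of "X x"] mx by (simp add: power2_eq_square field_simps)
    ultimately show ?thesis unfolding minus_divide_left[symmetric] e1 using mx by (simp add: D_def gb)
  qed
  ultimately have "D = 0"
    using orthogonal_pair_expansion[OF g[OF x], of "X x" "Y x" D] XX[OF W(3)] YY[OF W(3)] XY[OF W(3)] mx by simp
  then show ?thesis using G_sym[OF x, of "X x" "Y x"] by (simp add: D_def cov_def)
qed

end

text \<open>Cartan's formula: the exterior derivative of \<open>\<eta>\<close> on the frame consists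
  of the derivatives of the constants \<open>a\<close>, \<open>b\<close> and of
  \<open>\<eta>\<close> on the bracket, and all of them vanish. Since the frame spans, bilinearity
  extends this to all directions.\<close>

lemma coframe_closed:
  fixes \<eta> :: "real^2 \<Rightarrow> real^2 \<Rightarrow> real"
  assumes W: "open W" "x \<in> W" and \<eta>: "smooth_lin W \<eta>" and sm: "smooth_on W X" "smooth_on W Y"
    and const: "\<And>y. y \<in> W \<Longrightarrow> \<eta> y (X y) = a" "\<And>y. y \<in> W \<Longrightarrow> \<eta> y (Y y) = b"
    and br: "dder Y x (X x) = dder X x (Y x)"
    and span: "\<And>v. \<exists>s t. v = s *\<^sub>R X x + t *\<^sub>R Y x"
  shows "dder (\<lambda>y. \<eta> y w) x v = dder (\<lambda>y. \<eta> y v) x w"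
proof -
  define B where "B v w = dder (\<lambda>y. \<eta> y w) x v" for v w
  have sm\<eta>: "smooth_on W (\<lambda>y. \<eta> y w)" for w using \<eta> by (simp add: smooth_lin_def)
  have lin: "linear (\<eta> y)" if "y \<in> W" for y using \<eta> that by (simp add: smooth_lin_def)
  have B1: "B (s *\<^sub>R u + t *\<^sub>R v) w = s * B u w + t * B v w" for s t u v w
    using smooth_on_linear_dder[OF sm\<eta> W(2), of w] by (simp add: B_def linear_add linear_cmul)
  have B2: "B w (s *\<^sub>R u + t *\<^sub>R v) = s * B w u + t * B w v" for s t u v w
  proof -
    have "((\<lambda>y. s * \<eta> y u + t * \<eta> y v) has_derivative (\<lambda>w. s * B w u + t * B w v)) (at x)"
      unfolding B_def
      by (intro has_derivative_add has_derivative_mult_right smooth_on_has_derivative[OF sm\<eta> W(2)])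
    then have "((\<lambda>y. \<eta> y (s *\<^sub>R u + t *\<^sub>R v)) has_derivative (\<lambda>w. s * B w u + t * B w v)) (at x)"
      using has_derivative_cong_open[OF W, of "\<lambda>y. \<eta> y (s *\<^sub>R u + t *\<^sub>R v)" "\<lambda>y. s * \<eta> y u + t * \<eta> y v"]
      by (simp add: lin linear_add linear_cmul)
    from dder_eqI[OF this] show ?thesis by (simp add: B_def)
  qed
  have BX: "B v (X x) = - \<eta> x (dder X x v)" for v
    using smooth_lin_dder[OF W(1) \<eta> sm(1) W(2), of v] dder_cong_open[OF W, of "\<lambda>y. \<eta> y (X y)" "\<lambda>y. a"] const(1)
    by (simp add: B_def)
  have BY: "B v (Y x) = - \<eta> x (dder Y x v)" for v
    using smooth_lin_dder[OF W(1) \<eta> sm(2) W(2), of v] dder_cong_open[OF W, of "\<lambda>y. \<eta> y (Y y)" "\<lambda>y. b"] const(2)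
    by (simp add: B_def)
  have BXY: "B (X x) (Y x) = B (Y x) (X x)" unfolding BX BY br ..
  obtain s t where v: "v = s *\<^sub>R X x + t *\<^sub>R Y x" using span[of v] by (elim exE)
  obtain s' t' where w: "w = s' *\<^sub>R X x + t' *\<^sub>R Y x" using span[of w] by (elim exE)
  have "B v w = B w v" unfolding v w B1 B2 by (simp add: BXY algebra_simps)
  then show ?thesis by (simp add: B_def)
qed

lemma open_Collect_pos:
  fixes f :: "'a::topological_space \<Rightarrow> real"
  assumes "open S" "continuous_on S f" shows "open {x \<in> S. f x > 0}"
proof -
  have "{x \<in> S. f x > 0} = S \<inter> f -` {0<..}" by auto
  then show ?thesis using continuous_open_preimage[OF assms(2,1), of "{0<..}"] by simp
qed

context codazzi_data
begin

text \<open>As the square of \<open>P\<close> is \<open>m\<close> squared times the identity,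
  \<open>P + m\<close> and \<open>P - m\<close> map every vector into an eigenspace. Applied to
  fixed vectors they give smooth eigenfields, nonzero near \<open>x0\<close> as soon as they are
  nonzero at \<open>x0\<close>.\<close>

lemma principal_frame:
  assumes x0: "x0 \<in> \<Omega>" and v0: "A x0 v0 \<noteq> k *\<^sub>R v0"
  shows "\<exists>W m X Y. open W \<and> x0 \<in> W \<and> W \<subseteq> \<Omega> \<and> smooth_on W m \<and> smooth_on W X \<and> smooth_on W Y \<and>
    (\<forall>y\<in>W. m y > 0 \<and> P y (X y) = m y *\<^sub>R X y \<and> P y (Y y) = - m y *\<^sub>R Y y \<and>
      g y (X y) (X y) = 1 / (2 * m y) \<and> g y (Y y) (Y y) = 1 / (2 * m y) \<and> g y (X y) (Y y) = 0)"
proof -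
  define e :: "real^2" where "e = axis 1 1"
  have e: "e \<noteq> 0" by (simp add: e_def axis_eq_0_iff)
  define q where "q x = g x (P x e) (P x e) / g x e e" for x
  have smPv: "smooth_on \<Omega> (\<lambda>x. P x v)" for v using smP by (simp add: smooth_lin_def)
  have q: "smooth_on \<Omega> q"
    unfolding q_def
  proof (rule smooth_on_divide[OF open_\<Omega>])
    show "smooth_on \<Omega> (\<lambda>x. g x (P x e) (P x e))"
      by (rule smooth_bil_apply[OF open_\<Omega> smg smPv smPv])
    show "smooth_on \<Omega> (\<lambda>x. g x e e)" using smg by (simp add: smooth_bil_def)
    show "g x e e > 0" if "x \<in> \<Omega>" for x using inner_form_pos[OF g[OF that] e] .
  qed
  have sq: "P x (P x v) = q x *\<^sub>R v" "g x (P x v) (P x v) = q x * g x v v" if "x \<in> \<Omega>" for x v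
  proof -
    have 1: "inner_form (g x)" "linear (P x)" "\<And>v w. g x (P x v) w = g x v (P x w)"
        "\<And>a b. on_pair (g x) a b \<Longrightarrow> g x (P x a) a + g x (P x b) b = 0"
      by (fact g[OF that] linP[OF that] P_sym[OF that] P_trace[OF that])+
    show "P x (P x v) = q x *\<^sub>R v" "g x (P x v) (P x v) = q x * g x v v"
      unfolding q_def
      by (rule traceless_symmetric_square[where g = "g x" and P = "P x" and e = e, OF 1 e], assumption)+
  qed
  have q0: "q x0 > 0"
  proof -
    have "P x0 v0 \<noteq> 0" using v0 by (simp add: P_def)
    then have "q x0 * g x0 v0 v0 > 0" using sq(2)[OF x0] inner_form_pos[OF g[OF x0]] by metis
    moreover have "g x0 v0 v0 \<ge> 0"
      using inner_form_pos[OF g[OF x0], of v0] gb(7)[OF x0] by (cases "v0 = 0") (auto simp: less_imp_le)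
    ultimately show ?thesis by (simp add: zero_less_mult_iff)
  qed
  define \<Omega>1 where "\<Omega>1 = {x \<in> \<Omega>. q x > 0}"
  have \<Omega>1: "open \<Omega>1" "x0 \<in> \<Omega>1" "\<Omega>1 \<subseteq> \<Omega>"
    using open_Collect_pos[OF open_\<Omega> smooth_on_continuous_on[OF q]] q0 x0 by (auto simp: \<Omega>1_def)
  define m where "m x = sqrt (q x)" for x
  have m: "m x > 0" "m x * m x = q x" if "x \<in> \<Omega>1" for x using that by (auto simp: m_def \<Omega>1_def)
  have smm: "smooth_on \<Omega>1 m"
    unfolding m_def by (rule smooth_on_sqrt[OF \<Omega>1(1) smooth_on_mono[OF q \<Omega>1(3)]]) (simp add: \<Omega>1_def)
  obtain b where on: "on_pair (g x0) ((1 / sqrt (g x0 e e)) *\<^sub>R e) b"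
    using on_pair_exists[OF g[OF x0] e] by blast
  \<comment> \<open>If \<open>P x0\<close> were the scalar \<open>- s\<close>, its trace
    \<open>- 2 * s\<close> would have to vanish.\<close>
  have ex: "\<exists>w. P x0 w + s *\<^sub>R w \<noteq> 0" if "s \<noteq> 0" for s
  proof (rule ccontr)
    assume "\<not> ?thesis"
    then have "P x0 w = - s *\<^sub>R w" for w by (simp add: eq_neg_iff_add_eq_0)
    then show False using P_trace[OF x0 on] on that by (simp add: gb[OF x0] on_pair_def)
  qed
  obtain w1 where w1: "P x0 w1 + m x0 *\<^sub>R w1 \<noteq> 0" using ex[of "m x0"] m(1)[OF \<Omega>1(2)] by auto
  obtain w2 where w2: "P x0 w2 - m x0 *\<^sub>R w2 \<noteq> 0" using ex[of "- m x0"] m(1)[OF \<Omega>1(2)] by auto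
  define u1 where "u1 x = P x w1 + m x *\<^sub>R w1" for x
  define u2 where "u2 x = P x w2 - m x *\<^sub>R w2" for x
  have smu: "smooth_on \<Omega>1 u1" "smooth_on \<Omega>1 u2"
    unfolding u1_def u2_def using \<Omega>1(1)
    by (intro smooth_on_add smooth_on_diff smooth_on_scaleR smooth_on_const smooth_on_mono[OF smPv \<Omega>1(3)] smm; assumption)+
  have Pu: "P x (u1 x) = m x *\<^sub>R u1 x" "P x (u2 x) = - m x *\<^sub>R u2 x" if "x \<in> \<Omega>1" for x
  proof -
    have x: "x \<in> \<Omega>" using that \<Omega>1 by auto
    note lin = linear_add[OF linP[OF x]] linear_diff[OF linP[OF x]] linear_cmul[OF linP[OF x]]
    show "P x (u1 x) = m x *\<^sub>R u1 x" "P x (u2 x) = - m x *\<^sub>R u2 x"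
      by (simp_all add: u1_def u2_def lin sq(1)[OF x] m(2)[OF that, symmetric] scaleR_add_right scaleR_diff_right)
  qed
  note smg1 = smooth_bil_mono[OF smg \<Omega>1(3)]
  define n1 n2 where "n1 x = g x (u1 x) (u1 x)" and "n2 x = g x (u2 x) (u2 x)" for x
  have smn: "smooth_on \<Omega>1 n1" "smooth_on \<Omega>1 n2"
    unfolding n1_def n2_def
    by (rule smooth_bil_apply[OF \<Omega>1(1) smg1 smu(1) smu(1)], rule smooth_bil_apply[OF \<Omega>1(1) smg1 smu(2) smu(2)])
  define W where "W = {x \<in> \<Omega>1. n1 x > 0} \<inter> {x \<in> \<Omega>1. n2 x > 0}"
  have W: "open W" "W \<subseteq> \<Omega>1"
    unfolding W_def using open_Collect_pos[OF \<Omega>1(1) smooth_on_continuous_on] smn by auto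
  have "x0 \<in> W"
    using w1 w2 \<Omega>1(2) inner_form_pos[OF g[OF x0]] by (auto simp: W_def n1_def n2_def u1_def u2_def)
  \<comment> \<open>Dividing by \<open>sqrt (n1 x)\<close> gives unit length; the remaining factor
    is \<open>1 / sqrt \<mu>\<close> with \<open>\<mu> = 2 * m\<close>.\<close>
  define X where "X x = (1 / sqrt (2 * m x * n1 x)) *\<^sub>R u1 x" for x
  define Y where "Y x = (1 / sqrt (2 * m x * n2 x)) *\<^sub>R u2 x" for x
  have pos: "m x * n1 x > 0" "m x * n2 x > 0" "m x > 0" "n1 x > 0" "n2 x > 0" if "x \<in> W" for x
    using that m(1) W(2) by (auto simp: W_def)
  have "smooth_on W X" "smooth_on W Y"
    unfolding X_def Y_def using pos W
    by (intro smooth_on_scaleR smooth_on_divide smooth_on_sqrt smooth_on_mult smooth_on_const smooth_on_mono[OF smu(1)]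
        smooth_on_mono[OF smu(2)] smooth_on_mono[OF smm]
        smooth_on_mono[OF smn(1)] smooth_on_mono[OF smn(2)]; auto simp: mult.assoc)+
  moreover have "P y (X y) = m y *\<^sub>R X y \<and> P y (Y y) = - m y *\<^sub>R Y y \<and>
      g y (X y) (X y) = 1 / (2 * m y) \<and> g y (Y y) (Y y) = 1 / (2 * m y) \<and> g y (X y) (Y y) = 0" if yW: "y \<in> W" for y
  proof -
    have y1: "y \<in> \<Omega>1" and y: "y \<in> \<Omega>" using yW W \<Omega>1 by auto
    note p = pos[OF yW]
    have PX: "P y (X y) = m y *\<^sub>R X y" and PY: "P y (Y y) = - m y *\<^sub>R Y y"
      by (simp_all add: X_def Y_def linear_cmul[OF linP[OF y]] Pu[OF y1] mult.commute)
    have "m y * g y (X y) (Y y) = - m y * g y (X y) (Y y)"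
      using P_sym[OF y, of "X y" "Y y"] unfolding PX PY by (simp add: gb[OF y])
    then have "g y (X y) (Y y) = 0" using p by simp
    moreover have "g y (X y) (X y) = 1 / (2 * m y)" "g y (Y y) (Y y) = 1 / (2 * m y)"
    proof -
      have rs: "1 / sqrt a * (1 / sqrt a * n) = n / a" if "a > 0" for a n :: real
        using that by (simp add: field_simps)
      have "2 * m y * n1 y > 0" "2 * m y * n2 y > 0" using p by (simp_all add: mult.assoc)
      then show "g y (X y) (X y) = 1 / (2 * m y)" "g y (Y y) (Y y) = 1 / (2 * m y)"
        unfolding X_def Y_def using p
        by (simp_all only: gb[OF y] n1_def[symmetric] n2_def[symmetric] rs real_scaleR_def) simp_all
    qed
    ultimately show ?thesis using PX PY by simp
  qed
  ultimately show ?thesis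
    using W \<Omega>1 \<open>x0 \<in> W\<close> pos(3) smooth_on_mono[OF smm W(2)]
    by (intro exI[of _ W] exI[of _ m] exI[of _ X] exI[of _ Y]) auto
qed

text \<open>The components of \<open>\<psi>\<close> are potentials of the coframe dual to the
  commuting eigenframe, so the derivative of \<open>\<psi>\<close> carries \<open>X\<close> and
  \<open>Y\<close> to the standard basis. Metric and shape operator, diagonal in the frame, become
  diagonal in the new coordinates.\<close>

lemma adapted_coordinates:
  assumes x0: "x0 \<in> \<Omega>" and v0: "A x0 v0 \<noteq> k *\<^sub>R v0"
  shows "\<exists>W (\<psi> :: real^2 \<Rightarrow> real^2) \<mu>. open W \<and> x0 \<in> W \<and> W \<subseteq> \<Omega> \<and> smooth_on W \<psi> \<and> inj_on \<psi> W \<and> open (\<psi> ` W) \<and>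
    smooth_on (\<psi> ` W) (inv_into W \<psi>) \<and> smooth_on W \<mu> \<and>
    (\<forall>x\<in>W. \<mu> x > 0 \<and> (\<forall>v w. g x v w = (1 / \<mu> x) * (dder \<psi> x v \<bullet> dder \<psi> x w) \<and>
       g x (A x v) w = (k / \<mu> x + 1/2) * (dder \<psi> x v $ 1 * dder \<psi> x w $ 1) +
         (k / \<mu> x - 1/2) * (dder \<psi> x v $ 2 * dder \<psi> x w $ 2)))"
proof -
  obtain W m X Y where W: "open W" "x0 \<in> W" "W \<subseteq> \<Omega>"
    and sm: "smooth_on W m" "smooth_on W X" "smooth_on W Y"
    and frame: "\<forall>y\<in>W. m y > 0 \<and> P y (X y) = m y *\<^sub>R X y \<and> P y (Y y) = - m y *\<^sub>R Y y \<and>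
      g y (X y) (X y) = 1 / (2 * m y) \<and> g y (Y y) (Y y) = 1 / (2 * m y) \<and> g y (X y) (Y y) = 0"
    using principal_frame[OF assms] by (elim exE conjE) (rule that)
  have m: "m y > 0" and PX: "P y (X y) = m y *\<^sub>R X y" and PY: "P y (Y y) = - m y *\<^sub>R Y y"
    and XX: "g y (X y) (X y) = 1 / (2 * m y)" and YY: "g y (Y y) (Y y) = 1 / (2 * m y)"
    and XY: "g y (X y) (Y y) = 0" if "y \<in> W" for y
    using bspec[OF frame that] by simp_all
  \<comment> \<open>The factor \<open>2 * m x\<close> is the reciprocal of the squared length of the
    frame vectors, which makes this the dual coframe.\<close>
  define \<eta>1 \<eta>2 where "\<eta>1 x v = 2 * m x * g x (X x) v" and "\<eta>2 x v = 2 * m x * g x (Y x) v" for x v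
  note smgW = smooth_bil_mono[OF smg W(3)]
  have sm\<eta>: "smooth_lin W \<eta>1" "smooth_lin W \<eta>2"
    using smooth_bil_lin2'[OF W(1) smgW sm(2)] smooth_bil_lin2'[OF W(1) smgW sm(3)] W(1) sm(1)
    unfolding \<eta>1_def \<eta>2_def smooth_lin_def
    by (auto intro!: smooth_intros linearI simp: linear_add linear_cmul algebra_simps)
  have inW: "x \<in> \<Omega>" if "x \<in> W" for x using that W by auto
  have dual: "\<eta>1 x (X x) = 1" "\<eta>1 x (Y x) = 0" "\<eta>2 x (X x) = 0" "\<eta>2 x (Y x) = 1" if "x \<in> W" for x
    using XX[OF that] YY[OF that] XY[OF that] m[OF that] inner_form_sym[OF g[OF inW[OF that]], of "Y x" "X x"]
    by (auto simp: \<eta>1_def \<eta>2_def)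
  have expand: "v = \<eta>1 x v *\<^sub>R X x + \<eta>2 x v *\<^sub>R Y x" if "x \<in> W" for x v
    using orthogonal_pair_expansion[OF g[OF inW[OF that]], of "X x" "Y x" v] XX[OF that] YY[OF that] XY[OF that] m[OF that]
      inner_form_sym[OF g[OF inW[OF that]], of v]
    by (simp add: \<eta>1_def \<eta>2_def mult_ac)
  have closed: "dder (\<lambda>y. \<eta>1 y w) x v = dder (\<lambda>y. \<eta>1 y v) x w" "dder (\<lambda>y. \<eta>2 y w) x v = dder (\<lambda>y. \<eta>2 y v) x w"
    if "x \<in> W" for x v w
    using coframe_closed[OF W(1) that sm\<eta>(1) sm(2,3) dual(1,2)] coframe_closed[OF W(1) that sm\<eta>(2) sm(2,3) dual(3,4)]
      eigenframe_commutes[OF W(1,3) that sm m PX PY XX YY XY] expand[OF that] by metis+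
  \<comment> \<open>Potentials come from the Poincare lemma on a ball, hence the shrinking.\<close>
  obtain r where r: "r > 0" "ball x0 r \<subseteq> W" using W by (auto simp: open_contains_ball)
  have pot: "\<exists>f::real^2 \<Rightarrow> real. \<forall>x\<in>ball x0 r. (f has_derivative \<eta> x) (at x)"
    if sme: "smooth_lin W \<eta>" and cl: "\<And>x v w. x \<in> W \<Longrightarrow> dder (\<lambda>y. \<eta> y w) x v = dder (\<lambda>y. \<eta> y v) x w" for \<eta>
  proof -
    define \<theta> where "\<theta> x = (\<Sum>b\<in>Basis. \<eta> x b *\<^sub>R b)" for x
    have \<theta>: "\<theta> x \<bullet> v = \<eta> x v" if "x \<in> W" for x v
    proof -
      have "\<eta> x v = (\<Sum>b\<in>Basis. (v \<bullet> b) *\<^sub>R \<eta> x b)"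
        by (rule linear_eucl_expand) (use sme that in \<open>simp add: smooth_lin_def\<close>)
      then show ?thesis
        unfolding \<theta>_def inner_sum_left inner_scaleR_left by (simp add: inner_commute[of v] mult.commute)
    qed
    have sm\<theta>: "smooth_on W \<theta>"
      unfolding \<theta>_def using sme W(1) by (intro smooth_intros) (auto simp: smooth_lin_def)
    have "dder \<theta> x v \<bullet> w = dder (\<lambda>y. \<eta> y w) x v" if "x \<in> W" for x v w
      using dder_inner[OF smooth_on_differentiable[OF sm\<theta> that], of w v]
        dder_cong_open[OF W(1) that, of "\<lambda>y. \<theta> y \<bullet> w" "\<lambda>y. \<eta> y w"] \<theta> by simp
    then have "\<exists>f::real^2 \<Rightarrow> real. \<forall>x\<in>ball x0 r. (f has_derivative (\<lambda>v. \<theta> x \<bullet> v)) (at x)"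
      using cl r by (intro closed_form_potential smooth_on_mono[OF sm\<theta>]) auto
    moreover have "(\<lambda>v. \<theta> x \<bullet> v) = \<eta> x" if "x \<in> ball x0 r" for x using \<theta> r that by auto
    ultimately show ?thesis by metis
  qed
  obtain f1 where f1: "\<And>x. x \<in> ball x0 r \<Longrightarrow> (f1 has_derivative \<eta>1 x) (at x)" using pot[OF sm\<eta>(1) closed(1)] by metis
  obtain f2 where f2: "\<And>x. x \<in> ball x0 r \<Longrightarrow> (f2 has_derivative \<eta>2 x) (at x)" using pot[OF sm\<eta>(2) closed(2)] by metis
  define \<psi> :: "real^2 \<Rightarrow> real^2" where "\<psi> x = f1 x *\<^sub>R axis 1 1 + f2 x *\<^sub>R axis 2 1" for x
  have d\<psi>: "(\<psi> has_derivative (\<lambda>v. \<eta>1 x v *\<^sub>R axis 1 1 + \<eta>2 x v *\<^sub>R axis 2 1)) (at x)" if "x \<in> ball x0 r" for x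
    unfolding \<psi>_def by (intro has_derivative_add has_derivative_scaleR_left f1 f2 that)
  note dd\<psi> = dder_eqI[OF d\<psi>]
  have comp: "dder \<psi> x v $ 1 = \<eta>1 x v" "dder \<psi> x v $ 2 = \<eta>2 x v" if "x \<in> ball x0 r" for x v
    by (simp_all add: dd\<psi>[OF that] axis_def)
  have sm\<psi>: "smooth_on (ball x0 r) \<psi>"
  proof (rule smooth_on_dderI)
    show "\<psi> differentiable (at x)" if "x \<in> ball x0 r" for x using d\<psi>[OF that] by (rule Derivative.differentiableI)
    fix v
    have "smooth_on (ball x0 r) (\<lambda>x. \<eta>1 x v *\<^sub>R axis 1 1 + \<eta>2 x v *\<^sub>R (axis 2 1 :: real^2))"
      using sm\<eta> r(2) by (intro smooth_intros open_ball) (auto simp: smooth_lin_def intro: smooth_on_mono)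
    then show "smooth_on (ball x0 r) (\<lambda>x. dder \<psi> x v)"
      by (subst smooth_on_cong[OF open_ball]) (auto simp: dd\<psi>)
  qed
  \<comment> \<open>Inverse of the derivative of \<open>\<psi>\<close>: the standard basis goes back
    to the frame.\<close>
  define E where "E x v = (v $ 1) *\<^sub>R X x + (v $ 2) *\<^sub>R Y x" for x and v :: "real^2"
  have smE: "smooth_lin (ball x0 r) E"
    unfolding smooth_lin_def E_def using sm r(2)
    by (auto intro!: smooth_intros linearI simp: algebra_simps intro: smooth_on_mono)
  have "\<exists>U. open U \<and> x0 \<in> U \<and> U \<subseteq> ball x0 r \<and> inj_on \<psi> U \<and> open (\<psi> ` U) \<and> smooth_on (\<psi> ` U) (inv_into U \<psi>)"
  proof (rule smooth_local_diffeomorphism[OF open_ball _ sm\<psi> smE])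
    fix x v assume x: "x \<in> ball x0 r"
    then have xW: "x \<in> W" using r by auto
    have l: "linear (\<eta>1 x)" "linear (\<eta>2 x)" using sm\<eta> xW by (auto simp: smooth_lin_def)
    show "dder \<psi> x (E x v) = v"
      by (simp add: vec_eq_iff forall_2 comp[OF x] E_def l linear_add linear_cmul dual[OF xW])
    show "E x (dder \<psi> x v) = v"
      using expand[OF xW, of v] by (simp add: E_def comp[OF x])
  qed (use r in auto)
  then obtain U where U: "open U" "x0 \<in> U" "U \<subseteq> ball x0 r" "inj_on \<psi> U" "open (\<psi> ` U)" "smooth_on (\<psi> ` U) (inv_into U \<psi>)"
    by blast
  have form: "g x v w = (1 / (2 * m x)) * (dder \<psi> x v \<bullet> dder \<psi> x w)"
    "g x (A x v) w = (k / (2 * m x) + 1/2) * (dder \<psi> x v $ 1 * dder \<psi> x w $ 1) +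
         (k / (2 * m x) - 1/2) * (dder \<psi> x v $ 2 * dder \<psi> x w $ 2)" if x: "x \<in> U" for x v w
  proof -
    have xb: "x \<in> ball x0 r" and xW: "x \<in> W" and x\<Omega>: "x \<in> \<Omega>" using x U r W by auto
    note gb = gb[OF x\<Omega>]
    have w: "g x (X x) w = \<eta>1 x w / (2 * m x)" "g x (Y x) w = \<eta>2 x w / (2 * m x)" for w
      using m[OF xW] by (simp_all add: \<eta>1_def \<eta>2_def)
    have gvw: "g x v w = (\<eta>1 x v * \<eta>1 x w + \<eta>2 x v * \<eta>2 x w) / (2 * m x)" for v w
      by (subst expand[OF xW, of v]) (simp add: gb w add_divide_distrib)
    then show "g x v w = (1 / (2 * m x)) * (dder \<psi> x v \<bullet> dder \<psi> x w)"
      by (simp add: inner_vec_def sum_2 comp[OF xb])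
    have Pv: "P x v = m x *\<^sub>R (\<eta>1 x v *\<^sub>R X x) - m x *\<^sub>R (\<eta>2 x v *\<^sub>R Y x)"
      by (subst expand[OF xW, of v])
        (simp add: linear_add[OF linP[OF x\<Omega>]] linear_cmul[OF linP[OF x\<Omega>]] PX[OF xW] PY[OF xW] mult.commute)
    have "g x (A x v) w = g x (P x v) w + k * g x v w" by (simp add: P_def gb)
    also have "g x (P x v) w = (\<eta>1 x v * \<eta>1 x w - \<eta>2 x v * \<eta>2 x w) / 2"
      using m[OF xW] by (simp add: Pv gb w field_simps)
    finally show "g x (A x v) w = (k / (2 * m x) + 1/2) * (dder \<psi> x v $ 1 * dder \<psi> x w $ 1) +
         (k / (2 * m x) - 1/2) * (dder \<psi> x v $ 2 * dder \<psi> x w $ 2)"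
      unfolding gvw comp[OF xb] by (simp add: algebra_simps add_divide_distrib diff_divide_distrib)
  qed
  have UW: "U \<subseteq> W" using U r by auto
  have "smooth_on U (\<lambda>x. 2 * m x)" using smooth_on_mono[OF sm(1) UW] U(1) by (intro smooth_intros)
  moreover have "U \<subseteq> \<Omega>" "smooth_on U \<psi>" "\<And>x. x \<in> U \<Longrightarrow> 2 * m x > 0"
    using UW W(3) smooth_on_mono[OF sm\<psi> U(3)] m by auto
  ultimately show ?thesis
    by (intro exI[of _ U] exI[of _ \<psi>] exI[of _ "\<lambda>x. 2 * m x"] conjI ballI allI)
      (rule U | assumption | erule form | blast)+
qed

end

subsection \<open>Germs of smooth functions\<close>

definition smooth_at :: "'a::real_normed_vector \<Rightarrow> ('a \<Rightarrow> 'b::real_normed_vector) \<Rightarrow> bool" where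
  "smooth_at x f \<longleftrightarrow> (\<exists>W. open W \<and> x \<in> W \<and> smooth_on W f)"

lemma smooth_atI: "open W \<Longrightarrow> x \<in> W \<Longrightarrow> smooth_on W f \<Longrightarrow> smooth_at x f"
  by (auto simp: smooth_at_def)

lemma smooth_at_differentiable: "smooth_at x f \<Longrightarrow> f differentiable (at x)"
  by (auto simp: smooth_at_def intro: smooth_on_differentiable)

lemma smooth_at_cong:
  fixes f g :: "'a::real_normed_vector \<Rightarrow> 'b::real_normed_vector"
  assumes "open W" "x \<in> W" "\<And>y. y \<in> W \<Longrightarrow> f y = g y"
  shows "smooth_at x f \<longleftrightarrow> smooth_at x g"
proof -
  have *: "smooth_at x g" if h: "smooth_at x f" "\<And>y. y \<in> W \<Longrightarrow> f y = g y" for f g :: "'a \<Rightarrow> 'b"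
  proof -
    obtain V where V: "open V" "x \<in> V" "smooth_on V f" using h(1) by (auto simp: smooth_at_def)
    have "smooth_on (V \<inter> W) g"
      using smooth_on_mono[OF V(3), of "V \<inter> W"] smooth_on_cong[of "V \<inter> W" f g] h(2) V assms(1) by auto
    then show ?thesis using V assms by (intro smooth_atI[of "V \<inter> W"]) auto
  qed
  show ?thesis using *[of f g] *[of g f] assms(3) by auto
qed

lemma smooth_at_compose:
  fixes g :: "'a::real_normed_vector \<Rightarrow> 'b::euclidean_space"
  assumes "smooth_at x g" "smooth_at (g x) f"
  shows "smooth_at x (\<lambda>x. f (g x))"
proof -
  obtain V where V: "open V" "x \<in> V" "smooth_on V g" using assms(1) by (auto simp: smooth_at_def)
  obtain W where W: "open W" "g x \<in> W" "smooth_on W f" using assms(2) by (auto simp: smooth_at_def)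
  have "open (V \<inter> g -` W)"
    using continuous_open_preimage[OF smooth_on_continuous_on[OF V(3)] V(1) W(1)] .
  moreover have "smooth_on (V \<inter> g -` W) (\<lambda>x. f (g x))"
    using calculation W V by (intro smooth_on_compose[of _ W g f] smooth_on_mono[OF V(3)]) auto
  ultimately show ?thesis using V W by (intro smooth_atI[of "V \<inter> g -` W"]) auto
qed

lemma dder_compose_at:
  assumes "smooth_at x g" "smooth_at (g x) f"
  shows "dder (\<lambda>x. f (g x)) x v = dder f (g x) (dder g x v)"
proof -
  obtain V where V: "open V" "x \<in> V" "smooth_on V g" using assms(1) by (auto simp: smooth_at_def)
  obtain W where W: "open W" "g x \<in> W" "smooth_on W f" using assms(2) by (auto simp: smooth_at_def)
  show ?thesis by (rule dder_compose(1)[OF V(3,2) W(3,2)])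
qed

subsection \<open>Charts\<close>

lemma topological_chartD:
  assumes "topological_chart X c"
  shows "openin X (fst c)" "fst c \<subseteq> topspace X" "open (chart_img c)" "inj_on (snd c) (fst c)"
    "openin X U \<Longrightarrow> U \<subseteq> fst c \<Longrightarrow> open (snd c ` U)"
    "open W \<Longrightarrow> openin X {q \<in> fst c. snd c q \<in> W}"
proof -
  show 1: "openin X (fst c)" and 3: "open (chart_img c)" using assms by (auto simp: topological_chart_def)
  show 2: "fst c \<subseteq> topspace X" using 1 by (rule openin_subset)
  have h: "homeomorphic_map (subtopology X (fst c)) (top_of_set (chart_img c)) (snd c)"
    using assms by (simp add: topological_chart_def)
  have ts: "topspace (subtopology X (fst c)) = fst c" using 2 by auto
  show "inj_on (snd c) (fst c)" using homeomorphic_imp_injective_map[OF h] ts by simp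
  show "open (snd c ` U)" if "openin X U" "U \<subseteq> fst c"
  proof -
    have "openin (subtopology X (fst c)) U" using that by (simp add: openin_subtopology) blast
    then have "openin (top_of_set (chart_img c)) (snd c ` U)"
      using homeomorphic_imp_open_map[OF h] by (simp add: open_map_def)
    then show ?thesis using 3 openin_open_trans by blast
  qed
  show "openin X {q \<in> fst c. snd c q \<in> W}" if "open W"
  proof -
    have "openin (top_of_set (chart_img c)) (chart_img c \<inter> W)" using that by (simp add: openin_open_Int)
    from openin_continuous_map_preimage[OF homeomorphic_imp_continuous_map[OF h] this]
    have "openin (subtopology X (fst c)) {q \<in> topspace (subtopology X (fst c)). snd c q \<in> chart_img c \<inter> W}" .
    then have "openin X {q \<in> topspace (subtopology X (fst c)). snd c q \<in> chart_img c \<inter> W}"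
      using openin_trans_full 1 by blast
    moreover have "{q \<in> topspace (subtopology X (fst c)). snd c q \<in> chart_img c \<inter> W} = {q \<in> fst c. snd c q \<in> W}"
      using ts by auto
    ultimately show ?thesis by simp
  qed
qed

definition chart_through :: "('a, 'm) chart \<Rightarrow> (real^'m \<Rightarrow> real^'m) \<Rightarrow> (real^'m) set \<Rightarrow> ('a, 'm) chart" where
  "chart_through c \<psi> W = ({q \<in> fst c. snd c q \<in> W}, \<lambda>q. \<psi> (snd c q))"

definition comps :: "('a, 'm::finite) chart \<Rightarrow> 'a tvec \<Rightarrow> real^'m" where
  "comps c u = (\<chi> i. coord_diff c i u)"

lemma coord_diff_comps: "coord_diff c i u = comps c u $ i"
  by (simp add: comps_def)

lemma comps_lincomb: "comps c (a *\<^sub>R u + b *\<^sub>R v) = a *\<^sub>R comps c u + b *\<^sub>R comps c v"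
  by (simp add: comps_def coord_diff_def vec_eq_iff)

locale smooth_mfd =
  fixes M :: "('a, 'm::finite) riem"
  assumes smooth_manifold: "smooth_manifold M"
begin

lemma atlas:
  shows "\<forall>c\<in>charts M. topological_chart (top_space M) c" "(\<Union>c\<in>charts M. fst c) = points M"
    "\<forall>c\<in>charts M. \<forall>d\<in>charts M. smoothly_compatible c d"
    "\<forall>c. topological_chart (top_space M) c \<and> (\<forall>d\<in>charts M. smoothly_compatible c d) \<longrightarrow> c \<in> charts M"
  using smooth_manifold unfolding smooth_manifold_def by - (elim conjE; assumption)+

lemma chart_topological: "c \<in> charts M \<Longrightarrow> topological_chart (top_space M) c"
  using atlas(1) by (rule bspec)

lemmas chartD = topological_chartD[OF chart_topological]

lemma chart_inv [simp]:
  assumes "c \<in> charts M"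
  shows "q \<in> fst c \<Longrightarrow> chart_inv c (snd c q) = q" "x \<in> chart_img c \<Longrightarrow> snd c (chart_inv c x) = x"
    "x \<in> chart_img c \<Longrightarrow> chart_inv c x \<in> fst c"
  using inv_into_f_f[OF chartD(4)[OF assms]] f_inv_into_f[of x "snd c" "fst c"] inv_into_into[of x "snd c" "fst c"]
  by simp_all

lemma chart_exists: "p \<in> points M \<Longrightarrow> \<exists>c\<in>charts M. p \<in> fst c"
  using atlas(2) by blast

lemma chart_points: "c \<in> charts M \<Longrightarrow> q \<in> fst c \<Longrightarrow> q \<in> points M"
  using chartD(2) by blast

lemma overlap_open: "c \<in> charts M \<Longrightarrow> d \<in> charts M \<Longrightarrow> open (snd c ` (fst c \<inter> fst d))"
  using chartD(5)[of c "fst c \<inter> fst d"] chartD(1) by (simp add: openin_Int)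

lemma transition_smooth:
  assumes "c \<in> charts M" "d \<in> charts M"
  shows "smooth_on (snd c ` (fst c \<inter> fst d)) (\<lambda>x. snd d (chart_inv c x))"
  using bspec[OF bspec[OF atlas(3) assms(1)] assms(2)] by (simp add: smoothly_compatible_def o_def)

lemma transition_smooth_at:
  assumes "c \<in> charts M" "d \<in> charts M" "p \<in> fst c" "p \<in> fst d"
  shows "smooth_at (snd c p) (\<lambda>x. snd d (chart_inv c x))"
  by (rule smooth_atI[OF overlap_open[OF assms(1,2)] _ transition_smooth[OF assms(1,2)]]) (use assms in auto)

text \<open>Composing a chart with a diffeomorphism of part of its image stays inside
  \<open>charts M\<close> because the atlas is maximal: it suffices that the result is a topological
  chart and compatible with every chart of the atlas.\<close>

lemma chart_through:
  assumes c: "c \<in> charts M" and W: "open W" "W \<subseteq> chart_img c" and \<psi>: "smooth_on W \<psi>" "inj_on \<psi> W" "open (\<psi> ` W)"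
    "smooth_on (\<psi> ` W) (inv_into W \<psi>)"
  shows "chart_through c \<psi> W \<in> charts M" "chart_img (chart_through c \<psi> W) = \<psi> ` W"
    "z \<in> \<psi> ` W \<Longrightarrow> chart_inv (chart_through c \<psi> W) z = chart_inv c (inv_into W \<psi> z)"
proof -
  define U where "U = {q \<in> fst c. snd c q \<in> W}"
  define c' where "c' = chart_through c \<psi> W"
  have c': "fst c' = U" "snd c' = (\<lambda>q. \<psi> (snd c q))" by (simp_all add: c'_def chart_through_def U_def)
  have cU: "snd c ` U = W" using W(2) by (auto simp: U_def)
  have img: "chart_img c' = \<psi> ` W" using cU by (auto simp: c')
  then show "chart_img (chart_through c \<psi> W) = \<psi> ` W" by (simp add: c'_def)
  have inj: "inj_on (snd c') U"
    using chartD(4)[OF c] \<psi>(2) by (auto simp: c' U_def inj_on_def)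
  have inv: "chart_inv c' z = chart_inv c (inv_into W \<psi> z)" if z: "z \<in> \<psi> ` W" for z
  proof -
    obtain q where q: "q \<in> U" "z = \<psi> (snd c q)" using z cU by auto
    then have "inv_into W \<psi> z = snd c q" using \<psi>(2) by (simp add: U_def)
    moreover have "chart_inv c' z = q" using inv_into_f_f[OF inj q(1)] q(2) by (simp add: c')
    ultimately show ?thesis using q c by (simp add: U_def)
  qed
  then show "z \<in> \<psi> ` W \<Longrightarrow> chart_inv (chart_through c \<psi> W) z = chart_inv c (inv_into W \<psi> z)"
    by (simp add: c'_def)
  have Uo: "openin (top_space M) U" unfolding U_def by (rule chartD(6)[OF c W(1)])
  have "homeomorphic_map (subtopology (top_space M) U) (top_of_set W) (snd c)"
  proof -
    have "homeomorphic_map (subtopology (top_space M) (fst c)) (top_of_set (chart_img c)) (snd c)"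
      using chart_topological[OF c] by (simp add: topological_chart_def)
    then have "homeomorphic_map (subtopology (subtopology (top_space M) (fst c)) U) (subtopology (top_of_set (chart_img c)) W) (snd c)"
      by (rule homeomorphic_map_subtopologies) (use cU W(2) chartD(2)[OF c] in \<open>auto simp: U_def\<close>)
    moreover have "fst c \<inter> U = U" "chart_img c \<inter> W = W" using W(2) by (auto simp: U_def)
    ultimately show ?thesis by (simp add: subtopology_subtopology)
  qed
  moreover have "homeomorphic_map (top_of_set W) (top_of_set (\<psi> ` W)) \<psi>"
  proof -
    have "homeomorphic_maps (top_of_set W) (top_of_set (\<psi> ` W)) \<psi> (inv_into W \<psi>)"
      unfolding homeomorphic_maps_def using smooth_on_continuous_on[OF \<psi>(1)] smooth_on_continuous_on[OF \<psi>(4)] \<psi>(2)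
      by (auto simp: f_inv_into_f inv_into_into)
    then show ?thesis by (metis homeomorphic_map_maps)
  qed
  ultimately have "homeomorphic_map (subtopology (top_space M) U) (top_of_set (\<psi> ` W)) (\<psi> \<circ> snd c)"
    by (rule homeomorphic_map_compose)
  then have top: "topological_chart (top_space M) c'"
    unfolding topological_chart_def img using Uo \<psi>(3) by (simp add: c' o_def)
  have "smoothly_compatible c' d" if d: "d \<in> charts M" for d
  proof -
    have Ud: "openin (top_space M) (U \<inter> fst d)" using Uo chartD(1)[OF d] by (rule openin_Int)
    have o1: "open (snd c' ` (U \<inter> fst d))" using topological_chartD(5)[OF top Ud] by (simp add: c')
    have o2: "open (snd d ` (U \<inter> fst d))" using chartD(5)[OF d Ud] by simp
    have sub1: "snd c' ` (U \<inter> fst d) \<subseteq> \<psi> ` W" using cU by (auto simp: c')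
    have invW: "inv_into W \<psi> (snd c' q) = snd c q" if "q \<in> U" for q
      using that \<psi>(2) by (simp add: c' U_def)
    have "smooth_on (snd c' ` (U \<inter> fst d)) (\<lambda>z. snd d (chart_inv c (inv_into W \<psi> z)))"
      by (rule smooth_on_compose[OF o1 overlap_open[OF c d] _ smooth_on_mono[OF \<psi>(4) sub1] transition_smooth[OF c d]])
        (auto simp: invW U_def)
    then have 1: "smooth_on (snd c' ` (U \<inter> fst d)) (snd d \<circ> chart_inv c')"
    proof (subst smooth_on_cong[OF o1])
      fix z assume "z \<in> snd c' ` (U \<inter> fst d)"
      then show "(snd d \<circ> chart_inv c') z = snd d (chart_inv c (inv_into W \<psi> z))"
        using inv[OF subsetD[OF sub1]] by simp
    qed
    have "smooth_on (snd d ` (U \<inter> fst d)) (\<lambda>z. \<psi> (snd c (chart_inv d z)))"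
      by (rule smooth_on_compose[OF o2 W(1) _ smooth_on_mono[OF transition_smooth[OF d c]] \<psi>(1)])
        (use d in \<open>auto simp: U_def\<close>)
    then show ?thesis using 1 by (simp add: smoothly_compatible_def c' o_def)
  qed
  then have "c' \<in> charts M" using top atlas(4) by blast
  then show "chart_through c \<psi> W \<in> charts M" by (simp add: c'_def)
qed

text \<open>\<open>smooth_near\<close> and \<open>smooth_field_near\<close> demand smoothness over
  the whole domain of some chart. To deduce them from information near one point, a chart must be
  cut down to that neighbourhood.\<close>

lemma restrict_chart:
  assumes c: "c \<in> charts M" and W: "open W" "W \<subseteq> chart_img c"
  shows "\<exists>c'\<in>charts M. fst c' = {q \<in> fst c. snd c q \<in> W} \<and> snd c' = snd c \<and> chart_img c' = W \<and>
    (\<forall>x\<in>W. chart_inv c' x = chart_inv c x)"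
proof -
  have inv: "inv_into W (\<lambda>x. x) z = z" if "z \<in> W" for z using inv_into_f_f[of "\<lambda>x. x" W z] that by simp
  have "smooth_on ((\<lambda>x. x) ` W) (inv_into W (\<lambda>x. x))"
    using smooth_on_cong[OF W(1), of "\<lambda>x. x" "inv_into W (\<lambda>x. x)"] inv smooth_on_id[of W] by simp
  note * = chart_through[OF c W smooth_on_id _ _ this]
  show ?thesis
    by (rule bexI[of _ "chart_through c (\<lambda>x. x) W"])
      (use * W(1) inv in \<open>auto simp: chart_through_def inj_on_def\<close>)
qed

text \<open>Smoothness of transition maps replaces the unknown chart of the definition by any given
  chart around the point.\<close>

lemma smooth_near_iff:
  assumes c: "c \<in> charts M" and p: "p \<in> fst c"
  shows "smooth_near M p f \<longleftrightarrow> smooth_at (snd c p) (\<lambda>x. f (chart_inv c x))"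
proof
  assume "smooth_near M p f"
  then obtain d where d: "d \<in> charts M" "p \<in> fst d" "smooth_on (chart_img d) (\<lambda>x. f (chart_inv d x))"
    by (auto simp: smooth_near_def o_def)
  have "smooth_at (snd d p) (\<lambda>x. f (chart_inv d x))"
    by (rule smooth_atI[OF chartD(3)[OF d(1)] _ d(3)]) (use d in auto)
  then have "smooth_at (snd c p) (\<lambda>x. f (chart_inv d (snd d (chart_inv c x))))"
    using smooth_at_compose[OF transition_smooth_at[OF c d(1) p d(2)], of "\<lambda>x. f (chart_inv d x)"] c p by simp
  then show "smooth_at (snd c p) (\<lambda>x. f (chart_inv c x))"
    by (subst smooth_at_cong[OF overlap_open[OF c d(1)], of _ _ "\<lambda>x. f (chart_inv d (snd d (chart_inv c x)))"])
      (use c d p in auto)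
next
  assume "smooth_at (snd c p) (\<lambda>x. f (chart_inv c x))"
  then obtain V where V: "open V" "snd c p \<in> V" "smooth_on V (\<lambda>x. f (chart_inv c x))" by (auto simp: smooth_at_def)
  define W where "W = V \<inter> chart_img c"
  have W: "open W" "W \<subseteq> chart_img c" "snd c p \<in> W" using V chartD(3)[OF c] p by (auto simp: W_def)
  obtain c' where c': "c' \<in> charts M" "fst c' = {q \<in> fst c. snd c q \<in> W}" "snd c' = snd c" "chart_img c' = W"
    "\<forall>x\<in>W. chart_inv c' x = chart_inv c x"
    using restrict_chart[OF c W(1,2)] by blast
  have "smooth_on W (\<lambda>x. f (chart_inv c x))" by (rule smooth_on_mono[OF V(3)]) (simp add: W_def)
  then have "smooth_on (chart_img c') (f \<circ> chart_inv c')"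
    unfolding c'(4) using smooth_on_cong[OF W(1), of "\<lambda>x. f (chart_inv c x)" "f \<circ> chart_inv c'"] c'(5) by simp
  then show "smooth_near M p f" using c' p W(3) by (auto simp: smooth_near_def)
qed

subsection \<open>Tangent vectors in coordinates\<close>

lemma chart_vec_apply:
  assumes "c \<in> charts M" "p \<in> fst c" "smooth_near M p f"
  shows "chart_vec M c p \<xi> f = dder (\<lambda>x. f (chart_inv c x)) (snd c p) \<xi>"
  using assms by (simp add: chart_vec_def o_def)

lemma chart_vec_linear:
  assumes c: "c \<in> charts M" "p \<in> fst c"
  shows "chart_vec M c p (a *\<^sub>R \<xi> + b *\<^sub>R \<eta>) = a *\<^sub>R chart_vec M c p \<xi> + b *\<^sub>R chart_vec M c p \<eta>"
proof
  fix f
  show "chart_vec M c p (a *\<^sub>R \<xi> + b *\<^sub>R \<eta>) f = (a *\<^sub>R chart_vec M c p \<xi> + b *\<^sub>R chart_vec M c p \<eta>) f"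
  proof (cases "smooth_near M p f")
    case True
    then have "linear (dder (\<lambda>x. f (chart_inv c x)) (snd c p))"
      using smooth_near_iff[OF c] smooth_at_differentiable dder_linear by blast
    then show ?thesis using True c by (simp add: chart_vec_apply linear_add linear_cmul)
  qed (simp add: chart_vec_def)
qed

lemma chart_vec_simps:
  assumes c: "c \<in> charts M" "p \<in> fst c"
  shows "chart_vec M c p (\<xi> + \<eta>) = chart_vec M c p \<xi> + chart_vec M c p \<eta>"
    "chart_vec M c p (\<xi> - \<eta>) = chart_vec M c p \<xi> - chart_vec M c p \<eta>"
    "chart_vec M c p (a *\<^sub>R \<xi>) = a *\<^sub>R chart_vec M c p \<xi>" "chart_vec M c p 0 = 0"
    "linear (chart_vec M c p)"
proof -
  show a: "chart_vec M c p (\<xi> + \<eta>) = chart_vec M c p \<xi> + chart_vec M c p \<eta>" for \<xi> \<eta>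
    using chart_vec_linear[OF c, of 1 \<xi> 1 \<eta>] by simp
  show s: "chart_vec M c p (a *\<^sub>R \<xi>) = a *\<^sub>R chart_vec M c p \<xi>" for a \<xi>
    using chart_vec_linear[OF c, of a \<xi> 0 \<xi>] by simp
  show l: "linear (chart_vec M c p)" by (rule linearI) (rule a, rule s)
  show "chart_vec M c p (\<xi> - \<eta>) = chart_vec M c p \<xi> - chart_vec M c p \<eta>" "chart_vec M c p 0 = 0"
    using l by (rule linear_diff, rule linear_0)
qed

lemma smooth_near_coord:
  assumes c: "c \<in> charts M" "p \<in> fst c" shows "smooth_near M p (\<lambda>q. snd c q $ i)"
  unfolding smooth_near_iff[OF c]
proof (rule smooth_atI[OF chartD(3)[OF c(1)]])
  show "smooth_on (chart_img c) (\<lambda>x. snd c (chart_inv c x) $ i)"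
    by (subst smooth_on_cong[OF chartD(3)[OF c(1)], of _ "\<lambda>x. x $ i"])
      (use c in \<open>auto intro!: smooth_intros chartD(3)\<close>)
qed (use c in auto)

lemma comps_chart_vec_change:
  assumes c: "c \<in> charts M" "p \<in> fst c" and d: "d \<in> charts M" "p \<in> fst d"
  shows "comps d (chart_vec M c p \<xi>) = dder (\<lambda>x. snd d (chart_inv c x)) (snd c p) \<xi>"
proof -
  note t = smooth_at_differentiable[OF transition_smooth_at[OF c(1) d(1) c(2) d(2)]]
  have "dder (\<lambda>x. snd d (chart_inv c x) $ i) (snd c p) \<xi> = dder (\<lambda>x. snd d (chart_inv c x)) (snd c p) \<xi> $ i" for i
    using dder_eqI[OF bounded_linear.has_derivative[OF bounded_linear_vec_nth dder_works[OF t], of i]] by simp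
  then show ?thesis
    by (simp add: comps_def coord_diff_def vec_eq_iff chart_vec_apply[OF c smooth_near_coord[OF d]])
qed

lemma comps_chart_vec [simp]:
  assumes c: "c \<in> charts M" "p \<in> fst c"
  shows "comps c (chart_vec M c p \<xi>) = \<xi>"
proof -
  have "dder (\<lambda>x. snd c (chart_inv c x)) (snd c p) = dder (\<lambda>x. x) (snd c p)"
    by (rule dder_cong_open[OF chartD(3)[OF c(1)]]) (use c in auto)
  then show ?thesis using comps_chart_vec_change[OF c c] by simp
qed

lemma chart_vec_change:
  assumes c: "c \<in> charts M" "p \<in> fst c" and d: "d \<in> charts M" "p \<in> fst d"
  shows "chart_vec M c p \<xi> = chart_vec M d p (dder (\<lambda>x. snd d (chart_inv c x)) (snd c p) \<xi>)"
proof
  fix f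
  show "chart_vec M c p \<xi> f = chart_vec M d p (dder (\<lambda>x. snd d (chart_inv c x)) (snd c p) \<xi>) f"
  proof (cases "smooth_near M p f")
    case True
    then have "smooth_at (snd d (chart_inv c (snd c p))) (\<lambda>y. f (chart_inv d y))"
      using smooth_near_iff[OF d] c by simp
    from dder_compose_at[OF transition_smooth_at[OF c(1) d(1) c(2) d(2)] this, of \<xi>]
    have "dder (\<lambda>x. f (chart_inv d (snd d (chart_inv c x)))) (snd c p) \<xi> =
        dder (\<lambda>y. f (chart_inv d y)) (snd d p) (dder (\<lambda>x. snd d (chart_inv c x)) (snd c p) \<xi>)"
      using c by simp
    moreover have "dder (\<lambda>x. f (chart_inv d (snd d (chart_inv c x)))) (snd c p) = dder (\<lambda>x. f (chart_inv c x)) (snd c p)"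
      by (rule dder_cong_open[OF overlap_open[OF c(1) d(1)]]) (use c d in auto)
    ultimately show ?thesis using True by (simp add: chart_vec_apply c d)
  qed (simp add: chart_vec_def)
qed

lemma chart_vec_tangent: "c \<in> charts M \<Longrightarrow> p \<in> fst c \<Longrightarrow> chart_vec M c p \<xi> \<in> tangent_space M p"
  unfolding tangent_space_def by blast

lemma chart_vec_comps:
  assumes c: "c \<in> charts M" "p \<in> fst c" and u: "u \<in> tangent_space M p"
  shows "chart_vec M c p (comps c u) = u"
proof -
  obtain d \<xi> where d: "d \<in> charts M" "p \<in> fst d" "u = chart_vec M d p \<xi>" using u by (auto simp: tangent_space_def)
  show ?thesis
    unfolding d(3) using chart_vec_change[OF d(1,2) c] comps_chart_vec_change[OF d(1,2) c] by simp
qed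

lemma tangent_space_eq:
  assumes c: "c \<in> charts M" "p \<in> fst c"
  shows "tangent_space M p = range (chart_vec M c p)"
proof (intro set_eqI iffI)
  show "u \<in> range (chart_vec M c p)" if "u \<in> tangent_space M p" for u
    using chart_vec_comps[OF c that] by (metis rangeI)
qed (auto intro: chart_vec_tangent[OF c])

text \<open>Derivations depend on germs only, including the default value: two functions agreeing
  near \<open>p\<close> are both smooth there or both sent to 0.\<close>

lemma tangent_cong:
  assumes u: "u \<in> tangent_space M p" and U: "openin (top_space M) U" "p \<in> U" "\<And>q. q \<in> U \<Longrightarrow> f q = f' q"
  shows "u f = u f'" "smooth_near M p f \<longleftrightarrow> smooth_near M p f'"
proof -
  obtain c \<xi> where c: "c \<in> charts M" "p \<in> fst c" and u: "u = chart_vec M c p \<xi>" using u by (auto simp: tangent_space_def)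
  define W where "W = snd c ` (fst c \<inter> U)"
  have W: "open W" "snd c p \<in> W"
    unfolding W_def using chartD(5)[OF c(1)] openin_Int[OF chartD(1)[OF c(1)] U(1)] c U by auto
  have eq: "f (chart_inv c x) = f' (chart_inv c x)" if "x \<in> W" for x
    using that c U(3) by (auto simp: W_def)
  show *: "smooth_near M p f \<longleftrightarrow> smooth_near M p f'"
    unfolding smooth_near_iff[OF c] by (rule smooth_at_cong[OF W eq])
  have "dder (\<lambda>x. f (chart_inv c x)) (snd c p) = dder (\<lambda>x. f' (chart_inv c x)) (snd c p)"
    by (rule dder_cong_open[OF W eq])
  then show "u f = u f'" using * by (simp add: u chart_vec_def o_def)
qed

subsection \<open>Vector fields in coordinates\<close>

text \<open>The open set is explicit, so that several fields can be brought to a common domain;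
  \<open>smooth_field_near\<close> hides it behind an existential chart.\<close>

definition field_rep :: "('a, 'm) chart \<Rightarrow> 'a vfield \<Rightarrow> (real^'m) set \<Rightarrow> bool" where
  "field_rep c X W \<longleftrightarrow> open W \<and> W \<subseteq> chart_img c \<and> smooth_on W (\<lambda>x. comps c (X (chart_inv c x))) \<and>
     (\<forall>x\<in>W. X (chart_inv c x) \<in> tangent_space M (chart_inv c x))"

lemma smooth_field_near_iff:
  assumes c: "c \<in> charts M" "p \<in> fst c"
  shows "smooth_field_near M p X \<longleftrightarrow> (\<exists>W. snd c p \<in> W \<and> field_rep c X W)"
proof
  assume "smooth_field_near M p X"
  then obtain d where d: "d \<in> charts M" "p \<in> fst d" "\<forall>q\<in>fst d. X q \<in> tangent_space M q"
    "\<forall>i. smooth_on (chart_img d) (\<lambda>x. coord_diff d i (X (chart_inv d x)))"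
    by (auto simp: smooth_field_near_def o_def)
  have smX: "smooth_on (chart_img d) (\<lambda>x. comps d (X (chart_inv d x)))"
    unfolding smooth_on_vec_iff[OF chartD(3)[OF d(1)]] using d(4) by (simp add: comps_def)
  define W where "W = snd c ` (fst c \<inter> fst d)"
  have W: "open W" "snd c p \<in> W" "W \<subseteq> chart_img c" unfolding W_def using overlap_open[OF c(1) d(1)] c d by auto
  have eq: "comps c (X (chart_inv c x)) =
      dder (\<lambda>y. snd c (chart_inv d y)) (snd d (chart_inv c x)) (comps d (X (chart_inv d (snd d (chart_inv c x)))))"
    and tan: "X (chart_inv c x) \<in> tangent_space M (chart_inv c x)" if "x \<in> W" for x
  proof -
    have q: "chart_inv c x \<in> fst c" "chart_inv c x \<in> fst d" using that c by (auto simp: W_def)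
    show "X (chart_inv c x) \<in> tangent_space M (chart_inv c x)" using d(3) q by auto
    then show "comps c (X (chart_inv c x)) =
      dder (\<lambda>y. snd c (chart_inv d y)) (snd d (chart_inv c x)) (comps d (X (chart_inv d (snd d (chart_inv c x)))))"
      using comps_chart_vec_change[OF d(1) q(2) c(1) q(1), of "comps d (X (chart_inv c x))"] chart_vec_comps[OF d(1) q(2)] d q
      by simp
  qed
  have tr: "smooth_on W (\<lambda>x. snd d (chart_inv c x))" unfolding W_def by (rule transition_smooth[OF c(1) d(1)])
  have im: "(\<lambda>x. snd d (chart_inv c x)) ` W \<subseteq> snd d ` (fst d \<inter> fst c)" using c by (auto simp: W_def)
  have "smooth_on W (\<lambda>x. dder (\<lambda>y. snd c (chart_inv d y)) (snd d (chart_inv c x)) (comps d (X (chart_inv d (snd d (chart_inv c x))))))"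
  proof -
    have L: "smooth_lin W (\<lambda>x. dder (\<lambda>y. snd c (chart_inv d y)) (snd d (chart_inv c x)))"
      by (rule smooth_lin_compose[OF W(1) overlap_open[OF d(1) c(1)] im tr smooth_lin_D[OF overlap_open[OF d(1) c(1)] transition_smooth[OF d(1) c(1)]]])
    have "(\<lambda>x. snd d (chart_inv c x)) ` W \<subseteq> chart_img d" using im by blast
    from smooth_on_compose[OF W(1) chartD(3)[OF d(1)] this tr smX]
    have "smooth_on W (\<lambda>x. comps d (X (chart_inv d (snd d (chart_inv c x)))))" .
    from smooth_lin_apply[OF W(1) L this] show ?thesis .
  qed
  then have "smooth_on W (\<lambda>x. comps c (X (chart_inv c x)))"
    by (subst smooth_on_cong[OF W(1) eq]) auto
  then show "\<exists>W. snd c p \<in> W \<and> field_rep c X W" using W tan by (auto simp: field_rep_def)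
next
  assume "\<exists>W. snd c p \<in> W \<and> field_rep c X W"
  then obtain W where W: "snd c p \<in> W" "open W" "W \<subseteq> chart_img c" "smooth_on W (\<lambda>x. comps c (X (chart_inv c x)))"
    "\<forall>x\<in>W. X (chart_inv c x) \<in> tangent_space M (chart_inv c x)" by (auto simp: field_rep_def)
  obtain c' where c': "c' \<in> charts M" "fst c' = {q \<in> fst c. snd c q \<in> W}" "snd c' = snd c" "chart_img c' = W"
    "\<forall>x\<in>W. chart_inv c' x = chart_inv c x"
    using restrict_chart[OF c(1) W(2,3)] by blast
  have "X q \<in> tangent_space M q" if "q \<in> fst c'" for q
    using that W(5) c c'(2) by force
  moreover have "smooth_on (chart_img c') ((\<lambda>q. coord_diff c' i (X q)) \<circ> chart_inv c')" for i
  proof -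
    have "smooth_on W (\<lambda>x. comps c (X (chart_inv c x)) $ i)" by (rule smooth_on_vec_nth[OF W(2,4)])
    then show ?thesis
      unfolding c'(4) using c'(3,5)
      by (subst smooth_on_cong[OF W(2), of _ "\<lambda>x. comps c (X (chart_inv c x)) $ i"])
        (auto simp: comps_def coord_diff_def)
  qed
  ultimately show "smooth_field_near M p X"
    using c' c(2) W(1) by (auto simp: smooth_field_near_def)
qed

lemma field_rep_smooth:
  "c \<in> charts M \<Longrightarrow> field_rep c X W \<Longrightarrow> x \<in> W \<Longrightarrow> smooth_field_near M (chart_inv c x) X"
  using smooth_field_near_iff[of c "chart_inv c x" X] by (force simp: field_rep_def)

lemma field_rep_apply:
  "c \<in> charts M \<Longrightarrow> field_rep c X W \<Longrightarrow> x \<in> W \<Longrightarrow> chart_vec M c (chart_inv c x) (comps c (X (chart_inv c x))) = X (chart_inv c x)"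
  by (rule chart_vec_comps) (auto simp: field_rep_def)

lemma field_repI:
  assumes c: "c \<in> charts M" and W: "open W" "W \<subseteq> chart_img c" "smooth_on W \<xi>"
    and X: "\<And>x. x \<in> W \<Longrightarrow> X (chart_inv c x) = chart_vec M c (chart_inv c x) (\<xi> x)"
  shows "field_rep c X W"
proof -
  have in_c: "chart_inv c x \<in> fst c" if "x \<in> W" for x using that W(2) c by auto
  have "comps c (X (chart_inv c x)) = \<xi> x" if "x \<in> W" for x using that c in_c by (simp add: X)
  then show ?thesis
    using W X chart_vec_tangent[OF c in_c] smooth_on_cong[OF W(1), of "\<lambda>x. comps c (X (chart_inv c x))" \<xi>]
    by (auto simp: field_rep_def)
qed

lemma field_rep_mono: "field_rep c X W \<Longrightarrow> V \<subseteq> W \<Longrightarrow> open V \<Longrightarrow> field_rep c X V"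
  by (auto simp: field_rep_def smooth_on_mono)

lemma const_field_rep: "c \<in> charts M \<Longrightarrow> field_rep c (\<lambda>q. chart_vec M c q \<xi>) (chart_img c)"
  by (rule field_repI[of c _ "\<lambda>x. \<xi>"]) (auto simp: chartD(3) smooth_on_const)

lemma const_field_smooth:
  assumes "c \<in> charts M" "p \<in> fst c" shows "smooth_field_near M p (\<lambda>q. chart_vec M c q \<xi>)"
  using field_rep_smooth[OF assms(1) const_field_rep[OF assms(1)], of "snd c p" \<xi>] assms by simp

lemma smooth_field_near_add:
  assumes "p \<in> points M" "smooth_field_near M p X" "smooth_field_near M p Y"
  shows "smooth_field_near M p (\<lambda>q. X q + Y q)"
proof -
  obtain c where c: "c \<in> charts M" "p \<in> fst c" using chart_exists[OF assms(1)] by blast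
  obtain V where V: "snd c p \<in> V" "field_rep c X V" using assms(2) smooth_field_near_iff[OF c] by blast
  obtain W where W: "snd c p \<in> W" "field_rep c Y W" using assms(3) smooth_field_near_iff[OF c] by blast
  have *: "field_rep c X (V \<inter> W)" "field_rep c Y (V \<inter> W)" "open (V \<inter> W)"
    using V W by (auto intro: field_rep_mono simp: field_rep_def smooth_on_mono)
  have "field_rep c (\<lambda>q. X q + Y q) (V \<inter> W)"
  proof (rule field_repI[OF c(1) *(3), of "\<lambda>x. comps c (X (chart_inv c x)) + comps c (Y (chart_inv c x))"])
    show "V \<inter> W \<subseteq> chart_img c" using *(1) by (simp add: field_rep_def)
    show "smooth_on (V \<inter> W) (\<lambda>x. comps c (X (chart_inv c x)) + comps c (Y (chart_inv c x)))"
      using * by (intro smooth_on_add) (auto simp: field_rep_def)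
    fix x assume x: "x \<in> V \<inter> W"
    have "chart_inv c x \<in> fst c" using x *(1) c by (auto simp: field_rep_def)
    then show "X (chart_inv c x) + Y (chart_inv c x) =
        chart_vec M c (chart_inv c x) (comps c (X (chart_inv c x)) + comps c (Y (chart_inv c x)))"
      using field_rep_apply[OF c(1) *(1) x] field_rep_apply[OF c(1) *(2) x] c by (simp add: chart_vec_simps)
  qed
  then show ?thesis using smooth_field_near_iff[OF c] V W by blast
qed

lemma smooth_field_near_scaleR:
  assumes "p \<in> points M" "smooth_near M p f" "smooth_field_near M p X"
  shows "smooth_field_near M p (\<lambda>q. f q *\<^sub>R X q)"
proof -
  obtain c where c: "c \<in> charts M" "p \<in> fst c" using chart_exists[OF assms(1)] by blast
  obtain W where W: "snd c p \<in> W" "field_rep c X W" using assms(3) smooth_field_near_iff[OF c] by blast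
  obtain V where V: "snd c p \<in> V" "open V" "smooth_on V (\<lambda>x. f (chart_inv c x))"
    using assms(2) smooth_near_iff[OF c] by (auto simp: smooth_at_def)
  have *: "field_rep c X (V \<inter> W)" "open (V \<inter> W)"
    using V W by (auto intro: field_rep_mono simp: field_rep_def smooth_on_mono)
  have "field_rep c (\<lambda>q. f q *\<^sub>R X q) (V \<inter> W)"
  proof (rule field_repI[OF c(1) *(2), of "\<lambda>x. f (chart_inv c x) *\<^sub>R comps c (X (chart_inv c x))"])
    show "V \<inter> W \<subseteq> chart_img c" using *(1) by (simp add: field_rep_def)
    show "smooth_on (V \<inter> W) (\<lambda>x. f (chart_inv c x) *\<^sub>R comps c (X (chart_inv c x)))"
      using * smooth_on_mono[OF V(3), of "V \<inter> W"] by (intro smooth_on_scaleR) (auto simp: field_rep_def)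
    fix x assume x: "x \<in> V \<inter> W"
    have "chart_inv c x \<in> fst c" using x *(1) c by (auto simp: field_rep_def)
    then show "f (chart_inv c x) *\<^sub>R X (chart_inv c x) =
        chart_vec M c (chart_inv c x) (f (chart_inv c x) *\<^sub>R comps c (X (chart_inv c x)))"
      using field_rep_apply[OF c(1) *(1) x] c by (simp add: chart_vec_simps)
  qed
  then show ?thesis using smooth_field_near_iff[OF c] V W by blast
qed

end

subsection \<open>The metric and the connection in coordinates\<close>

definition gmet :: "('a, 'm::finite) riem \<Rightarrow> ('a, 'm) chart \<Rightarrow> real^'m \<Rightarrow> real^'m \<Rightarrow> real^'m \<Rightarrow> real" where
  "gmet M c x v w = metric M (chart_inv c x) (chart_vec M c (chart_inv c x) v) (chart_vec M c (chart_inv c x) w)"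

text \<open>The Christoffel symbols contracted with \<open>v\<close> and \<open>w\<close>: the
  components of the derivative of the field with constant components \<open>w\<close> in direction
  \<open>v\<close>.\<close>

definition christoffel :: "('a, 'm::finite) riem \<Rightarrow> ('a, 'm) chart \<Rightarrow> real^'m \<Rightarrow> real^'m \<Rightarrow> real^'m \<Rightarrow> real^'m" where
  "christoffel M c x v w =
     comps c (conn M (chart_inv c x) (chart_vec M c (chart_inv c x) v) (\<lambda>q. chart_vec M c q w))"

text \<open>Components of \<open>R(u,v)w\<close> for fields with constant components; their brackets
  vanish, so only the commutator of the two derivatives remains.\<close>

definition curv :: "('a, 'm::finite) riem \<Rightarrow> ('a, 'm) chart \<Rightarrow> real^'m \<Rightarrow> real^'m \<Rightarrow> real^'m \<Rightarrow> real^'m \<Rightarrow> real^'m" where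
  "curv M c x u v w =
     dder (\<lambda>y. christoffel M c y v w) x u - dder (\<lambda>y. christoffel M c y u w) x v +
     christoffel M c x u (christoffel M c x v w) - christoffel M c x v (christoffel M c x u w)"

locale riem_mfd = smooth_mfd +
  assumes riemannian_metric: "riemannian_metric M" and levi_civita: "levi_civita M"
begin

lemma metric_rules:
  assumes "p \<in> points M" "u \<in> tangent_space M p" "v \<in> tangent_space M p"
  shows "metric M p u v = metric M p v u"
    "w \<in> tangent_space M p \<Longrightarrow> metric M p (a *\<^sub>R u + b *\<^sub>R v) w = a * metric M p u w + b * metric M p v w"
    "u \<noteq> 0 \<Longrightarrow> metric M p u u > 0"
  using riemannian_metric assms unfolding riemannian_metric_def by blast+

lemma metric_smooth:
  assumes "c \<in> charts M"
  shows "smooth_on (chart_img c) (\<lambda>x. gmet M c x (axis i 1) (axis j 1))"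
  using bspec[OF conjunct2[OF riemannian_metric[unfolded riemannian_metric_def]] assms]
  unfolding gmet_def coord_field_def o_def by simp

lemma conn_rules:
  assumes "p \<in> points M" "u \<in> tangent_space M p" "smooth_field_near M p Y"
  shows conn_tangent: "conn M p u Y \<in> tangent_space M p"
    and conn_lincomb: "v \<in> tangent_space M p \<Longrightarrow> conn M p (a *\<^sub>R u + b *\<^sub>R v) Y = a *\<^sub>R conn M p u Y + b *\<^sub>R conn M p v Y"
    and conn_add: "smooth_field_near M p Z \<Longrightarrow> conn M p u (\<lambda>q. Y q + Z q) = conn M p u Y + conn M p u Z"
    and conn_leibniz: "smooth_near M p f \<Longrightarrow> conn M p u (\<lambda>q. f q *\<^sub>R Y q) = u f *\<^sub>R Y p + f p *\<^sub>R conn M p u Y"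
    and conn_metric: "smooth_field_near M p Z \<Longrightarrow> u (\<lambda>q. metric M q (Y q) (Z q)) =
          metric M p (conn M p u Y) (Z p) + metric M p (Y p) (conn M p u Z)"
proof -
  note L = bspec[OF levi_civita[unfolded levi_civita_def] assms(1)]
  note L2 = conjunct2[OF L] note L3 = conjunct2[OF L2] note L4 = conjunct2[OF L3]
  note L6 = conjunct2[OF conjunct2[OF L4]]
  show "conn M p u Y \<in> tangent_space M p"
    by (rule conjunct1[OF L, THEN bspec, OF assms(2), THEN spec, THEN mp, OF assms(3)])
  show "conn M p (a *\<^sub>R u + b *\<^sub>R v) Y = a *\<^sub>R conn M p u Y + b *\<^sub>R conn M p v Y" if "v \<in> tangent_space M p"
    by (rule conjunct1[OF L2, THEN bspec, OF assms(2), THEN bspec, OF that, THEN spec, THEN spec, THEN spec, THEN mp, OF assms(3)])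
  show "conn M p u (\<lambda>q. Y q + Z q) = conn M p u Y + conn M p u Z" if "smooth_field_near M p Z"
    by (rule conjunct1[OF L3, THEN bspec, OF assms(2), THEN spec, THEN spec, THEN mp, OF assms(3), THEN mp, OF that])
  show "conn M p u (\<lambda>q. f q *\<^sub>R Y q) = u f *\<^sub>R Y p + f p *\<^sub>R conn M p u Y" if "smooth_near M p f"
    by (rule conjunct1[OF L4, THEN bspec, OF assms(2), THEN spec, THEN spec, THEN mp, OF that, THEN mp, OF assms(3)])
  show "u (\<lambda>q. metric M q (Y q) (Z q)) = metric M p (conn M p u Y) (Z p) + metric M p (Y p) (conn M p u Z)"
    if "smooth_field_near M p Z"
    by (rule conjunct1[OF L6, THEN bspec, OF assms(2), THEN spec, THEN spec, THEN mp, OF assms(3), THEN mp, OF that])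
qed

lemma conn_rules2:
  assumes "p \<in> points M" "smooth_field_near M p X" "smooth_field_near M p Y"
  shows conn_smooth: "smooth_field_near M p (\<lambda>q. conn M q (X q) Y)"
    and conn_torsion: "conn M p (X p) Y - conn M p (Y p) X = lie_bracket M X Y p"
proof -
  note L = bspec[OF levi_civita[unfolded levi_civita_def] assms(1)]
  note L5 = conjunct2[OF conjunct2[OF conjunct2[OF conjunct2[OF L]]]]
  show "smooth_field_near M p (\<lambda>q. conn M q (X q) Y)"
    by (rule conjunct1[OF L5, THEN spec, THEN spec, THEN mp, OF assms(2), THEN mp, OF assms(3)])
  show "conn M p (X p) Y - conn M p (Y p) X = lie_bracket M X Y p"
    by (rule conjunct2[OF conjunct2[OF L5], THEN spec, THEN spec, THEN mp, OF assms(2), THEN mp, OF assms(3)])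
qed

lemma smooth_near_const: "p \<in> points M \<Longrightarrow> smooth_near M p (\<lambda>q. a)"
  using chart_exists[of p] smooth_near_iff[of _ p "\<lambda>q. a"] smooth_atI[OF open_UNIV UNIV_I smooth_on_const] by blast

lemma tangent_const: "u \<in> tangent_space M p \<Longrightarrow> u (\<lambda>q. a) = 0"
  by (auto simp: tangent_space_def chart_vec_def o_def)

text \<open>Locality follows from the Leibniz rule applied to the indicator function of a neighbourhood,
  which need only be smooth near the point.\<close>

lemma conn_local:
  assumes p: "p \<in> points M" and u: "u \<in> tangent_space M p" and X: "smooth_field_near M p X" and Y: "smooth_field_near M p Y"
    and U: "openin (top_space M) U" "p \<in> U" "\<And>q. q \<in> U \<Longrightarrow> X q = Y q"
  shows "conn M p u X = conn M p u Y"
proof -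
  define f where "f q = (if q \<in> U then 1 else 0 :: real)" for q
  have f: "smooth_near M p f" "u f = 0"
    using tangent_cong[OF u U(1,2), of f "\<lambda>q. 1"] smooth_near_const[OF p] tangent_const[OF u] by (auto simp: f_def)
  have "(\<lambda>q. f q *\<^sub>R X q) = (\<lambda>q. f q *\<^sub>R Y q)" using U(3) by (auto simp: f_def)
  moreover have "conn M p u (\<lambda>q. f q *\<^sub>R Z q) = conn M p u Z" if "smooth_field_near M p Z" for Z
    using conn_leibniz[OF p u that f(1)] U(2) f(2) by (simp add: f_def)
  ultimately show ?thesis using X Y by metis
qed

text \<open>Smoothness of the sum and the value of its derivative are proved together, since
  additivity of the connection presupposes smoothness of the partial sum.\<close>

lemma conn_sum:
  assumes p: "p \<in> points M" and u: "u \<in> tangent_space M p" and I: "finite I"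
    and Z: "smooth_field_near M p Z0" "\<And>i. i \<in> I \<Longrightarrow> smooth_field_near M p (Z i)"
    and f: "\<And>i. i \<in> I \<Longrightarrow> smooth_near M p (f i)"
  shows "smooth_field_near M p (\<lambda>q. \<Sum>i\<in>I. f i q *\<^sub>R Z i q) \<and>
    conn M p u (\<lambda>q. \<Sum>i\<in>I. f i q *\<^sub>R Z i q) = (\<Sum>i\<in>I. u (f i) *\<^sub>R Z i p + f i p *\<^sub>R conn M p u (Z i))"
  using I Z(2) f
proof (induction I rule: finite_induct)
  case empty
  \<comment> \<open>The empty sum is 0 times some smooth field; \<open>Z0\<close> is provided for
    this case.\<close>
  have "(\<lambda>q. 0 *\<^sub>R Z0 q) = (\<lambda>q. 0)" by auto
  then show ?case
    using smooth_field_near_scaleR[OF p smooth_near_const[OF p, of 0] Z(1)]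
      conn_leibniz[OF p u Z(1) smooth_near_const[OF p, of 0]] tangent_const[OF u, of 0]
    by (simp add: zero_fun_def)
next
  case (insert i I)
  have Zi: "smooth_field_near M p (Z i)" and fi: "smooth_near M p (f i)"
    by (rule insert.prems, rule insertI1)+
  have IH: "smooth_field_near M p (\<lambda>q. \<Sum>i\<in>I. f i q *\<^sub>R Z i q) \<and>
    conn M p u (\<lambda>q. \<Sum>i\<in>I. f i q *\<^sub>R Z i q) = (\<Sum>i\<in>I. u (f i) *\<^sub>R Z i p + f i p *\<^sub>R conn M p u (Z i))"
    by (rule insert.IH; rule insert.prems; erule insertI2)
  note 1 = smooth_field_near_scaleR[OF p fi Zi] and 2 = conjunct1[OF IH]
  show ?case
    unfolding sum.insert[OF insert.hyps]
    by (rule conjI[OF smooth_field_near_add[OF p 1 2]])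
      (simp only: conn_add[OF p u 1 2] conn_leibniz[OF p u Zi fi] conjunct2[OF IH])
qed

lemma axis_expansion: "(v :: real^'m) = (\<Sum>i\<in>UNIV. (v $ i) *\<^sub>R axis i 1)"
  using basis_expansion[of v] by (simp add: scalar_mult_eq_scaleR)

context
  fixes c assumes c: "c \<in> charts M"
begin

lemma chart_point: "x \<in> chart_img c \<Longrightarrow> chart_inv c x \<in> points M" "x \<in> chart_img c \<Longrightarrow> chart_inv c x \<in> fst c"
  using chart_points[OF c] c by auto

lemma const_smooth: "x \<in> chart_img c \<Longrightarrow> smooth_field_near M (chart_inv c x) (\<lambda>q. chart_vec M c q w)"
  by (rule const_field_smooth[OF c chart_point(2)])

lemma christoffel_vec:
  assumes "x \<in> chart_img c"
  shows "chart_vec M c (chart_inv c x) (christoffel M c x v w) =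
    conn M (chart_inv c x) (chart_vec M c (chart_inv c x) v) (\<lambda>q. chart_vec M c q w)"
  unfolding christoffel_def using assms
  by (intro chart_vec_comps c chart_point conn_tangent chart_vec_tangent const_smooth)

lemma christoffel_bilinear:
  assumes x: "x \<in> chart_img c" shows "bilinear (christoffel M c x)"
proof -
  let ?p = "chart_inv c x"
  note p = chart_point[OF x] and t = chart_vec_tangent[OF c chart_point(2)[OF x]]
  have 1: "christoffel M c x (a *\<^sub>R v + b *\<^sub>R v') w = a *\<^sub>R christoffel M c x v w + b *\<^sub>R christoffel M c x v' w" for a b v v' w
    unfolding christoffel_def chart_vec_linear[OF c p(2)]
    by (simp add: conn_lincomb[OF p(1) t const_smooth[OF x] t]
        comps_lincomb conn_tangent[OF p(1) t const_smooth[OF x]])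
  have 2: "christoffel M c x v (a *\<^sub>R w + b *\<^sub>R w') = a *\<^sub>R christoffel M c x v w + b *\<^sub>R christoffel M c x v w'" for a b v w w'
  proof -
    have sc: "smooth_field_near M ?p (\<lambda>q. a *\<^sub>R chart_vec M c q w)" for a w
      by (rule smooth_field_near_scaleR[OF p(1) smooth_near_const[OF p(1)] const_smooth[OF x]])
    \<comment> \<open>\<open>chart_vec\<close> is linear only over the domain of \<open>c\<close>,
      so the two fields agree merely near the point and locality is invoked.\<close>
    have "conn M ?p (chart_vec M c ?p v) (\<lambda>q. chart_vec M c q (a *\<^sub>R w + b *\<^sub>R w')) =
        conn M ?p (chart_vec M c ?p v) (\<lambda>q. a *\<^sub>R chart_vec M c q w + b *\<^sub>R chart_vec M c q w')"
      by (rule conn_local[OF p(1) t const_smooth[OF x] smooth_field_near_add[OF p(1) sc sc] chartD(1)[OF c] p(2)])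
        (rule chart_vec_linear[OF c])
    also have "\<dots> = a *\<^sub>R conn M ?p (chart_vec M c ?p v) (\<lambda>q. chart_vec M c q w) +
        b *\<^sub>R conn M ?p (chart_vec M c ?p v) (\<lambda>q. chart_vec M c q w')"
      by (simp add: conn_add[OF p(1) t sc sc] conn_leibniz[OF p(1) t const_smooth[OF x] smooth_near_const[OF p(1)]]
          tangent_const[OF t])
    finally show ?thesis
      by (simp add: christoffel_def comps_lincomb conn_tangent[OF p(1) t const_smooth[OF x]])
  qed
  show ?thesis
    unfolding bilinear_def
    using 1[of 1 _ 1] 1[of _ _ 0] 2[of _ 1 _ 1] 2[of _ _ _ 0] by (auto intro!: linearI)
qed

text \<open>Rests on the clause that the derivative of a smooth field along a smooth field is
  smooth, applied to constant-component fields; the neighbourhoods depend on the point and are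
  patched by \<open>smooth_on_local\<close>.\<close>

lemma christoffel_smooth: "smooth_bil (chart_img c) (christoffel M c)"
  unfolding smooth_bil_def
proof (intro conjI ballI allI)
  show "smooth_on (chart_img c) (\<lambda>x. christoffel M c x v w)" for v w
  proof (rule smooth_on_local)
    fix x assume x: "x \<in> chart_img c"
    have "smooth_field_near M (chart_inv c x) (\<lambda>q. conn M q (chart_vec M c q v) (\<lambda>q. chart_vec M c q w))"
      by (rule conn_smooth[OF chart_point(1)[OF x] const_smooth[OF x] const_smooth[OF x]])
    then obtain W where "snd c (chart_inv c x) \<in> W"
      "field_rep c (\<lambda>q. conn M q (chart_vec M c q v) (\<lambda>q. chart_vec M c q w)) W"
      using smooth_field_near_iff[OF c chart_point(2)[OF x]] by blast
    then show "\<exists>W. open W \<and> x \<in> W \<and> smooth_on W (\<lambda>x. christoffel M c x v w)"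
      using c x by (auto simp: field_rep_def christoffel_def)
  qed
qed (rule christoffel_bilinear)

text \<open>Near \<open>p\<close> the field is a finite combination of coordinate fields; locality
  permits the replacement and the Leibniz rule evaluates it. Every later derivative of a field on a
  manifold reduces to this formula.\<close>

lemma conn_rep:
  assumes p: "p \<in> fst c" and X: "field_rep c X W" "snd c p \<in> W"
  shows "conn M p (chart_vec M c p v) X =
    chart_vec M c p (dder (\<lambda>x. comps c (X (chart_inv c x))) (snd c p) v + christoffel M c (snd c p) v (comps c (X p)))"
proof -
  let ?u = "chart_vec M c p v"
  have pp: "p \<in> points M" and u: "?u \<in> tangent_space M p" using chart_points[OF c p] chart_vec_tangent[OF c p] by auto
  have xi: "snd c p \<in> chart_img c" and invp: "chart_inv c (snd c p) = p" using p c by auto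
  define f where "f i q = comps c (X q) $ i" for i q
  have W: "open W" "smooth_on W (\<lambda>x. comps c (X (chart_inv c x)))" using X(1) by (auto simp: field_rep_def)
  have f: "smooth_near M p (f i)" for i
    unfolding smooth_near_iff[OF c p] f_def
    by (rule smooth_atI[OF W(1) X(2) smooth_on_vec_nth[OF W]])
  have uf: "?u (f i) = dder (\<lambda>x. comps c (X (chart_inv c x))) (snd c p) v $ i" for i
    using dder_eqI[OF bounded_linear.has_derivative[OF bounded_linear_vec_nth smooth_on_has_derivative[OF W(2) X(2)], of i]]
    by (simp add: chart_vec_apply[OF c p f]) (simp add: f_def)
  have Xp: "smooth_field_near M p X" using smooth_field_near_iff[OF c p] X by blast
  have cs: "smooth_field_near M p (\<lambda>q. chart_vec M c q w)" for w by (rule const_field_smooth[OF c p])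
  define Z where "Z i q = chart_vec M c q (axis i 1)" for i q
  have Z: "smooth_field_near M p (Z i)" for i using cs by (simp add: Z_def[abs_def])
  note s = conn_sum[OF pp u finite_class.finite_UNIV Z[of undefined] Z f, of "\<lambda>i. i"]
  have "conn M p ?u X = conn M p ?u (\<lambda>q. \<Sum>i\<in>UNIV. f i q *\<^sub>R Z i q)"
  proof (rule conn_local[OF pp u Xp conjunct1[OF s] chartD(6)[OF c W(1)]])
    show "p \<in> {q \<in> fst c. snd c q \<in> W}" using p X by simp
    fix q assume q: "q \<in> {q \<in> fst c. snd c q \<in> W}"
    have "X q = chart_vec M c q (\<Sum>i\<in>UNIV. (comps c (X q) $ i) *\<^sub>R axis i 1)"
      using field_rep_apply[OF c X(1), of "snd c q"] q c by (simp add: axis_expansion[symmetric])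
    also have "\<dots> = (\<Sum>i\<in>UNIV. f i q *\<^sub>R Z i q)"
      using chart_vec_simps(5)[OF c, of q] q by (simp add: linear_sum linear_cmul f_def Z_def)
    finally show "X q = (\<Sum>i\<in>UNIV. f i q *\<^sub>R Z i q)" .
  qed
  also have "\<dots> = (\<Sum>i\<in>UNIV. ?u (f i) *\<^sub>R Z i p + f i p *\<^sub>R conn M p ?u (Z i))" by (rule conjunct2[OF s])
  also have "\<dots> = (\<Sum>i\<in>UNIV. chart_vec M c p (?u (f i) *\<^sub>R axis i 1 + f i p *\<^sub>R christoffel M c (snd c p) v (axis i 1)))"
    using christoffel_vec[OF xi, of v] by (simp add: chart_vec_simps[OF c p] Z_def[abs_def] invp)
  also have "\<dots> = chart_vec M c p ((\<Sum>i\<in>UNIV. ?u (f i) *\<^sub>R axis i 1) + (\<Sum>i\<in>UNIV. f i p *\<^sub>R christoffel M c (snd c p) v (axis i 1)))"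
    by (simp add: linear_sum[OF chart_vec_simps(5)[OF c p], symmetric] sum.distrib)
  also have "(\<Sum>i\<in>UNIV. ?u (f i) *\<^sub>R axis i 1) = dder (\<lambda>x. comps c (X (chart_inv c x))) (snd c p) v"
    unfolding uf by (rule axis_expansion[symmetric])
  also have "(\<Sum>i\<in>UNIV. f i p *\<^sub>R christoffel M c (snd c p) v (axis i 1)) = christoffel M c (snd c p) v (comps c (X p))"
  proof -
    have l: "linear (christoffel M c (snd c p) v)" using christoffel_bilinear[OF xi] by (simp add: bilinear_def)
    show ?thesis
      by (subst (2) axis_expansion) (simp add: linear_sum[OF l] linear_cmul[OF l] f_def)
  qed
  finally show ?thesis .
qed

text \<open>This is the symmetry of second derivatives. With vanishing torsion it makes the
  Christoffel symbols symmetric.\<close>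

lemma lie_bracket_const:
  assumes p: "p \<in> fst c"
  shows "lie_bracket M (\<lambda>q. chart_vec M c q v) (\<lambda>q. chart_vec M c q w) p = 0"
proof
  fix f
  show "lie_bracket M (\<lambda>q. chart_vec M c q v) (\<lambda>q. chart_vec M c q w) p f = 0 f"
  proof (cases "smooth_near M p f")
    case True
    define F where "F x = f (chart_inv c x)" for x
    obtain V' where V': "open V'" "snd c p \<in> V'" "smooth_on V' F"
      using True smooth_near_iff[OF c p] by (auto simp: smooth_at_def F_def[abs_def])
    define V where "V = V' \<inter> chart_img c"
    have V: "open V" "snd c p \<in> V" "smooth_on V F"
      using V' p chartD(3)[OF c] smooth_on_mono[OF V'(3)] by (auto simp: V_def)
    have eq: "chart_vec M c (chart_inv c x) w f = dder F x w" if "x \<in> V" for x w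
    proof -
      have x: "x \<in> chart_img c" using that by (simp add: V_def)
      have "smooth_near M (chart_inv c x) f"
        using smooth_near_iff[OF c chart_point(2)[OF x]] smooth_atI[OF V(1) that V(3)] x c by (simp add: F_def[abs_def])
      then show ?thesis using chart_vec_apply[OF c chart_point(2)[OF x]] x c by (simp add: F_def[abs_def])
    qed
    have "chart_vec M c p v (\<lambda>q. chart_vec M c q w f) = dder (\<lambda>y. dder F y w) (snd c p) v" for v w
    proof -
      have "smooth_near M p (\<lambda>q. chart_vec M c q w f)"
        unfolding smooth_near_iff[OF c p]
        by (subst smooth_at_cong[OF V(1,2) eq]) (auto intro: smooth_atI[OF V(1,2) smooth_on_dder[OF V(3)]])
      then show ?thesis
        using dder_cong_open[OF V(1,2) eq] by (simp add: chart_vec_apply[OF c p])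
    qed
    then show ?thesis
      using True dder_dder_commute_real[OF V(1,3,2)] by (simp add: lie_bracket_def)
  qed (simp add: lie_bracket_def)
qed

lemma christoffel_sym:
  assumes x: "x \<in> chart_img c" shows "christoffel M c x v w = christoffel M c x w v"
proof -
  have "conn M (chart_inv c x) (chart_vec M c (chart_inv c x) v) (\<lambda>q. chart_vec M c q w) =
      conn M (chart_inv c x) (chart_vec M c (chart_inv c x) w) (\<lambda>q. chart_vec M c q v)"
    using conn_torsion[OF chart_point(1)[OF x] const_smooth[OF x, of v] const_smooth[OF x, of w]] lie_bracket_const[OF chart_point(2)[OF x]]
    by simp
  then show ?thesis by (simp add: christoffel_def)
qed

lemma metric_gmet: "p \<in> fst c \<Longrightarrow> metric M p (chart_vec M c p v) (chart_vec M c p w) = gmet M c (snd c p) v w"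
  using c by (simp add: gmet_def)

lemma gmet_inner_form:
  assumes x: "x \<in> chart_img c" shows "inner_form (gmet M c x)"
proof -
  note p = chart_point[OF x] and t = chart_vec_tangent[OF c chart_point(2)[OF x]]
  have sym: "gmet M c x v w = gmet M c x w v" for v w
    unfolding gmet_def by (rule metric_rules(1)[OF p(1) t t])
  have 1: "gmet M c x (a *\<^sub>R v + b *\<^sub>R v') w = a * gmet M c x v w + b * gmet M c x v' w" for a b v v' w
    unfolding gmet_def chart_vec_linear[OF c p(2)] by (rule metric_rules(2)[OF p(1) t t t])
  have 2: "gmet M c x w (a *\<^sub>R v + b *\<^sub>R v') = a * gmet M c x w v + b * gmet M c x w v'" for a b v v' w
    using 1[of a v b v' w] sym by metis
  have "bilinear (gmet M c x)"
    unfolding bilinear_def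
    using 1[of 1 _ 1] 1[of _ _ 0] 2[of _ 1 _ 1] 2[of _ _ _ 0] by (auto intro!: linearI)
  moreover have "gmet M c x v v > 0" if "v \<noteq> 0" for v
  proof -
    have "chart_vec M c (chart_inv c x) v \<noteq> 0"
      using that comps_chart_vec[OF c p(2)] chart_vec_simps(4)[OF c p(2)] by metis
    then show ?thesis unfolding gmet_def by (rule metric_rules(3)[OF p(1) t t])
  qed
  ultimately show ?thesis using sym by (auto simp: inner_form_def)
qed

lemma gmet_smooth: "smooth_bil (chart_img c) (gmet M c)"
  unfolding smooth_bil_def
proof (intro conjI ballI allI)
  show "bilinear (gmet M c x)" if "x \<in> chart_img c" for x
    using gmet_inner_form[OF that] by (rule inner_form_bilinear)
  fix v w :: "real^'b"
  have "gmet M c x v w = (\<Sum>i\<in>UNIV. \<Sum>j\<in>UNIV. v $ i * w $ j * gmet M c x (axis i 1) (axis j 1))"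
    if x: "x \<in> chart_img c" for x
  proof -
    have b: "linear (\<lambda>v. gmet M c x v w)" "linear (gmet M c x v)" for v w
      using inner_form_bilinear[OF gmet_inner_form[OF x]] by (auto simp: bilinear_def)
    have 1: "gmet M c x v w = (\<Sum>i\<in>UNIV. v $ i * gmet M c x (axis i 1) w)"
      by (subst axis_expansion[of v]) (simp add: linear_sum[OF b(1)] linear_cmul[OF b(1)])
    have 2: "gmet M c x (axis i 1) w = (\<Sum>j\<in>UNIV. w $ j * gmet M c x (axis i 1) (axis j 1))" for i
      by (subst axis_expansion[of w]) (simp add: linear_sum[OF b(2)] linear_cmul[OF b(2)])
    show ?thesis unfolding 1 2 by (simp add: sum_distrib_left mult.assoc)
  qed
  moreover have "smooth_on (chart_img c) (\<lambda>x. \<Sum>i\<in>UNIV. \<Sum>j\<in>UNIV. v $ i * w $ j * gmet M c x (axis i 1) (axis j 1))"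
    by (intro smooth_on_sum smooth_on_mult smooth_on_const chartD(3)[OF c] metric_smooth[OF c])
  ultimately show "smooth_on (chart_img c) (\<lambda>x. gmet M c x v w)"
    using smooth_on_cong[OF chartD(3)[OF c], of "\<lambda>x. gmet M c x v w"] by simp
qed

lemma christoffel_metric:
  assumes x: "x \<in> chart_img c"
  shows "dder (\<lambda>y. gmet M c y v w) x u = gmet M c x (christoffel M c x u v) w + gmet M c x v (christoffel M c x u w)"
proof -
  let ?p = "chart_inv c x"
  note p = chart_point[OF x] and t = chart_vec_tangent[OF c chart_point(2)[OF x]]
  have sx: "snd c ?p = x" using x c by simp
  define f where "f q = metric M q (chart_vec M c q v) (chart_vec M c q w)" for q
  have f: "(\<lambda>y. f (chart_inv c y)) = (\<lambda>y. gmet M c y v w)" by (simp add: f_def gmet_def)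
  have sm: "smooth_near M ?p f"
    unfolding smooth_near_iff[OF c p(2)] f sx
    using gmet_smooth by (intro smooth_atI[OF chartD(3)[OF c] x]) (simp add: smooth_bil_def)
  have "dder (\<lambda>y. gmet M c y v w) x u = chart_vec M c ?p u f"
    using chart_vec_apply[OF c p(2) sm] f sx by simp
  also have "\<dots> = gmet M c x (christoffel M c x u v) w + gmet M c x v (christoffel M c x u w)"
    using conn_metric[OF p(1) t const_smooth[OF x] const_smooth[OF x], of u v w]
    by (simp add: f_def[abs_def] gmet_def christoffel_vec[OF x])
  finally show ?thesis .
qed

end

end

subsection \<open>Curvature in coordinates\<close>

lemma smooth_lin_dder_linear:
  assumes S: "open S" "x \<in> S" and L: "smooth_lin S L"
  shows "linear (\<lambda>w. dder (\<lambda>y. L y w) x u)"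
proof -
  have sm: "smooth_on S (\<lambda>y. L y w)" for w using L by (simp add: smooth_lin_def)
  have lin: "linear (L y)" if "y \<in> S" for y using L that by (simp add: smooth_lin_def)
  note d = smooth_on_has_derivative[OF sm S(2)]
  have a: "dder (\<lambda>y. L y (v + w)) x u = dder (\<lambda>y. L y v) x u + dder (\<lambda>y. L y w) x u" for v w
  proof -
    have "dder (\<lambda>y. L y (v + w)) x = dder (\<lambda>y. L y v + L y w) x"
      by (rule dder_cong_open[OF S]) (rule linear_add[OF lin])
    then show ?thesis using dder_eqI[OF has_derivative_add[OF d d]] by simp
  qed
  have b: "dder (\<lambda>y. L y (r *\<^sub>R v)) x u = r *\<^sub>R dder (\<lambda>y. L y v) x u" for r v
  proof -
    have "dder (\<lambda>y. L y (r *\<^sub>R v)) x = dder (\<lambda>y. r *\<^sub>R L y v) x"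
      by (rule dder_cong_open[OF S]) (rule linear_cmul[OF lin])
    then show ?thesis using dder_eqI[OF has_derivative_scaleR_right[OF d]] by simp
  qed
  show ?thesis by (rule linearI) (rule a, rule b)
qed

text \<open>Stated for any real vector space: it is applied to tangent vectors, which live in a
  function space, as well as to coordinate vectors.\<close>

lemma span_pair: "x \<in> span {u, v} \<longleftrightarrow> (\<exists>a b. x = a *\<^sub>R u + b *\<^sub>R v)"
proof
  assume "x \<in> span {u, v}"
  then obtain a where "x - a *\<^sub>R u \<in> span {v}" by (auto simp: span_insert)
  then obtain b where "x - a *\<^sub>R u = b *\<^sub>R v" by (auto simp: span_singleton)
  then have "x = a *\<^sub>R u + b *\<^sub>R v" by (metis add.commute diff_add_cancel)
  then show "\<exists>a b. x = a *\<^sub>R u + b *\<^sub>R v" by blast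
next
  assume "\<exists>a b. x = a *\<^sub>R u + b *\<^sub>R v"
  then obtain a b where x: "x = a *\<^sub>R u + b *\<^sub>R v" by blast
  have "u \<in> span {u, v}" "v \<in> span {u, v}" by (simp_all add: span_base)
  then show "x \<in> span {u, v}" unfolding x by (intro span_add span_scale)
qed

lemma independent_pair:
  assumes "u \<noteq> v"
  shows "independent {u, v} \<longleftrightarrow> (\<forall>a b. a *\<^sub>R u + b *\<^sub>R v = 0 \<longrightarrow> a = 0 \<and> b = 0)"
proof
  assume i: "independent {u, v}"
  show "\<forall>a b. a *\<^sub>R u + b *\<^sub>R v = 0 \<longrightarrow> a = 0 \<and> b = 0"
  proof (intro allI impI)
    fix a b :: real
    assume "a *\<^sub>R u + b *\<^sub>R v = 0"
    then have s: "(\<Sum>w\<in>{u, v}. (if w = u then a else b) *\<^sub>R w) = 0" using assms by simp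
    show "a = 0 \<and> b = 0"
      using independentD[OF i _ subset_refl s, of u] independentD[OF i _ subset_refl s, of v] assms by auto
  qed
next
  assume *: "\<forall>a b. a *\<^sub>R u + b *\<^sub>R v = 0 \<longrightarrow> a = 0 \<and> b = 0"
  have v: "v \<noteq> 0" using *[rule_format, of 0 1] by auto
  have "u \<notin> span {v}"
  proof
    assume "u \<in> span {v}"
    then obtain b where "u = b *\<^sub>R v" by (auto simp: span_singleton)
    then have "1 *\<^sub>R u + (- b) *\<^sub>R v = 0" by simp
    then show False using * by (metis zero_neq_one)
  qed
  then show "independent {u, v}" using v assms by (simp add: independent_insert)
qed

context riem_mfd
begin

context
  fixes c assumes c: "c \<in> charts M"
begin

text \<open>Tensoriality of the curvature. Second derivatives of the components of \<open>Z\<close>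
  cancel by symmetry, first derivatives of the components of \<open>X\<close> and \<open>Y\<close>
  cancel against the bracket term, and what is left depends on the values at \<open>p\<close>
  only.\<close>

lemma curvature_fields:
  assumes p: "p \<in> fst c" and X: "smooth_field_near M p X" and Y: "smooth_field_near M p Y" and Z: "smooth_field_near M p Z"
  shows "conn M p (X p) (\<lambda>q. conn M q (Y q) Z) - conn M p (Y p) (\<lambda>q. conn M q (X q) Z)
      - conn M p (lie_bracket M X Y p) Z =
    chart_vec M c p (curv M c (snd c p) (comps c (X p)) (comps c (Y p)) (comps c (Z p)))"
proof -
  obtain W1 where W1: "snd c p \<in> W1" "field_rep c X W1" using X smooth_field_near_iff[OF c p] by blast
  obtain W2 where W2: "snd c p \<in> W2" "field_rep c Y W2" using Y smooth_field_near_iff[OF c p] by blast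
  obtain W3 where W3: "snd c p \<in> W3" "field_rep c Z W3" using Z smooth_field_near_iff[OF c p] by blast
  define W where "W = W1 \<inter> W2 \<inter> W3"
  define x where "x = snd c p"
  have W: "open W" "x \<in> W" using W1 W2 W3 by (auto simp: W_def x_def field_rep_def)
  have rX: "field_rep c X W" by (rule field_rep_mono[OF W1(2) _ W(1)]) (auto simp: W_def)
  have rY: "field_rep c Y W" by (rule field_rep_mono[OF W2(2) _ W(1)]) (auto simp: W_def)
  have rZ: "field_rep c Z W" by (rule field_rep_mono[OF W3(2) _ W(1)]) (auto simp: W_def)
  have Wc: "W \<subseteq> chart_img c" using rX by (simp add: field_rep_def)
  have xp: "chart_inv c x = p" "x \<in> chart_img c" using c p by (auto simp: x_def)
  have pp: "p \<in> points M" by (rule chart_points[OF c p])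
  define \<xi> \<eta> \<zeta> where "\<xi> y = comps c (X (chart_inv c y))" and "\<eta> y = comps c (Y (chart_inv c y))"
    and "\<zeta> y = comps c (Z (chart_inv c y))" for y
  have sm: "smooth_on W \<xi>" "smooth_on W \<eta>" "smooth_on W \<zeta>"
    using rX rY rZ by (simp_all add: field_rep_def \<xi>_def[abs_def] \<eta>_def[abs_def] \<zeta>_def[abs_def])
  note smG = smooth_bil_mono[OF christoffel_smooth[OF c] Wc]
  note smD = smooth_lin_D[OF W(1) sm(3)]
  \<comment> \<open>One computation for both orders of differentiation: \<open>U\<close>,
    \<open>V\<close> will be \<open>Y\<close>, \<open>X\<close> and then \<open>X\<close>,
    \<open>Y\<close>.\<close>
  have inner: "conn M p (V p) (\<lambda>q. conn M q (U q) Z) = chart_vec M c p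
      (dder (\<lambda>y. dder \<zeta> y \<upsilon>) x \<omega> + dder \<zeta> x \<delta> + (dder (\<lambda>y. christoffel M c y \<upsilon> (\<zeta> x)) x \<omega> +
        christoffel M c x \<delta> (\<zeta> x) + christoffel M c x \<upsilon> (dder \<zeta> x \<omega>)) +
        christoffel M c x \<omega> (dder \<zeta> x \<upsilon> + christoffel M c x \<upsilon> (\<zeta> x)))"
    if U: "field_rep c U W" and V: "field_rep c V W" and
      d: "\<upsilon> = comps c (U p)" "\<omega> = comps c (V p)" "\<delta> = dder (\<lambda>y. comps c (U (chart_inv c y))) x \<omega>" for U V \<upsilon> \<omega> \<delta>
  proof -
    define \<tau> where "\<tau> y = comps c (U (chart_inv c y))" for y
    have sm\<tau>: "smooth_on W \<tau>" using U by (simp add: field_rep_def \<tau>_def[abs_def])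
    define \<nu> where "\<nu> y = dder \<zeta> y (\<tau> y) + christoffel M c y (\<tau> y) (\<zeta> y)" for y
    have sm1: "smooth_on W (\<lambda>y. dder \<zeta> y (\<tau> y))" by (rule smooth_lin_apply[OF W(1) smD sm\<tau>])
    have sm2: "smooth_on W (\<lambda>y. christoffel M c y (\<tau> y) (\<zeta> y))" by (rule smooth_bil_apply[OF W(1) smG sm\<tau> sm(3)])
    have sm\<nu>: "smooth_on W \<nu>" unfolding \<nu>_def by (rule smooth_on_add[OF W(1) sm1 sm2])
    have eq: "conn M (chart_inv c y) (U (chart_inv c y)) Z = chart_vec M c (chart_inv c y) (\<nu> y)" if "y \<in> W" for y
    proof -
      have y: "y \<in> chart_img c" using that Wc by auto
      show ?thesis
        using conn_rep[OF c chart_inv(3)[OF c y] rZ, of "\<tau> y"] field_rep_apply[OF c U that] that y c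
        by (simp add: \<nu>_def \<tau>_def \<zeta>_def[abs_def])
    qed
    have r: "field_rep c (\<lambda>q. conn M q (U q) Z) W" by (rule field_repI[OF c W(1) Wc sm\<nu> eq])
    have comps_eq: "comps c (conn M (chart_inv c y) (U (chart_inv c y)) Z) = \<nu> y" if "y \<in> W" for y
      using that Wc c by (auto simp: eq)
    have Vp: "V p = chart_vec M c p \<omega>" using field_rep_apply[OF c V W(2)] by (simp add: xp d)
    have "conn M p (V p) (\<lambda>q. conn M q (U q) Z) = chart_vec M c p (dder \<nu> x \<omega> + christoffel M c x \<omega> (\<nu> x))"
      using conn_rep[OF c p r, of \<omega>] W(2) dder_cong_open[OF W comps_eq] comps_eq[OF W(2)]
      by (simp add: Vp x_def[symmetric] xp)
    also have "dder \<nu> x \<omega> = dder (\<lambda>y. dder \<zeta> y (\<tau> y)) x \<omega> + dder (\<lambda>y. christoffel M c y (\<tau> y) (\<zeta> y)) x \<omega>"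
      unfolding \<nu>_def
      using dder_eqI[OF has_derivative_add[OF smooth_on_has_derivative[OF sm1 W(2)] smooth_on_has_derivative[OF sm2 W(2)]]] by simp
    also have "dder (\<lambda>y. dder \<zeta> y (\<tau> y)) x \<omega> = dder (\<lambda>y. dder \<zeta> y (\<tau> x)) x \<omega> + dder \<zeta> x (dder \<tau> x \<omega>)"
      by (rule smooth_lin_dder[OF W(1) smD sm\<tau> W(2)])
    also have "dder (\<lambda>y. christoffel M c y (\<tau> y) (\<zeta> y)) x \<omega> = dder (\<lambda>y. christoffel M c y (\<tau> x) (\<zeta> x)) x \<omega> +
        christoffel M c x (dder \<tau> x \<omega>) (\<zeta> x) + christoffel M c x (\<tau> x) (dder \<zeta> x \<omega>)"
      by (rule smooth_bil_dder[OF W(1) smG sm\<tau> sm(3) W(2)])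
    also have "\<nu> x = dder \<zeta> x (\<tau> x) + christoffel M c x (\<tau> x) (\<zeta> x)" by (simp add: \<nu>_def)
    finally show ?thesis by (simp add: \<tau>_def[abs_def] d xp)
  qed
  note G = bilinear_simps[OF christoffel_bilinear[OF c xp(2)]]
  have at: "comps c (X p) = \<xi> x" "comps c (Y p) = \<eta> x" "comps c (Z p) = \<zeta> x" by (simp_all add: \<xi>_def \<eta>_def \<zeta>_def xp)
  have reps: "(\<lambda>y. comps c (X (chart_inv c y))) = \<xi>" "(\<lambda>y. comps c (Y (chart_inv c y))) = \<eta>"
    "(\<lambda>y. comps c (Z (chart_inv c y))) = \<zeta>"
    by (simp_all add: fun_eq_iff \<xi>_def \<eta>_def \<zeta>_def)
  have XY: "X p = chart_vec M c p (\<xi> x)" "Y p = chart_vec M c p (\<eta> x)"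
    using field_rep_apply[OF c rX W(2)] field_rep_apply[OF c rY W(2)] by (simp_all add: \<xi>_def \<eta>_def xp)
  define \<beta> where "\<beta> = dder \<eta> x (\<xi> x) - dder \<xi> x (\<eta> x)"
  \<comment> \<open>The bracket is read off from the torsion identity, both of whose derivatives
    have known components, instead of from its definition on functions.\<close>
  have "lie_bracket M X Y p = chart_vec M c p \<beta>"
  proof -
    have "conn M p (X p) Y = chart_vec M c p (dder \<eta> x (\<xi> x) + christoffel M c x (\<xi> x) (\<eta> x))"
      unfolding XY(1) using conn_rep[OF c p rY, of "\<xi> x"] W(2) unfolding x_def[symmetric] reps at by simp
    moreover have "conn M p (Y p) X = chart_vec M c p (dder \<xi> x (\<eta> x) + christoffel M c x (\<eta> x) (\<xi> x))"
      unfolding XY(2) using conn_rep[OF c p rX, of "\<eta> x"] W(2) unfolding x_def[symmetric] reps at by simp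
    ultimately show ?thesis
      unfolding conn_torsion[OF pp X Y, symmetric]
      by (simp add: chart_vec_simps(2)[OF c p, symmetric] \<beta>_def christoffel_sym[OF c xp(2), of "\<xi> x" "\<eta> x"])
  qed
  then have br: "conn M p (lie_bracket M X Y p) Z = chart_vec M c p (dder \<zeta> x \<beta> + christoffel M c x \<beta> (\<zeta> x))"
    using conn_rep[OF c p rZ, of \<beta>] W(2) unfolding x_def[symmetric] reps at by simp
  have cl: "dder (\<lambda>y. dder \<zeta> y (\<eta> x)) x (\<xi> x) = dder (\<lambda>y. dder \<zeta> y (\<xi> x)) x (\<eta> x)"
    by (rule dder_dder_commute[OF W(1) sm(3) W(2)])
  have d\<beta>: "dder \<zeta> x \<beta> = dder \<zeta> x (dder \<eta> x (\<xi> x)) - dder \<zeta> x (dder \<xi> x (\<eta> x))"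
    unfolding \<beta>_def by (rule linear_diff[OF smooth_on_linear_dder[OF sm(3) W(2)]])
  show ?thesis
    unfolding inner[OF rY rX refl refl refl] inner[OF rX rY refl refl refl] br chart_vec_simps(2)[OF c p, symmetric] at reps
    by (rule arg_cong[of _ _ "chart_vec M c p"]) (simp add: curv_def x_def[symmetric] cl d\<beta>[unfolded \<beta>_def] \<beta>_def G algebra_simps)
qed

lemma riemann_curvature_eq:
  assumes p: "p \<in> fst c"
  shows "riemann_curvature M p (chart_vec M c p u) (chart_vec M c p v) (chart_vec M c p w) =
    chart_vec M c p (curv M c (snd c p) u v w)"
  unfolding riemann_curvature_def
proof (rule the_equality)
  show "\<forall>X Y Z. smooth_field_near M p X \<and> smooth_field_near M p Y \<and> smooth_field_near M p Z \<and>
      X p = chart_vec M c p u \<and> Y p = chart_vec M c p v \<and> Z p = chart_vec M c p w \<longrightarrow>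
      chart_vec M c p (curv M c (snd c p) u v w) = conn M p (X p) (\<lambda>q. conn M q (Y q) Z) -
        conn M p (Y p) (\<lambda>q. conn M q (X q) Z) - conn M p (lie_bracket M X Y p) Z"
  proof (intro allI impI, elim conjE)
    fix X Y Z assume h: "smooth_field_near M p X" "smooth_field_near M p Y" "smooth_field_near M p Z"
      and e: "X p = chart_vec M c p u" "Y p = chart_vec M c p v" "Z p = chart_vec M c p w"
    have "comps c (X p) = u" "comps c (Y p) = v" "comps c (Z p) = w" using c p by (simp_all add: e)
    then show "chart_vec M c p (curv M c (snd c p) u v w) = conn M p (X p) (\<lambda>q. conn M q (Y q) Z) -
        conn M p (Y p) (\<lambda>q. conn M q (X q) Z) - conn M p (lie_bracket M X Y p) Z"
      using curvature_fields[OF p h] by simp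
  qed
  fix z
  assume *: "\<forall>X Y Z. smooth_field_near M p X \<and> smooth_field_near M p Y \<and> smooth_field_near M p Z \<and>
      X p = chart_vec M c p u \<and> Y p = chart_vec M c p v \<and> Z p = chart_vec M c p w \<longrightarrow>
      z = conn M p (X p) (\<lambda>q. conn M q (Y q) Z) -
        conn M p (Y p) (\<lambda>q. conn M q (X q) Z) - conn M p (lie_bracket M X Y p) Z"
  \<comment> \<open>Uniqueness in the definite description needs one admissible choice of
    extensions; fields with constant components serve.\<close>
  note s = const_field_smooth[OF c p]
  have "z = conn M p (chart_vec M c p u) (\<lambda>q. conn M q (chart_vec M c q v) (\<lambda>q. chart_vec M c q w)) -
      conn M p (chart_vec M c p v) (\<lambda>q. conn M q (chart_vec M c q u) (\<lambda>q. chart_vec M c q w)) -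
      conn M p (lie_bracket M (\<lambda>q. chart_vec M c q u) (\<lambda>q. chart_vec M c q v) p) (\<lambda>q. chart_vec M c q w)"
    by (rule *[THEN spec, THEN spec, THEN spec, THEN mp]) (intro conjI s refl)
  also have "\<dots> = chart_vec M c p (curv M c (snd c p) (comps c (chart_vec M c p u)) (comps c (chart_vec M c p v)) (comps c (chart_vec M c p w)))"
    by (rule curvature_fields[OF p s s s])
  finally show "z = chart_vec M c p (curv M c (snd c p) u v w)" using c p by simp
qed

lemma curv_linear:
  assumes x: "x \<in> chart_img c"
  shows "linear (\<lambda>u. curv M c x u v w)" "linear (\<lambda>w. curv M c x u v w)" "curv M c x v u w = - curv M c x u v w"
proof -
  note S = chartD(3)[OF c] and sm = christoffel_smooth[OF c]
  note d1 = smooth_lin_dder_linear[OF S x smooth_bil_lin1[OF sm]] and d2 = smooth_lin_dder_linear[OF S x smooth_bil_lin2[OF sm]]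
  have d0: "linear (dder (\<lambda>y. christoffel M c y v w) x)" for v w
    using sm by (intro smooth_on_linear_dder[OF _ x]) (simp add: smooth_bil_def)
  note G = bilinear_simps[OF christoffel_bilinear[OF c x]]
  show "linear (\<lambda>u. curv M c x u v w)"
    unfolding curv_def
    by (rule linearI) (simp_all add: linear_add[OF d0] linear_cmul[OF d0] linear_add[OF d1] linear_cmul[OF d1] G algebra_simps)
  show "linear (\<lambda>w. curv M c x u v w)"
    unfolding curv_def
    by (rule linearI) (simp_all add: linear_add[OF d2] linear_cmul[OF d2] G algebra_simps)
  show "curv M c x v u w = - curv M c x u v w"
    by (simp add: curv_def)
qed

text \<open>The second derivatives of the squared length of a constant-component field commute.
  Expanded by metric compatibility, their difference is twice the quantity claimed to
  vanish.\<close>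

lemma curv_skew:
  assumes x: "x \<in> chart_img c"
  shows "gmet M c x (curv M c x u v w) w = 0"
proof -
  note S = chartD(3)[OF c] and sm = christoffel_smooth[OF c] and smg = gmet_smooth[OF c]
  have smv: "smooth_on (chart_img c) (\<lambda>y. christoffel M c y v w)" for v w
    using sm by (simp add: smooth_bil_def)
  define f where "f y = gmet M c y w w" for y
  have smf: "smooth_on (chart_img c) f" using smg by (simp add: smooth_bil_def f_def[abs_def])
  note gb = bilinear_simps[OF inner_form_bilinear[OF gmet_inner_form[OF c x]]]
  have df: "dder f y v = 2 * gmet M c y (christoffel M c y v w) w" if "y \<in> chart_img c" for y v
    unfolding f_def christoffel_metric[OF c that]
    using inner_form_sym[OF gmet_inner_form[OF c that], of w "christoffel M c y v w"] by simp
  have ddf: "dder (\<lambda>y. dder f y v) x u = 2 * (gmet M c x (christoffel M c x u (christoffel M c x v w)) w +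
      gmet M c x (christoffel M c x v w) (christoffel M c x u w) + gmet M c x (dder (\<lambda>y. christoffel M c y v w) x u) w)" for u v
  proof -
    have "dder (\<lambda>y. dder f y v) x = dder (\<lambda>y. 2 * gmet M c y (christoffel M c y v w) w) x"
      by (rule dder_cong_open[OF S x df])
    moreover have "dder (\<lambda>y. 2 * gmet M c y (christoffel M c y v w) w) x u = 2 * dder (\<lambda>y. gmet M c y (christoffel M c y v w) w) x u"
      using dder_eqI[OF has_derivative_mult_right[OF smooth_on_has_derivative[OF
            smooth_bil_apply[OF S smg smv smooth_on_const] x]], of 2 v w w] by simp
    moreover have "dder (\<lambda>y. gmet M c y (christoffel M c y v w) w) x u =
        dder (\<lambda>y. gmet M c y (christoffel M c x v w) w) x u + gmet M c x (dder (\<lambda>y. christoffel M c y v w) x u) w"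
      using smooth_bil_dder[OF S smg smv smooth_on_const x, of v w w u] by (simp add: gb)
    ultimately show ?thesis by (simp add: christoffel_metric[OF c x])
  qed
  have "dder (\<lambda>y. dder f y v) x u = dder (\<lambda>y. dder f y u) x v"
    by (rule dder_dder_commute_real[OF S smf x])
  then show ?thesis
    unfolding ddf
    using inner_form_sym[OF gmet_inner_form[OF c x], of "christoffel M c x v w" "christoffel M c x u w"]
    by (simp add: curv_def gb)
qed

text \<open>Independence of the basis: a change of basis multiplies numerator and denominator by the
  square of its determinant, by antisymmetry of the curvature in its first pair of arguments and in
  its last pair.\<close>

lemma sectional_curvature_eq:
  assumes x: "x \<in> chart_img c" and ind: "\<And>a b. a *\<^sub>R u + b *\<^sub>R v = 0 \<Longrightarrow> a = 0 \<and> b = 0"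
    and P: "P = {chart_vec M c (chart_inv c x) (a *\<^sub>R u + b *\<^sub>R v) | a b. True}"
  shows "sectional_curvature M (chart_inv c x) P =
    gmet M c x (curv M c x u v v) u / (gmet M c x u u * gmet M c x v v - (gmet M c x u v)\<^sup>2)"
proof -
  let ?p = "chart_inv c x" and ?g = "gmet M c x" and ?R = "curv M c x"
  let ?cv = "chart_vec M c ?p"
  have p: "?p \<in> fst c" and sx: "snd c ?p = x" using x c by auto
  note cv = chart_vec_linear[OF c p]
  have inj: "?cv s = ?cv t \<longleftrightarrow> s = t" for s t using comps_chart_vec[OF c p] by metis
  have cv0: "?cv t = 0 \<longleftrightarrow> t = 0" for t using inj[of t 0] chart_vec_simps(4)[OF c p] by simp
  note gb = bilinear_simps[OF inner_form_bilinear[OF gmet_inner_form[OF c x]]]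
  note gsym = inner_form_sym[OF gmet_inner_form[OF c x]]
  note L1 = curv_linear(1)[OF x] and L3 = curv_linear(2)[OF x] and alt = curv_linear(3)[OF x]
  have L2: "?R u (v + v') w = ?R u v w + ?R u v' w" "?R u (r *\<^sub>R v) w = r *\<^sub>R ?R u v w" for u v v' w r
    using alt[of u "v + v'" w] alt[of u v w] alt[of u v' w] alt[of u "r *\<^sub>R v" w] linear_add[OF L1] linear_cmul[OF L1] by simp_all
  have alt0: "?R u u w = 0" for u w by (simp add: curv_def)
  have skew: "?g (?R a b s) t = - ?g (?R a b t) s" for a b s t
    using curv_skew[OF x, of a b "s + t"] curv_skew[OF x, of a b s] curv_skew[OF x, of a b t]
    by (simp add: linear_add[OF L3] gb)
  define N where "N = ?g (?R u v v) u"
  define D where "D = ?g u u * ?g v v - (?g u v)\<^sup>2"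
  have val: "metric M ?p (riemann_curvature M ?p U V V) U / (metric M ?p U U * metric M ?p V V - (metric M ?p U V)\<^sup>2) = N / D"
    if UV: "U \<noteq> V" "independent {U, V}" "span {U, V} = P" for U V
  proof -
    have "U \<in> P" "V \<in> P" using UV(3) by (auto intro: span_base)
    then obtain a b a' b' where U: "U = ?cv (a *\<^sub>R u + b *\<^sub>R v)" and V: "V = ?cv (a' *\<^sub>R u + b' *\<^sub>R v)" unfolding P by blast
    \<comment> \<open>Determinant of the change of basis; if it vanished, \<open>U\<close> and
      \<open>V\<close> would be dependent.\<close>
    define \<Delta> where "\<Delta> = a * b' - b * a'"
    have "\<Delta> \<noteq> 0"
    proof
      assume \<Delta>: "\<Delta> = 0"
      have "b' *\<^sub>R (a *\<^sub>R u + b *\<^sub>R v) + (- b) *\<^sub>R (a' *\<^sub>R u + b' *\<^sub>R v) = \<Delta> *\<^sub>R u"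
        by (simp add: \<Delta>_def algebra_simps)
      then have "b' *\<^sub>R U + (- b) *\<^sub>R V = 0" unfolding U V cv[symmetric] using \<Delta> cv0 by simp
      then have 1: "b' = 0" "b = 0" using UV(1,2) independent_pair[OF UV(1)] by (metis, metis neg_equal_0_iff_equal)
      have "(- a') *\<^sub>R (a *\<^sub>R u + b *\<^sub>R v) + a *\<^sub>R (a' *\<^sub>R u + b' *\<^sub>R v) = \<Delta> *\<^sub>R v"
        by (simp add: \<Delta>_def algebra_simps)
      then have "(- a') *\<^sub>R U + a *\<^sub>R V = 0" unfolding U V cv[symmetric] using \<Delta> cv0 by simp
      then have "a' = 0" "a = 0" using UV(1,2) independent_pair[OF UV(1)] by (metis neg_equal_0_iff_equal, metis)
      then show False using 1 UV(1) by (simp add: U V)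
    qed
    have R: "?R (a *\<^sub>R u + b *\<^sub>R v) (a' *\<^sub>R u + b' *\<^sub>R v) w = \<Delta> *\<^sub>R ?R u v w" for w
      using alt[of u v w]
      by (simp add: linear_add[OF L1] linear_cmul[OF L1] L2 alt0 \<Delta>_def algebra_simps)
    have num: "metric M ?p (riemann_curvature M ?p U V V) U = \<Delta>\<^sup>2 * N"
    proof -
      have "metric M ?p (riemann_curvature M ?p U V V) U =
          ?g (?R (a *\<^sub>R u + b *\<^sub>R v) (a' *\<^sub>R u + b' *\<^sub>R v) (a' *\<^sub>R u + b' *\<^sub>R v)) (a *\<^sub>R u + b *\<^sub>R v)"
        unfolding U V riemann_curvature_eq[OF p] metric_gmet[OF c p] sx ..
      also have "\<dots> = \<Delta> * (\<Delta> * ?g (?R u v v) u)"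
        unfolding R using skew[of u v u v] curv_skew[OF x, of u v u] curv_skew[OF x, of u v v]
        by (simp add: linear_add[OF L3] linear_cmul[OF L3] gb \<Delta>_def algebra_simps)
      finally show ?thesis by (simp add: N_def power2_eq_square)
    qed
    have "metric M ?p U U * metric M ?p V V - (metric M ?p U V)\<^sup>2 = \<Delta>\<^sup>2 * D"
      unfolding U V metric_gmet[OF c p] sx D_def \<Delta>_def using gsym[of v u]
      by (simp add: gb power2_eq_square algebra_simps)
    then show ?thesis using num \<open>\<Delta> \<noteq> 0\<close> by simp
  qed
  have uv: "u \<noteq> v" using ind[of 1 "-1"] by auto
  have ne: "?cv u \<noteq> ?cv v" using inj uv by simp
  have base: "independent {?cv u, ?cv v}"
    unfolding independent_pair[OF ne] cv[symmetric] cv0 using ind by blast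
  have sp: "span {?cv u, ?cv v} = P"
    unfolding P set_eq_iff span_pair cv[symmetric] by blast
  show ?thesis
    unfolding sectional_curvature_def N_def[symmetric] D_def[symmetric]
  proof (rule the_equality)
    show "\<forall>U V. U \<noteq> V \<and> independent {U, V} \<and> span {U, V} = P \<longrightarrow>
        N / D = metric M ?p (riemann_curvature M ?p U V V) U / (metric M ?p U U * metric M ?p V V - (metric M ?p U V)\<^sup>2)"
      using val by simp
    fix k
    assume "\<forall>U V. U \<noteq> V \<and> independent {U, V} \<and> span {U, V} = P \<longrightarrow>
        k = metric M ?p (riemann_curvature M ?p U V V) U / (metric M ?p U U * metric M ?p V V - (metric M ?p U V)\<^sup>2)"
    then show "k = N / D" using ne base sp val[OF ne base sp] by blast
  qed
qed

end

end

subsection \<open>Immersed surfaces in coordinates\<close>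

text \<open>The image of \<open>c\<close> lies in a single chart \<open>d\<close>, so
  \<open>\<phi>\<close> becomes a map \<open>F\<close> of open sets. Only what concerns
  \<open>c\<close> is assumed, since the locale is used first for an arbitrary chart and then for
  the adapted one.\<close>

locale surface_chart = M: riem_mfd M + N: riem_mfd N
  for M :: "('a, 2) riem" and N :: "('b, 'n::finite) riem" +
  fixes \<phi> :: "'a \<Rightarrow> 'b" and c :: "('a, 2) chart" and d :: "('b, 'n) chart"
  assumes c: "c \<in> charts M" and d: "d \<in> charts N" and maps: "\<phi> ` fst c \<subseteq> fst d"
    and smooth_rep: "smooth_on (chart_img c) (\<lambda>x. snd d (\<phi> (chart_inv c x)))"
    and isometric: "p \<in> fst c \<Longrightarrow> u \<in> tangent_space M p \<Longrightarrow> v \<in> tangent_space M p \<Longrightarrow>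
      metric N (\<phi> p) (differential M N \<phi> p u) (differential M N \<phi> p v) = metric M p u v"
begin

abbreviation "\<Omega> \<equiv> chart_img c"
definition "F x = snd d (\<phi> (chart_inv c x))"
abbreviation "g \<equiv> gmet M c"
abbreviation "\<Gamma> \<equiv> christoffel M c"
abbreviation "gN \<equiv> gmet N d"
abbreviation "\<Gamma>N \<equiv> christoffel N d"

lemma open_\<Omega>: "open \<Omega>"
  by (rule M.chartD(3)[OF c])

lemma smF: "smooth_on \<Omega> F"
  using smooth_rep by (simp add: F_def[abs_def])

lemma phi_in: "p \<in> fst c \<Longrightarrow> \<phi> p \<in> fst d"
  using maps by auto

lemma F_img: "F ` \<Omega> \<subseteq> chart_img d"
  using phi_in M.chart_inv(3)[OF c] by (auto simp: F_def)

lemma F_snd: "p \<in> fst c \<Longrightarrow> F (snd c p) = snd d (\<phi> p)"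
  using c by (simp add: F_def)

lemma inv_F: "x \<in> \<Omega> \<Longrightarrow> chart_inv d (F x) = \<phi> (chart_inv c x)"
  unfolding F_def by (rule N.chart_inv(1)[OF d phi_in[OF M.chart_inv(3)[OF c]]])

lemma differential_rep:
  assumes p: "p \<in> fst c"
  shows "differential M N \<phi> p (chart_vec M c p \<xi>) = chart_vec N d (\<phi> p) (dder F (snd c p) \<xi>)"
proof
  fix f
  show "differential M N \<phi> p (chart_vec M c p \<xi>) f = chart_vec N d (\<phi> p) (dder F (snd c p) \<xi>) f"
  proof (cases "smooth_near N (\<phi> p) f")
    case True
    have x: "snd c p \<in> \<Omega>" using p by simp
    have smf: "smooth_at (F (snd c p)) (\<lambda>y. f (chart_inv d y))"
      using True N.smooth_near_iff[OF d phi_in[OF p]] F_snd[OF p] by simp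
    have Fat: "smooth_at (snd c p) F" by (rule smooth_atI[OF open_\<Omega> x smF])
    have eq: "f (chart_inv d (F x)) = f (\<phi> (chart_inv c x))" if "x \<in> \<Omega>" for x using inv_F[OF that] by simp
    have near: "smooth_near M p (f \<circ> \<phi>)"
      unfolding M.smooth_near_iff[OF c p]
      using smooth_at_cong[OF open_\<Omega> x, of "\<lambda>x. f (chart_inv d (F x))" "\<lambda>x. f (\<phi> (chart_inv c x))"] eq
        smooth_at_compose[OF Fat smf] by simp
    have "chart_vec M c p \<xi> (f \<circ> \<phi>) = dder (\<lambda>x. f (chart_inv d (F x))) (snd c p) \<xi>"
      unfolding M.chart_vec_apply[OF c p near]
      using dder_cong_open[OF open_\<Omega> x, of "\<lambda>x. f (chart_inv d (F x))" "\<lambda>x. f (\<phi> (chart_inv c x))"] eq by simp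
    also have "\<dots> = dder (\<lambda>y. f (chart_inv d y)) (F (snd c p)) (dder F (snd c p) \<xi>)"
      by (rule dder_compose_at[OF Fat smf])
    finally show ?thesis
      using True by (simp add: differential_def N.chart_vec_apply[OF d phi_in[OF p]] F_snd[OF p])
  qed (simp add: differential_def chart_vec_def)
qed

lemma isometric_rep:
  assumes x: "x \<in> \<Omega>" shows "gN (F x) (dder F x \<xi>) (dder F x \<eta>) = g x \<xi> \<eta>"
proof -
  let ?p = "chart_inv c x"
  have p: "?p \<in> fst c" and sx: "snd c ?p = x" using x c by auto
  show ?thesis
    using isometric[OF p M.chart_vec_tangent[OF c p] M.chart_vec_tangent[OF c p], of \<xi> \<eta>]
    unfolding differential_rep[OF p] M.metric_gmet[OF c p] N.metric_gmet[OF d phi_in[OF p]] sx F_snd[OF p, symmetric] .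
qed

text \<open>The pull-back connection is defined through an arbitrary chart of the target. For any
  such chart \<open>d'\<close> the field is expanded in the coordinate fields of \<open>d'\<close>;
  differentiating this expansion in \<open>d\<close> produces the defining expression, so its value
  does not depend on \<open>d'\<close>.\<close>

lemma conn_along_rep:
  assumes p: "p \<in> fst c" and W: "open W" "W \<subseteq> \<Omega>" "snd c p \<in> W" and \<nu>: "smooth_on W \<nu>"
    and V: "\<And>x. x \<in> W \<Longrightarrow> V (chart_inv c x) = chart_vec N d (\<phi> (chart_inv c x)) (\<nu> x)"
  shows "conn_along M N \<phi> p (chart_vec M c p \<xi>) V = chart_vec N d (\<phi> p)
    (dder \<nu> (snd c p) \<xi> + \<Gamma>N (F (snd c p)) (dder F (snd c p) \<xi>) (\<nu> (snd c p)))"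
proof -
  define x where "x = snd c p"
  define y where "y = F x"
  let ?q = "\<phi> p" and ?u = "chart_vec M c p \<xi>" and ?w = "dder F x \<xi>"
  have x: "x \<in> \<Omega>" "x \<in> W" "chart_inv c x = p" using p W c by (auto simp: x_def)
  have q: "?q \<in> fst d" and yq: "y = snd d ?q" using phi_in[OF p] F_snd[OF p] by (simp_all add: x_def y_def)
  have y: "y \<in> chart_img d" using q by (simp add: yq)
  define T where "T d' = (\<Sum>a\<in>UNIV. ?u (\<lambda>q. coord_diff d' a (V q)) *\<^sub>R coord_field N d' a ?q
            + coord_diff d' a (V p) *\<^sub>R conn N ?q (differential M N \<phi> p ?u) (coord_field N d' a))" for d'
  define R where "R = chart_vec N d ?q (dder \<nu> x \<xi> + \<Gamma>N y ?w (\<nu> x))"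
  have main: "T d' = R" if d': "d' \<in> charts N" "?q \<in> fst d'" for d'
  proof -
    \<comment> \<open>Components in \<open>d\<close> of the coordinate fields of \<open>d'\<close>,
      that is, the columns of the Jacobian from \<open>d'\<close> to \<open>d\<close>.\<close>
    define \<kappa> where "\<kappa> a z = comps d (coord_field N d' a (chart_inv d z))" for a z
    have cf: "N.field_rep d (coord_field N d' a) (snd d ` (fst d \<inter> fst d'))" for a
    proof (rule N.field_repI[OF d N.overlap_open[OF d d'(1)]])
      have sm: "smooth_on (snd d ` (fst d \<inter> fst d')) (\<lambda>z. snd d' (chart_inv d z))"
        by (rule N.transition_smooth[OF d d'(1)])
      show "snd d ` (fst d \<inter> fst d') \<subseteq> chart_img d" by auto
      have im: "(\<lambda>z. snd d' (chart_inv d z)) ` (snd d ` (fst d \<inter> fst d')) \<subseteq> snd d' ` (fst d' \<inter> fst d)"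
        using d by auto
      show "smooth_on (snd d ` (fst d \<inter> fst d')) (\<lambda>z. dder (\<lambda>z. snd d (chart_inv d' z)) (snd d' (chart_inv d z)) (axis a 1))"
        by (rule smooth_on_compose[OF N.overlap_open[OF d d'(1)] N.overlap_open[OF d'(1) d] im sm
              smooth_on_dder[OF N.transition_smooth[OF d'(1) d]]])
      fix z assume "z \<in> snd d ` (fst d \<inter> fst d')"
      then have z: "chart_inv d z \<in> fst d" "chart_inv d z \<in> fst d'" using d by auto
      show "coord_field N d' a (chart_inv d z) =
          chart_vec N d (chart_inv d z) (dder (\<lambda>z. snd d (chart_inv d' z)) (snd d' (chart_inv d z)) (axis a 1))"
        unfolding coord_field_def by (rule N.chart_vec_change[OF d'(1) z(2) d z(1)])
    qed
    have O: "open (snd d ` (fst d \<inter> fst d'))" "y \<in> snd d ` (fst d \<inter> fst d')"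
      using N.overlap_open[OF d d'(1)] q d' by (auto simp: yq)
    have sm\<kappa>: "smooth_on (snd d ` (fst d \<inter> fst d')) (\<kappa> a)" for a
      using cf[of a] by (simp add: N.field_rep_def \<kappa>_def[abs_def])
    \<comment> \<open>Where \<open>F\<close> stays inside both charts of the target; only here do
      both expansions make sense.\<close>
    define U where "U = W \<inter> F -` (snd d ` (fst d \<inter> fst d'))"
    have U: "open U" "x \<in> U" "U \<subseteq> W"
      using continuous_open_preimage[OF smooth_on_continuous_on[OF smooth_on_mono[OF smF W(2)]] W(1) O(1)] x(2) O(2)
      by (auto simp: U_def y_def)
    have FU: "F ` U \<subseteq> snd d ` (fst d \<inter> fst d')" by (auto simp: U_def)
    have smFU: "smooth_on U F" by (rule smooth_on_mono[OF smF]) (use U W in auto)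
    define \<nu>' where "\<nu>' z = dder (\<lambda>z. snd d' (chart_inv d z)) (F z) (\<nu> z)" for z
    have sm\<nu>': "smooth_on U \<nu>'"
    proof -
      have "smooth_lin U (\<lambda>z. dder (\<lambda>z. snd d' (chart_inv d z)) (F z))"
        by (rule smooth_lin_compose[OF U(1) O(1) FU smFU smooth_lin_D[OF O(1) N.transition_smooth[OF d d'(1)]]])
      from smooth_lin_apply[OF U(1) this smooth_on_mono[OF \<nu> U(3)]] show ?thesis by (simp add: \<nu>'_def[abs_def])
    qed
    have in_U: "chart_inv c z \<in> fst c" "\<phi> (chart_inv c z) \<in> fst d" "\<phi> (chart_inv c z) \<in> fst d'"
      "F z = snd d (\<phi> (chart_inv c z))" if z: "z \<in> U" for z
    proof -
      have zO: "z \<in> \<Omega>" using z U W by auto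
      show "chart_inv c z \<in> fst c" by (rule M.chart_inv(3)[OF c zO])
      then show qd: "\<phi> (chart_inv c z) \<in> fst d" by (rule phi_in)
      show Fz: "F z = snd d (\<phi> (chart_inv c z))" by (simp add: F_def)
      have "F z \<in> snd d ` (fst d \<inter> fst d')" using z unfolding U_def by blast
      then obtain r where r: "r \<in> fst d \<inter> fst d'" "F z = snd d r" by blast
      have "r = \<phi> (chart_inv c z)"
        by (rule inj_onD[OF N.chartD(4)[OF d] trans[OF r(2)[symmetric] Fz] _ qd]) (use r in simp)
      then show "\<phi> (chart_inv c z) \<in> fst d'" using r by simp
    qed
    have VU: "comps d' (V (chart_inv c z)) = \<nu>' z" if z: "z \<in> U" for z
    proof -
      have "V (chart_inv c z) = chart_vec N d (\<phi> (chart_inv c z)) (\<nu> z)" using V U(3) z by auto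
      then show ?thesis
        using N.comps_chart_vec_change[OF d in_U(2)[OF z] d'(1) in_U(3)[OF z]] in_U(4)[OF z] by (simp add: \<nu>'_def)
    qed
    have expand: "\<nu> z = (\<Sum>a\<in>UNIV. (\<nu>' z $ a) *\<^sub>R \<kappa> a (F z))" if z: "z \<in> U" for z
    proof -
      let ?r = "\<phi> (chart_inv c z)"
      have zO: "z \<in> \<Omega>" using z U W by auto
      note l' = N.chart_vec_simps(5)[OF d'(1) in_U(3)[OF z]] and l = N.chart_vec_simps(5)[OF d in_U(2)[OF z]]
      have "chart_vec N d ?r (\<nu> z) = chart_vec N d' ?r (\<nu>' z)"
        unfolding VU[OF z, symmetric]
        using V U(3) z N.chart_vec_comps[OF d'(1) in_U(3)[OF z] N.chart_vec_tangent[OF d in_U(2)[OF z]]] by auto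
      also have "\<dots> = (\<Sum>a\<in>UNIV. (\<nu>' z $ a) *\<^sub>R chart_vec N d' ?r (axis a 1))"
        by (subst N.axis_expansion[of "\<nu>' z"]) (simp only: linear_sum[OF l'] linear_cmul[OF l'])
      also have "\<dots> = (\<Sum>a\<in>UNIV. (\<nu>' z $ a) *\<^sub>R chart_vec N d ?r (\<kappa> a (F z)))"
      proof (rule sum.cong[OF refl])
        fix a
        have "chart_vec N d ?r (\<kappa> a (F z)) = coord_field N d' a ?r"
          using N.field_rep_apply[OF d cf[of a], of "F z"] FU z inv_F[OF zO] by (auto simp: \<kappa>_def)
        then show "(\<nu>' z $ a) *\<^sub>R chart_vec N d' ?r (axis a 1) = (\<nu>' z $ a) *\<^sub>R chart_vec N d ?r (\<kappa> a (F z))"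
          by (simp only: coord_field_def)
      qed
      also have "\<dots> = chart_vec N d ?r (\<Sum>a\<in>UNIV. (\<nu>' z $ a) *\<^sub>R \<kappa> a (F z))"
        by (simp only: linear_sum[OF l] linear_cmul[OF l])
      finally have "comps d (chart_vec N d ?r (\<nu> z)) = comps d (chart_vec N d ?r (\<Sum>a\<in>UNIV. (\<nu>' z $ a) *\<^sub>R \<kappa> a (F z)))"
        by (rule arg_cong)
      then show ?thesis unfolding N.comps_chart_vec[OF d in_U(2)[OF z]] .
    qed
    \<comment> \<open>The terms with derivatives of \<open>\<kappa>\<close> are exactly those that
      \<open>conn_rep\<close> yields for the coordinate fields of \<open>d'\<close>, so they cancel
      when the Christoffel terms are compared.\<close>
    have d\<nu>: "dder \<nu> x \<xi> = (\<Sum>a\<in>UNIV. (dder \<nu>' x \<xi> $ a) *\<^sub>R \<kappa> a y + (\<nu>' x $ a) *\<^sub>R dder (\<kappa> a) y ?w)"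
    proof -
      have "((\<lambda>z. \<Sum>a\<in>UNIV. (\<nu>' z $ a) *\<^sub>R \<kappa> a (F z)) has_derivative
          (\<lambda>v. \<Sum>a\<in>UNIV. (\<nu>' x $ a) *\<^sub>R dder (\<kappa> a) (F x) (dder F x v) + (dder \<nu>' x v $ a) *\<^sub>R \<kappa> a (F x))) (at x)"
      proof (rule has_derivative_sum, rule has_derivative_scaleR)
        fix a :: 'n
        show "((\<lambda>z. \<nu>' z $ a) has_derivative (\<lambda>v. dder \<nu>' x v $ a)) (at x)"
          by (rule bounded_linear.has_derivative[OF bounded_linear_vec_nth smooth_on_has_derivative[OF sm\<nu>' U(2)]])
        show "((\<lambda>z. \<kappa> a (F z)) has_derivative (\<lambda>v. dder (\<kappa> a) (F x) (dder F x v))) (at x)"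
          by (rule dder_compose(2)[OF smFU U(2) sm\<kappa>]) (use O y_def in auto)
      qed
      then have "dder (\<lambda>z. \<Sum>a\<in>UNIV. (\<nu>' z $ a) *\<^sub>R \<kappa> a (F z)) x \<xi> =
          (\<Sum>a\<in>UNIV. (\<nu>' x $ a) *\<^sub>R dder (\<kappa> a) (F x) (dder F x \<xi>) + (dder \<nu>' x \<xi> $ a) *\<^sub>R \<kappa> a (F x))"
        by (simp add: dder_eqI)
      moreover have "dder \<nu> x = dder (\<lambda>z. \<Sum>a\<in>UNIV. (\<nu>' z $ a) *\<^sub>R \<kappa> a (F z)) x"
        by (rule dder_cong_open[OF U(1,2)]) (rule expand)
      ultimately show ?thesis unfolding y_def by (simp add: add.commute)
    qed
    note lq = N.chart_vec_simps(5)[OF d q]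
    have "?u (\<lambda>q. coord_diff d' a (V q)) = dder \<nu>' x \<xi> $ a" for a
    proof -
      have eq: "coord_diff d' a (V (chart_inv c z)) = \<nu>' z $ a" if "z \<in> U" for z
        unfolding coord_diff_comps VU[OF that] ..
      have near: "smooth_near M p (\<lambda>q. coord_diff d' a (V q))"
        unfolding M.smooth_near_iff[OF c p] x_def[symmetric]
        using smooth_at_cong[OF U(1,2), of "\<lambda>z. coord_diff d' a (V (chart_inv c z))" "\<lambda>z. \<nu>' z $ a"] eq
          smooth_atI[OF U(1,2) smooth_on_vec_nth[OF U(1) sm\<nu>']] by simp
      have "dder (\<lambda>z. coord_diff d' a (V (chart_inv c z))) x = dder (\<lambda>z. \<nu>' z $ a) x"
        by (rule dder_cong_open[OF U(1,2)]) (rule eq)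
      then show ?thesis
        unfolding M.chart_vec_apply[OF c p near] x_def[symmetric]
        using dder_eqI[OF bounded_linear.has_derivative[OF bounded_linear_vec_nth smooth_on_has_derivative[OF sm\<nu>' U(2)]]]
        by simp
    qed
    moreover have "coord_field N d' a ?q = chart_vec N d ?q (\<kappa> a y)" for a
      using N.field_rep_apply[OF d cf[of a] O(2)] inv_F[OF x(1)] x(3) by (simp add: \<kappa>_def y_def)
    moreover have "coord_diff d' a (V p) = \<nu>' x $ a" for a
      unfolding coord_diff_comps using VU[OF U(2)] x(3) by simp
    moreover have "conn N ?q (differential M N \<phi> p ?u) (coord_field N d' a) =
        chart_vec N d ?q (dder (\<kappa> a) y ?w + \<Gamma>N y ?w (\<kappa> a y))" for a
    proof -
      have "conn N ?q (chart_vec N d ?q ?w) (coord_field N d' a) =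
          chart_vec N d ?q (dder (\<kappa> a) (snd d ?q) ?w + \<Gamma>N (snd d ?q) ?w (comps d (coord_field N d' a ?q)))"
        unfolding \<kappa>_def[abs_def] by (rule N.conn_rep[OF d q cf[of a]]) (use O(2) yq in simp)
      then show ?thesis
        unfolding differential_rep[OF p] x_def[symmetric] yq[symmetric] \<kappa>_def
        using inv_F[OF x(1)] x(3) by (simp add: y_def)
    qed
    ultimately have "T d' = (\<Sum>a\<in>UNIV. (dder \<nu>' x \<xi> $ a) *\<^sub>R chart_vec N d ?q (\<kappa> a y) +
        (\<nu>' x $ a) *\<^sub>R chart_vec N d ?q (dder (\<kappa> a) y ?w + \<Gamma>N y ?w (\<kappa> a y)))"
      unfolding T_def by (simp only:)
    also have "\<dots> = chart_vec N d ?q (\<Sum>a\<in>UNIV. (dder \<nu>' x \<xi> $ a) *\<^sub>R \<kappa> a y +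
        (\<nu>' x $ a) *\<^sub>R (dder (\<kappa> a) y ?w + \<Gamma>N y ?w (\<kappa> a y)))"
      by (simp only: linear_sum[OF lq] linear_cmul[OF lq] linear_add[OF lq])
    also have "(\<Sum>a\<in>UNIV. (dder \<nu>' x \<xi> $ a) *\<^sub>R \<kappa> a y + (\<nu>' x $ a) *\<^sub>R (dder (\<kappa> a) y ?w + \<Gamma>N y ?w (\<kappa> a y))) =
        dder \<nu> x \<xi> + (\<Sum>a\<in>UNIV. (\<nu>' x $ a) *\<^sub>R \<Gamma>N y ?w (\<kappa> a y))"
      unfolding d\<nu> by (simp add: scaleR_add_right sum.distrib add.assoc)
    also have "(\<Sum>a\<in>UNIV. (\<nu>' x $ a) *\<^sub>R \<Gamma>N y ?w (\<kappa> a y)) = \<Gamma>N y ?w (\<nu> x)"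
    proof -
      have l: "linear (\<Gamma>N y ?w)" using N.christoffel_bilinear[OF d y] by (simp add: bilinear_def)
      show ?thesis unfolding expand[OF U(2)] y_def[symmetric] by (simp add: linear_sum[OF l] linear_cmul[OF l])
    qed
    finally show ?thesis by (simp only: R_def)
  qed
  have "conn_along M N \<phi> p ?u V = R"
    unfolding conn_along_def T_def[symmetric]
  proof (rule the_equality)
    show "\<forall>d'\<in>charts N. ?q \<in> fst d' \<longrightarrow> R = T d'" using main by simp
    show "w = R" if "\<forall>d'\<in>charts N. ?q \<in> fst d' \<longrightarrow> w = T d'" for w
      using that main[OF d q] d q by simp
  qed
  then show ?thesis by (simp only: R_def x_def y_def)
qed

definition "B x \<xi> \<eta> = dder (\<lambda>y. dder F y \<eta>) x \<xi> + \<Gamma>N (F x) (dder F x \<xi>) (dder F x \<eta>) - dder F x (\<Gamma> x \<xi> \<eta>)"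

lemma linear_dF: "x \<in> \<Omega> \<Longrightarrow> linear (dder F x)"
  by (rule smooth_on_linear_dder[OF smF])

text \<open>The derivative of the extension enters both parts of the Gauss formula as
  \<open>dder F x (dder \<zeta> x \<xi>)\<close> and cancels; this is why the value depends on
  \<open>\<eta>\<close> alone.\<close>

lemma second_fundamental_form_rep:
  assumes p: "p \<in> fst c"
  shows "second_fundamental_form M N \<phi> p (chart_vec M c p \<xi>) (chart_vec M c p \<eta>) = chart_vec N d (\<phi> p) (B (snd c p) \<xi> \<eta>)"
proof -
  define x where "x = snd c p"
  have x: "x \<in> \<Omega>" "chart_inv c x = p" using p c by (auto simp: x_def)
  have main: "conn_along M N \<phi> p (chart_vec M c p \<xi>) (\<lambda>q. differential M N \<phi> q (Y q))
         - differential M N \<phi> p (conn M p (chart_vec M c p \<xi>) Y) = chart_vec N d (\<phi> p) (B x \<xi> \<eta>)"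
    if Y: "smooth_field_near M p Y" and Yp: "Y p = chart_vec M c p \<eta>" for Y
  proof -
    obtain W where W: "x \<in> W" "M.field_rep c Y W" using Y M.smooth_field_near_iff[OF c p] by (auto simp: x_def)
    define \<zeta> where "\<zeta> y = comps c (Y (chart_inv c y))" for y
    have W': "open W" "W \<subseteq> \<Omega>" and sm\<zeta>: "smooth_on W \<zeta>"
      using W(2) by (simp_all add: M.field_rep_def \<zeta>_def[abs_def])
    have \<zeta>x: "\<zeta> x = \<eta>" using M.comps_chart_vec[OF c p] by (simp add: \<zeta>_def x Yp)
    note smD = smooth_lin_D[OF W'(1) smooth_on_mono[OF smF W'(2)]]
    have rep: "differential M N \<phi> (chart_inv c y) (Y (chart_inv c y)) =
        chart_vec N d (\<phi> (chart_inv c y)) (dder F y (\<zeta> y))" if "y \<in> W" for y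
    proof -
      have y: "chart_inv c y \<in> fst c" "snd c (chart_inv c y) = y" using that W'(2) c by auto
      show ?thesis
        using differential_rep[OF y(1), of "\<zeta> y"] M.field_rep_apply[OF c W(2) that] y(2) by (simp add: \<zeta>_def)
    qed
    have 1: "conn_along M N \<phi> p (chart_vec M c p \<xi>) (\<lambda>q. differential M N \<phi> q (Y q)) = chart_vec N d (\<phi> p)
      (dder (\<lambda>y. dder F y (\<zeta> y)) x \<xi> + \<Gamma>N (F x) (dder F x \<xi>) (dder F x (\<zeta> x)))"
      using conn_along_rep[OF p W' W(1)[unfolded x_def] smooth_lin_apply[OF W'(1) smD sm\<zeta>], of "\<lambda>q. differential M N \<phi> q (Y q)" \<xi>] rep
      by (simp add: x_def)
    have 2: "dder (\<lambda>y. dder F y (\<zeta> y)) x \<xi> = dder (\<lambda>y. dder F y \<eta>) x \<xi> + dder F x (dder \<zeta> x \<xi>)"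
      using smooth_lin_dder[OF W'(1) smD sm\<zeta> W(1)] by (simp add: \<zeta>x)
    have "conn M p (chart_vec M c p \<xi>) Y = chart_vec M c p (dder \<zeta> x \<xi> + \<Gamma> x \<xi> \<eta>)"
      using M.conn_rep[OF c p W(2), of \<xi>] W(1) \<zeta>x by (simp add: x_def[symmetric] \<zeta>_def[abs_def] x(2))
    then have 3: "differential M N \<phi> p (conn M p (chart_vec M c p \<xi>) Y) =
        chart_vec N d (\<phi> p) (dder F x (dder \<zeta> x \<xi>) + dder F x (\<Gamma> x \<xi> \<eta>))"
      by (simp add: differential_rep[OF p] x_def[symmetric] linear_add[OF linear_dF[OF x(1)]])
    show ?thesis
      unfolding 1 2 3 N.chart_vec_simps(2)[OF d phi_in[OF p], symmetric] \<zeta>x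
      by (simp add: B_def algebra_simps)
  qed
  show ?thesis
    unfolding second_fundamental_form_def x_def[symmetric]
  proof (rule the_equality)
    show "\<forall>Y. smooth_field_near M p Y \<and> Y p = chart_vec M c p \<eta> \<longrightarrow> chart_vec N d (\<phi> p) (B x \<xi> \<eta>) =
        conn_along M N \<phi> p (chart_vec M c p \<xi>) (\<lambda>q. differential M N \<phi> q (Y q)) -
        differential M N \<phi> p (conn M p (chart_vec M c p \<xi>) Y)"
      using main by simp
    fix w assume *: "\<forall>Y. smooth_field_near M p Y \<and> Y p = chart_vec M c p \<eta> \<longrightarrow>
        w = conn_along M N \<phi> p (chart_vec M c p \<xi>) (\<lambda>q. differential M N \<phi> q (Y q)) -
        differential M N \<phi> p (conn M p (chart_vec M c p \<xi>) Y)"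
    have s: "smooth_field_near M p (\<lambda>q. chart_vec M c q \<eta>)" by (rule M.const_field_smooth[OF c p])
    show "w = chart_vec N d (\<phi> p) (B x \<xi> \<eta>)"
      using *[THEN spec, THEN mp, OF conjI[OF s refl]] main[OF s refl] by simp
  qed
qed

lemma smooth_GN: "smooth_bil \<Omega> (\<lambda>x. \<Gamma>N (F x))" "smooth_bil \<Omega> (\<lambda>x. gN (F x))"
  by (rule smooth_bil_compose[OF open_\<Omega> N.chartD(3)[OF d] F_img smF N.christoffel_smooth[OF d]],
      rule smooth_bil_compose[OF open_\<Omega> N.chartD(3)[OF d] F_img smF N.gmet_smooth[OF d]])

lemma B_smooth: "smooth_bil \<Omega> B"
proof -
  have smv: "smooth_on \<Omega> (\<lambda>x. B x \<xi> \<eta>)" for \<xi> \<eta>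
  proof -
    have G: "smooth_on \<Omega> (\<lambda>x. \<Gamma> x \<xi> \<eta>)" using M.christoffel_smooth[OF c] by (simp add: smooth_bil_def)
    show ?thesis
      unfolding B_def
      by (rule smooth_on_diff[OF open_\<Omega> smooth_on_add[OF open_\<Omega> smooth_on_dder[OF smooth_on_dder[OF smF]]
              smooth_bil_apply[OF open_\<Omega> smooth_GN(1) smooth_on_dder[OF smF] smooth_on_dder[OF smF]]]
            smooth_lin_apply[OF open_\<Omega> smooth_lin_D[OF open_\<Omega> smF] G]])
  qed
  have "bilinear (B x)" if x: "x \<in> \<Omega>" for x
  proof -
    have Fx: "F x \<in> chart_img d" using F_img x by auto
    note G = bilinear_simps[OF M.christoffel_bilinear[OF c x]] and GN = bilinear_simps[OF N.christoffel_bilinear[OF d Fx]]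
    note dF = linear_add[OF linear_dF[OF x]] linear_cmul[OF linear_dF[OF x]]
    have l1: "linear (dder (\<lambda>y. dder F y \<eta>) x)" for \<eta> by (rule smooth_on_linear_dder[OF smooth_on_dder[OF smF] x])
    have 1: "dder (\<lambda>y. dder F y \<eta>) x \<xi> = dder (\<lambda>y. dder F y \<xi>) x \<eta>" for \<xi> \<eta>
      by (rule dder_dder_commute[OF open_\<Omega> smF x])
    \<comment> \<open>Linearity in the inner direction is read off from linearity in the outer one,
      by symmetry of second derivatives.\<close>
    have 2: "dder (\<lambda>y. dder F y (\<eta> + \<eta>')) x \<xi> = dder (\<lambda>y. dder F y \<eta>) x \<xi> + dder (\<lambda>y. dder F y \<eta>') x \<xi>"
      "dder (\<lambda>y. dder F y (r *\<^sub>R \<eta>)) x \<xi> = r *\<^sub>R dder (\<lambda>y. dder F y \<eta>) x \<xi>" for \<xi> \<eta> \<eta>' r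
      unfolding 1[of _ \<xi>] by (rule linear_add[OF l1], rule linear_cmul[OF l1])
    show ?thesis
      unfolding bilinear_def B_def
      by (auto intro!: linearI simp: G GN dF 2 linear_add[OF l1] linear_cmul[OF l1] algebra_simps)
  qed
  then show ?thesis using smv by (simp add: smooth_bil_def)
qed

lemma B_sym:
  assumes x: "x \<in> \<Omega>" shows "B x \<xi> \<eta> = B x \<eta> \<xi>"
proof -
  have Fx: "F x \<in> chart_img d" using F_img x by auto
  show ?thesis
    unfolding B_def
    using dder_dder_commute[OF open_\<Omega> smF x, of \<eta> \<xi>] M.christoffel_sym[OF c x, of \<xi> \<eta>]
      N.christoffel_sym[OF d Fx, of "dder F x \<xi>" "dder F x \<eta>"] by simp
qed

end

subsection \<open>Traces and duality with respect to an inner product on the plane\<close>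

abbreviation "e1 \<equiv> (axis 1 1 :: real^2)"
abbreviation "e2 \<equiv> (axis 2 1 :: real^2)"

definition gram :: "(real^2 \<Rightarrow> real^2 \<Rightarrow> real) \<Rightarrow> real" where
  "gram g = g e1 e1 * g e2 e2 - (g e1 e2)\<^sup>2"

text \<open>Trace through the inverse Gram matrix of \<open>e1\<close>, \<open>e2\<close>. Being
  rational in the entries of \<open>g\<close>, it is visibly smooth in families, whereas a trace
  over orthonormal frames would need a smooth choice of frame.\<close>

definition trace2 :: "(real^2 \<Rightarrow> real^2 \<Rightarrow> real) \<Rightarrow> (real^2 \<Rightarrow> real^2 \<Rightarrow> 'v::real_vector) \<Rightarrow> 'v" where
  "trace2 g b = (1 / gram g) *\<^sub>R (g e2 e2 *\<^sub>R b e1 e1 - g e1 e2 *\<^sub>R (b e1 e2 + b e2 e1) + g e1 e1 *\<^sub>R b e2 e2)"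

text \<open>Cramer's rule for the vector representing a linear form; again rational in
  \<open>g\<close>, so that the shape operator is smooth by inspection.\<close>

definition riesz :: "(real^2 \<Rightarrow> real^2 \<Rightarrow> real) \<Rightarrow> (real^2 \<Rightarrow> real) \<Rightarrow> real^2" where
  "riesz g l = (1 / gram g) *\<^sub>R ((g e2 e2 * l e1 - g e1 e2 * l e2) *\<^sub>R e1 + (g e1 e1 * l e2 - g e1 e2 * l e1) *\<^sub>R e2)"

lemma vec2_expand: "(v::real^2) = (v $ 1) *\<^sub>R e1 + (v $ 2) *\<^sub>R e2"
  by (simp add: vec_eq_iff forall_2 axis_def)

lemma gram_pos:
  assumes g: "inner_form g" shows "gram g > 0"
proof -
  note b = bilinear_simps[OF inner_form_bilinear[OF g]]
  have p: "g e1 e1 > 0" using inner_form_pos[OF g] by (simp add: axis_eq_0_iff)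
  \<comment> \<open>A multiple of the part of \<open>e2\<close> orthogonal to \<open>e1\<close>; its
    squared length is the Gram determinant times \<open>g e1 e1\<close>.\<close>
  define w where "w = g e1 e1 *\<^sub>R e2 - g e1 e2 *\<^sub>R e1"
  have "w $ 2 \<noteq> 0" using p by (simp add: w_def axis_def)
  then have "w \<noteq> 0" by auto
  then have "g w w > 0" by (rule inner_form_pos[OF g])
  moreover have "g w w = g e1 e1 * gram g"
    using inner_form_sym[OF g, of e2 e1] by (simp add: w_def b gram_def power2_eq_square algebra_simps)
  ultimately show ?thesis using p by (simp add: zero_less_mult_iff)
qed

lemma axis2_nth: "e1 $ 1 = 1" "e1 $ 2 = 0" "e2 $ 1 = 0" "e2 $ 2 = 1"
  by (simp_all add: axis_def)

text \<open>For an orthonormal pair the matrix with entries \<open>a$i * a$j + b$i * b$j\<close> is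
  the inverse of the Gram matrix; \<open>q1\<close> to \<open>q4\<close> are the entries of this
  matrix identity, obtained by expanding \<open>e1\<close> and \<open>e2\<close> in the
  pair.\<close>

lemma on_pair_trace:
  assumes g: "inner_form g" and on: "on_pair g a b" and B: "bilinear B"
  shows "B a a + B b b = trace2 g B"
proof -
  note gb = bilinear_simps[OF inner_form_bilinear[OF g]] and Bb = bilinear_simps[OF B]
  have D: "gram g > 0" by (rule gram_pos[OF g])
  define S11 S12 S22 where "S11 = (a$1)\<^sup>2 + (b$1)\<^sup>2" and "S12 = a$1 * a$2 + b$1 * b$2" and "S22 = (a$2)\<^sup>2 + (b$2)\<^sup>2"
  have ga: "g w a = a$1 * g w e1 + a$2 * g w e2" "g w b = b$1 * g w e1 + b$2 * g w e2" for w
    by (subst vec2_expand[of a], simp add: gb, subst vec2_expand[of b], simp add: gb)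
  note ex = on_pair_expansion[OF g on]
  have s: "g e2 e1 = g e1 e2" by (rule inner_form_sym[OF g])
  have q1: "g e1 e1 * S11 + g e1 e2 * S12 = 1"
    using arg_cong[OF ex[of e1], of "\<lambda>v. v $ 1"] by (simp add: ga S11_def S12_def axis2_nth power2_eq_square algebra_simps)
  have q2: "g e1 e1 * S12 + g e1 e2 * S22 = 0"
    using arg_cong[OF ex[of e1], of "\<lambda>v. v $ 2"] by (simp add: ga S22_def S12_def axis2_nth power2_eq_square algebra_simps)
  have q3: "g e1 e2 * S12 + g e2 e2 * S22 = 1"
    using arg_cong[OF ex[of e2], of "\<lambda>v. v $ 2"] by (simp add: ga s S22_def S12_def axis2_nth power2_eq_square algebra_simps)
  have q4: "g e1 e2 * S11 + g e2 e2 * S12 = 0"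
    using arg_cong[OF ex[of e2], of "\<lambda>v. v $ 1"] by (simp add: ga s S11_def S12_def axis2_nth power2_eq_square algebra_simps)
  have "gram g * S11 = g e2 e2 * (g e1 e1 * S11 + g e1 e2 * S12) - g e1 e2 * (g e1 e2 * S11 + g e2 e2 * S12)"
    by (simp add: gram_def power2_eq_square algebra_simps)
  then have "gram g * S11 = g e2 e2" unfolding q1 q4 by simp
  then have 1: "S11 = g e2 e2 / gram g"
    using D by (intro eq_divide_imp) (simp_all add: mult.commute)
  have "gram g * S12 = g e2 e2 * (g e1 e1 * S12 + g e1 e2 * S22) - g e1 e2 * (g e1 e2 * S12 + g e2 e2 * S22)"
    by (simp add: gram_def power2_eq_square algebra_simps)
  then have "gram g * S12 = - g e1 e2" unfolding q2 q3 by simp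
  then have 2: "S12 = - g e1 e2 / gram g"
    using D by (intro eq_divide_imp) (simp_all add: mult.commute)
  have "gram g * S22 = g e1 e1 * (g e1 e2 * S12 + g e2 e2 * S22) - g e1 e2 * (g e1 e1 * S12 + g e1 e2 * S22)"
    by (simp add: gram_def power2_eq_square algebra_simps)
  then have "gram g * S22 = g e1 e1" unfolding q2 q3 by simp
  then have 3: "S22 = g e1 e1 / gram g"
    using D by (intro eq_divide_imp) (simp_all add: mult.commute)
  have Baa: "B w w = (w$1)\<^sup>2 *\<^sub>R B e1 e1 + (w$1 * w$2) *\<^sub>R (B e1 e2 + B e2 e1) + (w$2)\<^sup>2 *\<^sub>R B e2 e2" for w
    by (subst (1 2) vec2_expand[of w]) (simp add: Bb power2_eq_square algebra_simps)
  have "B a a + B b b = S11 *\<^sub>R B e1 e1 + S12 *\<^sub>R (B e1 e2 + B e2 e1) + S22 *\<^sub>R B e2 e2"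
    unfolding Baa[of a] Baa[of b] S11_def S12_def S22_def by (simp add: algebra_simps)
  also have "\<dots> = trace2 g B"
    unfolding 1 2 3 trace2_def by (simp add: algebra_simps)
  finally show ?thesis .
qed

lemma riesz:
  assumes g: "inner_form g" and l: "linear l" shows "g (riesz g l) w = l w"
proof -
  note gb = bilinear_simps[OF inner_form_bilinear[OF g]]
  have D: "gram g \<noteq> 0" using gram_pos[OF g] by simp
  have s: "g e2 e1 = g e1 e2" by (rule inner_form_sym[OF g])
  have 1: "gram g * g (riesz g l) e1 = gram g * l e1" "gram g * g (riesz g l) e2 = gram g * l e2"
    using D by (simp_all add: riesz_def gb s) (simp_all add: gram_def power2_eq_square algebra_simps)
  have "g (riesz g l) w = w$1 * g (riesz g l) e1 + w$2 * g (riesz g l) e2"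
    by (subst vec2_expand[of w]) (simp add: gb)
  also have "\<dots> = w$1 * l e1 + w$2 * l e2" using 1 D by simp
  also have "\<dots> = l w" by (subst (3) vec2_expand[of w]) (simp add: linear_add[OF l] linear_cmul[OF l])
  finally show ?thesis .
qed

subsection \<open>Covariant derivatives of endomorphism fields\<close>

definition cov_endo :: "('a, 'm::finite) riem \<Rightarrow> ('a, 'm) chart \<Rightarrow> (real^'m \<Rightarrow> real^'m \<Rightarrow> real^'m) \<Rightarrow>
    real^'m \<Rightarrow> real^'m \<Rightarrow> real^'m \<Rightarrow> real^'m" where
  "cov_endo M c L x \<xi> \<eta> = dder (\<lambda>y. L y \<eta>) x \<xi> + christoffel M c x \<xi> (L x \<eta>) - L x (christoffel M c x \<xi> \<eta>)"

context riem_mfd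
begin

text \<open>As with the second fundamental form, the derivative of the extension occurs in both
  terms, here as \<open>L x (dder \<zeta> x \<xi>)\<close>, and cancels.\<close>

lemma conn_endo_rep:
  assumes c: "c \<in> charts M" and p: "p \<in> fst c" and L: "smooth_lin (chart_img c) L"
    and T: "\<And>q \<xi>. q \<in> fst c \<Longrightarrow> T q (chart_vec M c q \<xi>) = chart_vec M c q (L (snd c q) \<xi>)"
  shows "conn_endo M T p (chart_vec M c p \<xi>) (chart_vec M c p \<eta>) = chart_vec M c p (cov_endo M c L (snd c p) \<xi> \<eta>)"
proof -
  define x where "x = snd c p"
  have x: "x \<in> chart_img c" "chart_inv c x = p" using p c by (auto simp: x_def)
  have lin: "linear (L x)" using smooth_lin_linear[OF L] x by blast
  have main: "conn M p (chart_vec M c p \<xi>) (\<lambda>q. T q (Y q)) - T p (conn M p (chart_vec M c p \<xi>) Y) =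
      chart_vec M c p (cov_endo M c L x \<xi> \<eta>)" if Y: "smooth_field_near M p Y" and Yp: "Y p = chart_vec M c p \<eta>" for Y
  proof -
    obtain W where W: "x \<in> W" "field_rep c Y W" using Y smooth_field_near_iff[OF c p] by (auto simp: x_def)
    define \<zeta> where "\<zeta> y = comps c (Y (chart_inv c y))" for y
    have W': "open W" "W \<subseteq> chart_img c" and sm\<zeta>: "smooth_on W \<zeta>"
      using W(2) by (simp_all add: field_rep_def \<zeta>_def[abs_def])
    have \<zeta>x: "\<zeta> x = \<eta>" using comps_chart_vec[OF c p] by (simp add: \<zeta>_def x Yp)
    note LW = smooth_lin_mono[OF L W'(2)]
    have TY: "T (chart_inv c y) (Y (chart_inv c y)) = chart_vec M c (chart_inv c y) (L y (\<zeta> y))" if "y \<in> W" for y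
    proof -
      have y: "chart_inv c y \<in> fst c" "snd c (chart_inv c y) = y" using that W'(2) c by auto
      show ?thesis
        using T[OF y(1), of "\<zeta> y"] field_rep_apply[OF c W(2) that] y(2) by (simp add: \<zeta>_def)
    qed
    have r: "field_rep c (\<lambda>q. T q (Y q)) W"
      by (rule field_repI[OF c W' smooth_lin_apply[OF W'(1) LW sm\<zeta>] TY])
    have cT: "comps c (T (chart_inv c y) (Y (chart_inv c y))) = L y (\<zeta> y)" if y: "y \<in> W" for y
      unfolding TY[OF y] by (rule comps_chart_vec[OF c]) (use y W'(2) c in auto)
    have dT: "dder (\<lambda>y. comps c (T (chart_inv c y) (Y (chart_inv c y)))) x = dder (\<lambda>y. L y (\<zeta> y)) x"
      by (rule dder_cong_open[OF W'(1) W(1)]) (rule cT)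
    have 1: "conn M p (chart_vec M c p \<xi>) (\<lambda>q. T q (Y q)) =
        chart_vec M c p (dder (\<lambda>y. L y \<eta>) x \<xi> + L x (dder \<zeta> x \<xi>) + christoffel M c x \<xi> (L x \<eta>))"
      using conn_rep[OF c p r, of \<xi>] W(1) dT cT[OF W(1)] smooth_lin_dder[OF W'(1) LW sm\<zeta> W(1), of \<xi>]
      by (simp add: x_def[symmetric] x(2) \<zeta>x)
    have "conn M p (chart_vec M c p \<xi>) Y = chart_vec M c p (dder \<zeta> x \<xi> + christoffel M c x \<xi> \<eta>)"
      using conn_rep[OF c p W(2), of \<xi>] W(1) \<zeta>x by (simp add: x_def[symmetric] \<zeta>_def[abs_def] x(2))
    then have 2: "T p (conn M p (chart_vec M c p \<xi>) Y) = chart_vec M c p (L x (dder \<zeta> x \<xi>) + L x (christoffel M c x \<xi> \<eta>))"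
      by (simp add: T[OF p] x_def[symmetric] linear_add[OF lin])
    show ?thesis
      unfolding 1 2 chart_vec_simps(2)[OF c p, symmetric] by (simp add: cov_endo_def algebra_simps)
  qed
  show ?thesis
    unfolding conn_endo_def x_def[symmetric]
  proof (rule the_equality)
    show "\<forall>Y. smooth_field_near M p Y \<and> Y p = chart_vec M c p \<eta> \<longrightarrow> chart_vec M c p (cov_endo M c L x \<xi> \<eta>) =
        conn M p (chart_vec M c p \<xi>) (\<lambda>q. T q (Y q)) - T p (conn M p (chart_vec M c p \<xi>) Y)"
      using main by simp
    fix w assume *: "\<forall>Y. smooth_field_near M p Y \<and> Y p = chart_vec M c p \<eta> \<longrightarrow>
        w = conn M p (chart_vec M c p \<xi>) (\<lambda>q. T q (Y q)) - T p (conn M p (chart_vec M c p \<xi>) Y)"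
    have s: "smooth_field_near M p (\<lambda>q. chart_vec M c q \<eta>)" by (rule const_field_smooth[OF c p])
    show "w = chart_vec M c p (cov_endo M c L x \<xi> \<eta>)"
      using *[THEN spec, THEN mp, OF conjI[OF s refl]] main[OF s refl] by simp
  qed
qed

lemma cov_endo_bilinear:
  assumes c: "c \<in> charts M" and x: "x \<in> chart_img c" and L: "smooth_lin (chart_img c) L"
  shows "bilinear (cov_endo M c L x)"
proof -
  note G = bilinear_simps[OF christoffel_bilinear[OF c x]]
  have lin: "linear (L x)" using smooth_lin_linear[OF L] x by blast
  have l1: "linear (dder (\<lambda>y. L y \<eta>) x)" for \<eta>
    using L by (intro smooth_on_linear_dder[OF _ x]) (simp add: smooth_lin_def)
  note l2 = smooth_lin_dder_linear[OF chartD(3)[OF c] x L]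
  show ?thesis
    unfolding bilinear_def cov_endo_def
    by (auto intro!: linearI simp: G linear_add[OF lin] linear_cmul[OF lin] linear_add[OF l1] linear_cmul[OF l1]
        linear_add[OF l2] linear_cmul[OF l2] algebra_simps)
qed

end

subsection \<open>Orthonormal frames of a surface\<close>

lemma (in surface_chart) frame_on_pair:
  assumes p: "p \<in> fst c" and e: "orthonormal_frame M p e"
  shows "\<exists>a b. e 1 = chart_vec M c p a \<and> e 2 = chart_vec M c p b \<and> on_pair (g (snd c p)) a b"
proof -
  have t: "e i \<in> tangent_space M p" for i using e by (simp add: orthonormal_frame_def)
  note cv = M.chart_vec_comps[OF c p t]
  have "metric M p (chart_vec M c p (comps c (e i))) (chart_vec M c p (comps c (e j))) = (if i = j then 1 else 0)" for i j
    using e unfolding cv by (simp add: orthonormal_frame_def)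
  then have "on_pair (g (snd c p)) (comps c (e 1)) (comps c (e 2))"
    unfolding M.metric_gmet[OF c p] on_pair_def by simp
  then show ?thesis using cv by metis
qed

lemma (in surface_chart) on_pair_frame:
  assumes p: "p \<in> fst c" and on: "on_pair (g (snd c p)) a b"
  shows "orthonormal_frame M p (\<lambda>i. chart_vec M c p (if i = 1 then a else b))"
proof -
  have x: "snd c p \<in> \<Omega>" using p by simp
  show ?thesis
    using on inner_form_sym[OF M.gmet_inner_form[OF c x], of b a] M.chart_vec_tangent[OF c p]
    unfolding orthonormal_frame_def M.metric_gmet[OF c p] on_pair_def forall_2 by simp
qed

text \<open>Settles at once the descriptions over orthonormal frames, for the mean curvature vector
  and for the divergence; Gram-Schmidt provides the frame on which uniqueness rests.\<close>

lemma (in surface_chart) the_frame_value: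
  assumes p: "p \<in> fst c"
    and f: "\<And>e a b. orthonormal_frame M p e \<Longrightarrow> e 1 = chart_vec M c p a \<Longrightarrow> e 2 = chart_vec M c p b \<Longrightarrow>
      on_pair (g (snd c p)) a b \<Longrightarrow> f e = w"
  shows "(THE w. \<forall>e. orthonormal_frame M p e \<longrightarrow> w = f e) = w"
proof (rule the_equality)
  have f': "f e = w" if "orthonormal_frame M p e" for e
    using f[OF that] frame_on_pair[OF p that] by blast
  then show "\<forall>e. orthonormal_frame M p e \<longrightarrow> w = f e" by simp
  have x: "snd c p \<in> \<Omega>" using p by simp
  obtain b where "on_pair (g (snd c p)) ((1 / sqrt (g (snd c p) e1 e1)) *\<^sub>R e1) b"
    using on_pair_exists[OF M.gmet_inner_form[OF c x], of e1] by (auto simp: axis_eq_0_iff)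
  from on_pair_frame[OF p this] obtain e where e: "orthonormal_frame M p e" by blast
  show "w' = w" if "\<forall>e. orthonormal_frame M p e \<longrightarrow> w' = f e" for w'
    using that e f'[OF e] by simp
qed

subsection \<open>Mean curvature, shape operator and the Codazzi equation in coordinates\<close>

context surface_chart
begin

definition "H x = (1/2) *\<^sub>R trace2 (g x) (B x)"

lemma B_bilinear: "x \<in> \<Omega> \<Longrightarrow> bilinear (B x)"
  by (rule smooth_bil_bilinear[OF B_smooth])

lemma g_inner_form: "x \<in> \<Omega> \<Longrightarrow> inner_form (g x)"
  by (rule M.gmet_inner_form[OF c])

lemma gN_inner_form: "x \<in> \<Omega> \<Longrightarrow> inner_form (gN (F x))"
  by (rule N.gmet_inner_form[OF d]) (use F_img in auto)

lemma smooth_entries: "smooth_on \<Omega> (\<lambda>x. g x v w)" "smooth_on \<Omega> (\<lambda>x. B x v w)"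
  using M.gmet_smooth[OF c] B_smooth by (simp_all add: smooth_bil_def)

lemma smooth_gram: "smooth_on \<Omega> (\<lambda>x. 1 / gram (g x))"
proof (rule smooth_on_divide[OF open_\<Omega> smooth_on_const])
  show "smooth_on \<Omega> (\<lambda>x. gram (g x))"
    unfolding gram_def
    by (rule smooth_on_diff[OF open_\<Omega> smooth_on_mult[OF open_\<Omega> smooth_entries(1) smooth_entries(1)]
          smooth_on_power2[OF open_\<Omega> smooth_entries(1)]])
qed (rule gram_pos[OF g_inner_form])

lemma smH: "smooth_on \<Omega> H"
  unfolding H_def trace2_def
  by (rule smooth_on_scaleR[OF open_\<Omega> smooth_on_const smooth_on_scaleR[OF open_\<Omega> smooth_gram
        smooth_on_add[OF open_\<Omega> smooth_on_diff[OF open_\<Omega> smooth_on_scaleR[OF open_\<Omega> smooth_entries]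
            smooth_on_scaleR[OF open_\<Omega> smooth_entries(1) smooth_on_add[OF open_\<Omega> smooth_entries(2) smooth_entries(2)]]]
          smooth_on_scaleR[OF open_\<Omega> smooth_entries]]]])

lemma mean_curvature_vector_rep:
  assumes p: "p \<in> fst c"
  shows "mean_curvature_vector M N \<phi> p = chart_vec N d (\<phi> p) (H (snd c p))"
  unfolding mean_curvature_vector_def
proof (rule the_frame_value[OF p])
  fix e :: "2 \<Rightarrow> 'a tvec" and a b assume e: "e 1 = chart_vec M c p a" "e 2 = chart_vec M c p b" and on: "on_pair (g (snd c p)) a b"
  have x: "snd c p \<in> \<Omega>" using p by simp
  note cN = N.chart_vec_simps[OF d phi_in[OF p]]
  show "(1/2) *\<^sub>R (\<Sum>i\<in>UNIV. second_fundamental_form M N \<phi> p (e i) (e i)) = chart_vec N d (\<phi> p) (H (snd c p))"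
    unfolding sum_2 e second_fundamental_form_rep[OF p] cN(1)[symmetric] cN(3)[symmetric] H_def
      on_pair_trace[OF g_inner_form[OF x] on B_bilinear[OF x]] ..
qed

lemma mean_curvature_sq:
  assumes p: "p \<in> fst c"
  shows "(mean_curvature M N \<phi> p)\<^sup>2 = gN (F (snd c p)) (H (snd c p)) (H (snd c p))"
proof -
  have x: "snd c p \<in> \<Omega>" using p by simp
  have "gN (F (snd c p)) (H (snd c p)) (H (snd c p)) \<ge> 0"
    using inner_form_pos[OF gN_inner_form[OF x], of "H (snd c p)"]
      bilinear_simps(7)[OF inner_form_bilinear[OF gN_inner_form[OF x]]]
    by (cases "H (snd c p) = 0") (auto simp: less_imp_le)
  then show ?thesis
    unfolding mean_curvature_def mean_curvature_vector_rep[OF p] N.metric_gmet[OF d phi_in[OF p]] F_snd[OF p, symmetric]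
    by simp
qed

definition "S x \<xi> = riesz (g x) (\<lambda>\<eta>. gN (F x) (B x \<xi> \<eta>) (H x))"

lemma S_eq:
  assumes x: "x \<in> \<Omega>" shows "g x (S x \<xi>) \<eta> = gN (F x) (B x \<xi> \<eta>) (H x)"
proof -
  have "linear (\<lambda>\<eta>. gN (F x) (B x \<xi> \<eta>) (H x))"
    using bilinear_simps[OF B_bilinear[OF x]] bilinear_simps[OF inner_form_bilinear[OF gN_inner_form[OF x]]]
    by (auto intro!: linearI)
  from riesz[OF g_inner_form[OF x] this] show ?thesis by (simp add: S_def)
qed

lemma S_sym: "x \<in> \<Omega> \<Longrightarrow> g x (S x \<xi>) \<eta> = g x \<xi> (S x \<eta>)"
  using inner_form_sym[OF g_inner_form, of x \<xi> "S x \<eta>"] by (simp add: S_eq B_sym)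

lemma S_smooth: "smooth_lin \<Omega> S"
proof -
  have a: "smooth_on \<Omega> (\<lambda>x. gN (F x) (B x \<xi> \<eta>) (H x))" for \<xi> \<eta>
    by (rule smooth_bil_apply[OF open_\<Omega> smooth_GN(2) smooth_entries(2) smH])
  have "smooth_on \<Omega> (\<lambda>x. S x \<xi>)" for \<xi>
    unfolding S_def riesz_def
    by (rule smooth_on_scaleR[OF open_\<Omega> smooth_gram smooth_on_add[OF open_\<Omega>
          smooth_on_scaleR[OF open_\<Omega> smooth_on_diff[OF open_\<Omega> smooth_on_mult[OF open_\<Omega> smooth_entries(1) a]
              smooth_on_mult[OF open_\<Omega> smooth_entries(1) a]] smooth_on_const]
          smooth_on_scaleR[OF open_\<Omega> smooth_on_diff[OF open_\<Omega> smooth_on_mult[OF open_\<Omega> smooth_entries(1) a]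
              smooth_on_mult[OF open_\<Omega> smooth_entries(1) a]] smooth_on_const]]])
  moreover have "linear (S x)" if x: "x \<in> \<Omega>" for x
  proof -
    note gb = bilinear_simps[OF inner_form_bilinear[OF g_inner_form[OF x]]]
    note Bb = bilinear_simps[OF B_bilinear[OF x]] and Nb = bilinear_simps[OF inner_form_bilinear[OF gN_inner_form[OF x]]]
    show ?thesis
    proof (rule linearI)
      show "S x (\<xi> + \<eta>) = S x \<xi> + S x \<eta>" for \<xi> \<eta>
        by (rule inner_form_eqI[OF g_inner_form[OF x]]) (simp add: S_eq[OF x] gb Bb Nb)
      show "S x (r *\<^sub>R \<xi>) = r *\<^sub>R S x \<xi>" for r \<xi>
        by (rule inner_form_eqI[OF g_inner_form[OF x]]) (simp add: S_eq[OF x] gb Bb Nb)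
    qed
  qed
  ultimately show ?thesis by (simp add: smooth_lin_def)
qed

lemma shape_H_rep:
  assumes p: "p \<in> fst c"
  shows "shape_H M N \<phi> p (chart_vec M c p \<xi>) = chart_vec M c p (S (snd c p) \<xi>)"
proof -
  have x: "snd c p \<in> \<Omega>" using p by simp
  have key: "metric M p (chart_vec M c p \<zeta>) v = metric N (\<phi> p)
      (second_fundamental_form M N \<phi> p (chart_vec M c p \<xi>) v) (mean_curvature_vector M N \<phi> p) \<longleftrightarrow>
      g (snd c p) \<zeta> (comps c v) = g (snd c p) (S (snd c p) \<xi>) (comps c v)" if vt: "v \<in> tangent_space M p" for \<zeta> v
  proof -
    obtain \<eta> where v: "v = chart_vec M c p \<eta>" using vt M.tangent_space_eq[OF c p] by auto
    show ?thesis
      unfolding v M.comps_chart_vec[OF c p] second_fundamental_form_rep[OF p] mean_curvature_vector_rep[OF p]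
        M.metric_gmet[OF c p] N.metric_gmet[OF d phi_in[OF p]] F_snd[OF p, symmetric] S_eq[OF x] ..
  qed
  show ?thesis
    unfolding shape_H_def
  proof (rule the_equality)
    show "chart_vec M c p (S (snd c p) \<xi>) \<in> tangent_space M p \<and> (\<forall>v\<in>tangent_space M p.
       metric M p (chart_vec M c p (S (snd c p) \<xi>)) v = metric N (\<phi> p)
         (second_fundamental_form M N \<phi> p (chart_vec M c p \<xi>) v) (mean_curvature_vector M N \<phi> p))"
      using key M.chart_vec_tangent[OF c p] by simp
    fix w assume w: "w \<in> tangent_space M p \<and> (\<forall>v\<in>tangent_space M p. metric M p w v = metric N (\<phi> p)
         (second_fundamental_form M N \<phi> p (chart_vec M c p \<xi>) v) (mean_curvature_vector M N \<phi> p))"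
    then obtain \<zeta> where \<zeta>: "w = chart_vec M c p \<zeta>" using M.tangent_space_eq[OF c p] by auto
    have "g (snd c p) \<zeta> \<eta> = g (snd c p) (S (snd c p) \<xi>) \<eta>" for \<eta>
      using key[OF M.chart_vec_tangent[OF c p], of \<zeta> \<eta>] w M.chart_vec_tangent[OF c p]
      unfolding \<zeta> M.comps_chart_vec[OF c p] by blast
    then have "\<zeta> = S (snd c p) \<xi>" by (rule inner_form_eqI[OF g_inner_form[OF x]])
    then show "w = chart_vec M c p (S (snd c p) \<xi>)" by (simp add: \<zeta>)
  qed
qed

text \<open>For constant \<open>|H|\<close> the multiple of the identity in the stress-bienergy
  tensor is parallel, so its divergence is 4 times that of \<open>A_H\<close>. The trace of
  \<open>A_H\<close> is \<open>2 * k\<close> because it pairs the trace of \<open>B\<close>, which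
  is twice \<open>H\<close>, with \<open>H\<close>.\<close>

lemma codazzi:
  assumes cmc: "\<And>q. q \<in> fst c \<Longrightarrow> (mean_curvature M N \<phi> q)\<^sup>2 = k"
    and bic: "\<And>q. q \<in> fst c \<Longrightarrow> divergence M (stress_bienergy M N \<phi>) q = 0"
  shows "codazzi_data \<Omega> g \<Gamma> S k"
proof
  fix x a b assume x: "x \<in> \<Omega>" and on: "on_pair (g x) a b"
  let ?p = "chart_inv c x"
  have p: "?p \<in> fst c" and sx: "snd c ?p = x" using x c by auto
  have "g x (S x a) a + g x (S x b) b = gN (F x) (B x a a + B x b b) (H x)"
    by (simp add: S_eq[OF x] bilinear_simps[OF inner_form_bilinear[OF gN_inner_form[OF x]]])
  also have "B x a a + B x b b = 2 *\<^sub>R H x"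
    using on_pair_trace[OF g_inner_form[OF x] on B_bilinear[OF x]] by (simp add: H_def)
  also have "gN (F x) (2 *\<^sub>R H x) (H x) = 2 * k"
    using cmc[OF p] mean_curvature_sq[OF p] sx by (simp add: bilinear_simps[OF inner_form_bilinear[OF gN_inner_form[OF x]]])
  finally show "g x (S x a) a + g x (S x b) b = 2 * k" .
  define L where "L y \<xi> = (- 2 * k) *\<^sub>R \<xi> + 4 *\<^sub>R S y \<xi>" for y \<xi>
  have smS: "smooth_on \<Omega> (\<lambda>y. S y \<xi>)" for \<xi>
    using S_smooth by (simp add: smooth_lin_def)
  note linS = smooth_lin_linear[OF S_smooth]
  have L: "smooth_lin \<Omega> L"
    unfolding smooth_lin_def L_def
  proof (intro conjI ballI allI)
    show "linear (\<lambda>\<xi>. (- 2 * k) *\<^sub>R \<xi> + 4 *\<^sub>R S y \<xi>)" if "y \<in> \<Omega>" for y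
      by (rule linearI) (simp_all add: linear_add[OF linS[OF that]] linear_cmul[OF linS[OF that]] algebra_simps)
    show "smooth_on \<Omega> (\<lambda>y. (- 2 * k) *\<^sub>R \<xi> + 4 *\<^sub>R S y \<xi>)" for \<xi>
      by (rule smooth_on_add[OF open_\<Omega> smooth_on_const smooth_on_scaleR[OF open_\<Omega> smooth_on_const smS]])
  qed
  have T: "stress_bienergy M N \<phi> q (chart_vec M c q \<xi>) = chart_vec M c q (L (snd c q) \<xi>)" if q: "q \<in> fst c" for q \<xi>
    unfolding stress_bienergy_def cmc[OF q] shape_H_rep[OF q] L_def
    by (simp only: M.chart_vec_linear[OF c q])
  \<comment> \<open>The identity contributes nothing: its two Christoffel terms cancel and its
    coefficient is constant.\<close>
  have C: "cov_endo M c L x \<xi> \<eta> = 4 *\<^sub>R cov_endo M c S x \<xi> \<eta>" for \<xi> \<eta>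
  proof -
    have "((\<lambda>y. (- 2 * k) *\<^sub>R \<eta> + 4 *\<^sub>R S y \<eta>) has_derivative (\<lambda>v. 0 + 4 *\<^sub>R dder (\<lambda>y. S y \<eta>) x v)) (at x)"
      by (intro has_derivative_add has_derivative_const has_derivative_scaleR_right smooth_on_has_derivative[OF smS x])
    then have dL: "dder (\<lambda>y. L y \<eta>) x \<xi> = 4 *\<^sub>R dder (\<lambda>y. S y \<eta>) x \<xi>"
      unfolding L_def by (simp add: dder_eqI)
    show ?thesis
      unfolding cov_endo_def dL unfolding L_def
      by (simp add: bilinear_simps[OF M.christoffel_bilinear[OF c x]] algebra_simps)
  qed
  have ce: "conn_endo M (stress_bienergy M N \<phi>) ?p (chart_vec M c ?p \<xi>) (chart_vec M c ?p \<eta>) =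
      chart_vec M c ?p (cov_endo M c L x \<xi> \<eta>)" for \<xi> \<eta>
    using M.conn_endo_rep[OF c p L, of "stress_bienergy M N \<phi>"] T sx by simp
  have "divergence M (stress_bienergy M N \<phi>) ?p = chart_vec M c ?p (trace2 (g x) (cov_endo M c L x))"
    unfolding divergence_def
  proof (rule the_frame_value[OF p])
    fix e :: "2 \<Rightarrow> 'a tvec" and a b assume e: "e 1 = chart_vec M c ?p a" "e 2 = chart_vec M c ?p b" and on: "on_pair (g (snd c ?p)) a b"
    show "(\<Sum>i\<in>UNIV. conn_endo M (stress_bienergy M N \<phi>) ?p (e i) (e i)) = chart_vec M c ?p (trace2 (g x) (cov_endo M c L x))"
      unfolding sum_2 e ce M.chart_vec_simps(1)[OF c p, symmetric]
        on_pair_trace[OF g_inner_form[OF x] on[unfolded sx] M.cov_endo_bilinear[OF c x L]] ..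
  qed
  then have "chart_vec M c ?p (trace2 (g x) (cov_endo M c L x)) = chart_vec M c ?p 0"
    using bic[OF p] M.chart_vec_simps(4)[OF c p] by simp
  then have "trace2 (g x) (cov_endo M c L x) = 0" using M.comps_chart_vec[OF c p] by metis
  then have "cov_endo M c L x a a + cov_endo M c L x b b = 0"
    using on_pair_trace[OF g_inner_form[OF x] on M.cov_endo_bilinear[OF c x L]] by simp
  then have "cov_endo M c S x a a + cov_endo M c S x b b = 0"
    unfolding C scaleR_add_right[symmetric] by simp
  then show "(dder (\<lambda>y. S y a) x a + \<Gamma> x a (S x a) - S x (\<Gamma> x a a)) +
      (dder (\<lambda>y. S y b) x b + \<Gamma> x b (S x b) - S x (\<Gamma> x b b)) = 0"
    by (simp add: cov_endo_def)
qed (use open_\<Omega> M.gmet_smooth[OF c] M.christoffel_smooth[OF c] S_smooth g_inner_form M.christoffel_sym[OF c]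
    M.christoffel_metric[OF c] S_sym in auto)

end

subsection \<open>The Gauss equation in isothermal coordinates\<close>

context surface_chart
begin

definition "along U x \<xi> = dder U x \<xi> + \<Gamma>N (F x) (dder F x \<xi>) (U x)"
text \<open>Derivative along \<open>F\<close> of the image of a constant vector. It keeps the
  tangential part that \<open>B\<close> removes, so the metric and curvature identities of the
  target apply to it directly.\<close>

definition "DF x \<xi> \<eta> = dder (\<lambda>y. dder F y \<eta>) x \<xi> + \<Gamma>N (F x) (dder F x \<xi>) (dder F x \<eta>)"

lemma along_dF: "along (\<lambda>y. dder F y \<eta>) x \<xi> = DF x \<xi> \<eta>"
  by (simp add: along_def DF_def)

lemma DF_B: "DF x \<xi> \<eta> = B x \<xi> \<eta> + dder F x (\<Gamma> x \<xi> \<eta>)"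
  by (simp add: B_def DF_def)

lemma F_in: "x \<in> \<Omega> \<Longrightarrow> F x \<in> chart_img d"
  using F_img by auto

lemma along_metric:
  assumes x: "x \<in> \<Omega>" and U: "smooth_on \<Omega> U" and V: "smooth_on \<Omega> V"
  shows "dder (\<lambda>y. gN (F y) (U y) (V y)) x \<xi> = gN (F x) (along U x \<xi>) (V x) + gN (F x) (U x) (along V x \<xi>)"
proof -
  have smv: "smooth_on (chart_img d) (\<lambda>z. gN z u v)" for u v using N.gmet_smooth[OF d] by (simp add: smooth_bil_def)
  have "dder (\<lambda>y. gN (F y) u v) x \<xi> = gN (F x) (\<Gamma>N (F x) (dder F x \<xi>) u) v + gN (F x) u (\<Gamma>N (F x) (dder F x \<xi>) v)" for u v
    using dder_compose(1)[OF smF x smv F_in[OF x]] N.christoffel_metric[OF d F_in[OF x]] by simp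
  then show ?thesis
    using smooth_bil_dder[OF open_\<Omega> smooth_GN(2) U V x, of \<xi>]
    by (simp add: along_def bilinear_simps[OF inner_form_bilinear[OF gN_inner_form[OF x]]])
qed

lemma DF_smooth: "smooth_on \<Omega> (\<lambda>x. DF x \<xi> \<eta>)"
  unfolding DF_def
  by (rule smooth_on_add[OF open_\<Omega> smooth_on_dder[OF smooth_on_dder[OF smF]]
        smooth_bil_apply[OF open_\<Omega> smooth_GN(1) smooth_on_dder[OF smF] smooth_on_dder[OF smF]]])

lemma DF_sym: "x \<in> \<Omega> \<Longrightarrow> DF x \<xi> \<eta> = DF x \<eta> \<xi>"
  unfolding DF_B using B_sym M.christoffel_sym[OF c] by simp

text \<open>The curvature of the pull-back connection is the pulled-back curvature. The third
  derivatives of \<open>F\<close> cancel by symmetry (\<open>c1\<close>), the second ones paired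
  with Christoffel symbols likewise (\<open>c2\<close>).\<close>

lemma along_curvature:
  assumes x: "x \<in> \<Omega>"
  shows "along (\<lambda>y. DF y \<eta> \<zeta>) x \<xi> - along (\<lambda>y. DF y \<xi> \<zeta>) x \<eta> =
    curv N d (F x) (dder F x \<xi>) (dder F x \<eta>) (dder F x \<zeta>)"
proof -
  note GN = bilinear_simps[OF N.christoffel_bilinear[OF d F_in[OF x]]]
  have smv: "smooth_on (chart_img d) (\<lambda>z. \<Gamma>N z u v)" for u v using N.christoffel_smooth[OF d] by (simp add: smooth_bil_def)
  define f where "f \<eta> y = \<Gamma>N (F y) (dder F y \<eta>) (dder F y \<zeta>)" for \<eta> y
  have smf: "smooth_on \<Omega> (f \<eta>)" for \<eta>
    unfolding f_def by (rule smooth_bil_apply[OF open_\<Omega> smooth_GN(1) smooth_on_dder[OF smF] smooth_on_dder[OF smF]])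
  have df: "dder (f \<eta>) x \<xi> = dder (\<lambda>z. \<Gamma>N z (dder F x \<eta>) (dder F x \<zeta>)) (F x) (dder F x \<xi>) +
      \<Gamma>N (F x) (dder (\<lambda>y. dder F y \<eta>) x \<xi>) (dder F x \<zeta>) + \<Gamma>N (F x) (dder F x \<eta>) (dder (\<lambda>y. dder F y \<zeta>) x \<xi>)" for \<xi> \<eta>
    unfolding f_def
    using smooth_bil_dder[OF open_\<Omega> smooth_GN(1) smooth_on_dder[OF smF, of \<eta>] smooth_on_dder[OF smF, of \<zeta>] x, of \<xi>]
      dder_compose(1)[OF smF x smv F_in[OF x]] by simp
  have dD: "dder (\<lambda>y. DF y \<eta> \<zeta>) x \<xi> = dder (\<lambda>y. dder (\<lambda>z. dder F z \<zeta>) y \<eta>) x \<xi> + dder (f \<eta>) x \<xi>" for \<xi> \<eta>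
    unfolding DF_def f_def[symmetric]
    using dder_eqI[OF has_derivative_add[OF smooth_on_has_derivative[OF smooth_on_dder[OF smooth_on_dder[OF smF]] x]
          smooth_on_has_derivative[OF smf x]]] by simp
  have c1: "dder (\<lambda>y. dder (\<lambda>z. dder F z \<zeta>) y \<eta>) x \<xi> = dder (\<lambda>y. dder (\<lambda>z. dder F z \<zeta>) y \<xi>) x \<eta>"
    by (rule dder_dder_commute[OF open_\<Omega> smooth_on_dder[OF smF] x])
  have c2: "dder (\<lambda>y. dder F y \<eta>) x \<xi> = dder (\<lambda>y. dder F y \<xi>) x \<eta>"
    by (rule dder_dder_commute[OF open_\<Omega> smF x])
  show ?thesis
    unfolding along_def dD df curv_def by (simp add: DF_def GN c1 c2 algebra_simps)
qed

text \<open>The pairing \<open>T\<close> is symmetric in its first two arguments and, by isometry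
  and metric compatibility of both connections, antisymmetric in its last two; going round the
  permutations gives \<open>T = - T\<close>.\<close>

lemma B_normal:
  assumes x: "x \<in> \<Omega>" shows "gN (F x) (B x \<xi> \<eta>) (dder F x \<zeta>) = 0"
proof -
  note Nb = bilinear_simps[OF inner_form_bilinear[OF gN_inner_form[OF x]]]
  define T where "T \<xi> \<eta> \<zeta> = gN (F x) (B x \<xi> \<eta>) (dder F x \<zeta>)" for \<xi> \<eta> \<zeta>
  have s: "T \<xi> \<eta> \<zeta> = T \<eta> \<xi> \<zeta>" for \<xi> \<eta> \<zeta> unfolding T_def B_sym[OF x, of \<xi> \<eta>] ..
  have a: "T \<xi> \<eta> \<zeta> = - T \<xi> \<zeta> \<eta>" for \<xi> \<eta> \<zeta>
  proof -
    have "dder (\<lambda>y. gN (F y) (dder F y \<eta>) (dder F y \<zeta>)) x = dder (\<lambda>y. g y \<eta> \<zeta>) x"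
      by (rule dder_cong_open[OF open_\<Omega> x]) (rule isometric_rep)
    then have "gN (F x) (DF x \<xi> \<eta>) (dder F x \<zeta>) + gN (F x) (dder F x \<eta>) (DF x \<xi> \<zeta>) =
        g x (\<Gamma> x \<xi> \<eta>) \<zeta> + g x \<eta> (\<Gamma> x \<xi> \<zeta>)"
      using along_metric[OF x smooth_on_dder[OF smF] smooth_on_dder[OF smF], of \<eta> \<zeta> \<xi>] M.christoffel_metric[OF c x, of \<eta> \<zeta> \<xi>]
      unfolding along_dF by simp
    then show ?thesis
      using inner_form_sym[OF gN_inner_form[OF x], of "dder F x \<eta>" "B x \<xi> \<zeta>"]
      by (simp add: DF_B Nb isometric_rep[OF x] T_def)
  qed
  have "T \<xi> \<eta> \<zeta> = - T \<xi> \<eta> \<zeta>"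
    using a[of \<xi> \<eta> \<zeta>] s[of \<xi> \<zeta> \<eta>] a[of \<zeta> \<xi> \<eta>] s[of \<zeta> \<eta> \<xi>] a[of \<eta> \<zeta> \<xi>] s[of \<eta> \<xi> \<zeta>] by simp
  then show ?thesis by (simp add: T_def)
qed

lemma H_normal:
  assumes x: "x \<in> \<Omega>" shows "gN (F x) (H x) (dder F x \<zeta>) = 0"
  by (simp add: H_def trace2_def bilinear_simps[OF inner_form_bilinear[OF gN_inner_form[OF x]]] B_normal[OF x])

end

text \<open>Three orthogonal vectors of nonzero length form a basis in dimension three. Applied to
  the two coordinate tangent vectors and \<open>H\<close>, it is the place where the codimension one
  enters.\<close>

lemma orthogonal_triple_inner:
  fixes X Y Z :: "real^'n"
  assumes n: "CARD('n) = 3" and g: "inner_form g"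
    and nz: "g X X \<noteq> 0" "g Y Y \<noteq> 0" "g Z Z \<noteq> 0" and orth: "g X Y = 0" "g X Z = 0" "g Y Z = 0"
  shows "g V W = g V X * g W X / g X X + g V Y * g W Y / g Y Y + g V Z * g W Z / g Z Z"
proof -
  note b = bilinear_simps[OF inner_form_bilinear[OF g]]
  have lin: "linear (\<lambda>v. g v w)" for w using inner_form_bilinear[OF g] by (simp add: bilinear_def)
  have orth': "g Y X = 0" "g Z X = 0" "g Z Y = 0" using orth inner_form_sym[OF g] by metis+
  have ne: "X \<noteq> Y" "X \<noteq> Z" "Y \<noteq> Z" using nz orth by auto
  have "independent {X, Y, Z}"
  proof (rule independent_if_scalars_zero)
    fix f v assume s: "(\<Sum>x\<in>{X, Y, Z}. f x *\<^sub>R x) = 0" and v: "v \<in> {X, Y, Z}"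
    have "f X *\<^sub>R X + f Y *\<^sub>R Y + f Z *\<^sub>R Z = 0" using s ne by (simp add: add.assoc)
    then have "g (f X *\<^sub>R X + f Y *\<^sub>R Y + f Z *\<^sub>R Z) w = 0" for w by (simp add: b)
    from this[of X] this[of Y] this[of Z] show "f v = 0"
      using v nz orth orth' by (auto simp: b)
  qed simp
  moreover have "card {X, Y, Z} = dim (UNIV :: (real^'n) set)" using ne n by simp
  ultimately have "span {X, Y, Z} = UNIV" using card_ge_dim_independent[of "{X, Y, Z}" UNIV] by auto
  then have "V \<in> span {X, Y, Z}" by simp
  then obtain r where "V - r *\<^sub>R X \<in> span {Y, Z}" by (auto simp: span_insert[of X])
  then obtain s t where "V - r *\<^sub>R X = s *\<^sub>R Y + t *\<^sub>R Z" unfolding span_pair by blast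
  then have V: "V = r *\<^sub>R X + s *\<^sub>R Y + t *\<^sub>R Z" by (simp add: algebra_simps)
  have "g V X = r * g X X" "g V Y = s * g Y Y" "g V Z = t * g Z Z" by (simp_all add: V b orth orth')
  moreover have "g V W = r * g W X + s * g W Y + t * g W Z"
    using inner_form_sym[OF g, of _ W] by (simp add: V b)
  ultimately show ?thesis using nz by simp
qed

context surface_chart
begin

text \<open>The commutation of derivatives along \<open>F\<close> is applied to the second
  coordinate vector and paired with the first. Inner products of second derivatives split into
  tangential parts, determined by the conformal factor, and parts along \<open>H\<close>, determined
  by the shape operator.\<close>

lemma gauss_isothermal:
  fixes m :: "real^2 \<Rightarrow> real"
  assumes n: "CARD('n) = 3" and m: "smooth_on \<Omega> m" "\<And>x. x \<in> \<Omega> \<Longrightarrow> m x > 0"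
    and met: "\<And>x v w. x \<in> \<Omega> \<Longrightarrow> g x v w = (1 / m x) * (v \<bullet> w)"
    and sh: "\<And>x v w. x \<in> \<Omega> \<Longrightarrow> g x (S x v) w = (k / m x + 1/2) * (v $ 1 * w $ 1) + (k / m x - 1/2) * (v $ 2 * w $ 2)"
    and H: "\<And>x. x \<in> \<Omega> \<Longrightarrow> gN (F x) (H x) (H x) = k" and k: "k > 0"
    and x: "x \<in> \<Omega>"
  shows "m x * (- (dder (\<lambda>y. dder m y e1) x e1 + dder (\<lambda>y. dder m y e2) x e2)) + ((dder m x e1)\<^sup>2 + (dder m x e2)\<^sup>2) +
    2 * m x * (gN (F x) (curv N d (F x) (dder F x e1) (dder F x e2) (dder F x e2)) (dder F x e1) * (m x)\<^sup>2
      + k - (m x)\<^sup>2 / (4 * k)) = 0"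
proof -
  \<comment> \<open>The conformal factor itself; its derivatives are rewritten in terms of those of
    \<open>m\<close> only at the end.\<close>
  define r where "r y = 1 / m y" for y
  have smr: "smooth_on \<Omega> r" unfolding r_def by (rule smooth_on_divide[OF open_\<Omega> smooth_on_const m])
  have dr: "dder r y v = - dder m y v / (m y)\<^sup>2" if y: "y \<in> \<Omega>" for y v
  proof -
    have "((\<lambda>z::real. 1 / z) has_real_derivative - 1 / (m y)\<^sup>2) (at (m y))"
      using m(2)[OF y] by (auto intro!: derivative_eq_intros simp: power2_eq_square)
    from DERIV_compose_FDERIV[OF this smooth_on_has_derivative[OF m(1) y]]
    have "(r has_derivative (\<lambda>v. dder m y v * (- 1 / (m y)\<^sup>2))) (at y)" by (simp add: r_def[abs_def])
    then show ?thesis by (simp add: dder_eqI)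
  qed
  have ddr: "dder (\<lambda>y. dder r y v) x v = - dder (\<lambda>y. dder m y v) x v / (m x)\<^sup>2 + 2 * (dder m x v)\<^sup>2 / (m x)^3" for v
  proof -
    have mx: "m x \<noteq> 0" using m(2)[OF x] by simp
    have "((\<lambda>z::real. - 1 / z\<^sup>2) has_real_derivative 2 / (m x)^3) (at (m x))"
      using mx by (auto intro!: derivative_eq_intros simp: power2_eq_square power3_eq_cube divide_simps)
    note d = DERIV_compose_FDERIV[OF this smooth_on_has_derivative[OF m(1) x]]
    have "((\<lambda>y. dder m y v * (- 1 / (m y)\<^sup>2)) has_derivative
        (\<lambda>w. dder m x v * (dder m x w * (2 / (m x)^3)) + dder (\<lambda>y. dder m y v) x w * (- 1 / (m x)\<^sup>2))) (at x)"
      by (rule has_derivative_mult[OF smooth_on_has_derivative[OF smooth_on_dder[OF m(1)] x] d])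
    moreover have "dder (\<lambda>y. dder r y v) x = dder (\<lambda>y. dder m y v * (- 1 / (m y)\<^sup>2)) x"
      by (rule dder_cong_open[OF open_\<Omega> x]) (simp add: dr)
    ultimately show ?thesis by (simp add: dder_eqI power2_eq_square)
  qed
  let ?X = "\<lambda>y. dder F y e1" and ?Y = "\<lambda>y. dder F y e2"
  let ?g = "gN (F x)"
  note smX = smooth_on_dder[OF smF]
  have ee: "e1 \<bullet> e1 = 1" "e2 \<bullet> e2 = 1" "e1 \<bullet> e2 = 0" "e2 \<bullet> e1 = 0" by (simp_all add: inner_axis_axis)
  have iso: "gN (F y) (dder F y v) (dder F y w) = r y * (v \<bullet> w)" if "y \<in> \<Omega>" for y v w
    using isometric_rep[OF that] met[OF that] by (simp add: r_def)
  have rule: "gN (F y) (DF y u v) (dder F y w) + gN (F y) (dder F y v) (DF y u w) = dder r y u * (v \<bullet> w)"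
    if y: "y \<in> \<Omega>" for y u v w
  proof -
    have "dder (\<lambda>y. gN (F y) (dder F y v) (dder F y w)) y = dder (\<lambda>y. r y * (v \<bullet> w)) y"
      by (rule dder_cong_open[OF open_\<Omega> y]) (rule iso)
    moreover have "dder (\<lambda>y. r y * (v \<bullet> w)) y u = dder r y u * (v \<bullet> w)"
      using dder_eqI[OF has_derivative_mult_left[OF smooth_on_has_derivative[OF smr y]]] by simp
    ultimately show ?thesis using along_metric[OF y smX smX, of v w u] unfolding along_dF by simp
  qed
  have comm: "gN (F y) v w = gN (F y) w v" if "y \<in> \<Omega>" for y v w by (rule inner_form_sym[OF gN_inner_form[OF that]])
  \<comment> \<open>The tangential components of the second derivatives of \<open>F\<close>: the
    Christoffel symbols of the first kind for the metric \<open>r\<close> times the Euclidean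
    one.\<close>
  have D: "gN (F y) (DF y e1 e1) (?X y) = dder r y e1 / 2" "gN (F y) (DF y e1 e2) (?X y) = dder r y e2 / 2"
    "gN (F y) (DF y e1 e2) (?Y y) = dder r y e1 / 2" "gN (F y) (DF y e2 e2) (?Y y) = dder r y e2 / 2"
    "gN (F y) (DF y e1 e1) (?Y y) = - dder r y e2 / 2" "gN (F y) (DF y e2 e2) (?X y) = - dder r y e1 / 2"
    if y: "y \<in> \<Omega>" for y
  proof -
    have s: "DF y e2 e1 = DF y e1 e2" by (rule DF_sym[OF y])
    show 1: "gN (F y) (DF y e1 e1) (?X y) = dder r y e1 / 2"
      using rule[OF y, of e1 e1 e1] comm[OF y, of "?X y" "DF y e1 e1"] by (simp add: ee)
    show 2: "gN (F y) (DF y e1 e2) (?X y) = dder r y e2 / 2"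
      using rule[OF y, of e2 e1 e1] comm[OF y, of "?X y" "DF y e1 e2"] by (simp add: ee s)
    show 3: "gN (F y) (DF y e1 e2) (?Y y) = dder r y e1 / 2"
      using rule[OF y, of e1 e2 e2] comm[OF y, of "?Y y" "DF y e1 e2"] by (simp add: ee)
    show 4: "gN (F y) (DF y e2 e2) (?Y y) = dder r y e2 / 2"
      using rule[OF y, of e2 e2 e2] comm[OF y, of "?Y y" "DF y e2 e2"] by (simp add: ee)
    show "gN (F y) (DF y e1 e1) (?Y y) = - dder r y e2 / 2"
      using rule[OF y, of e1 e1 e2] comm[OF y, of "?X y" "DF y e1 e2"] 2 by (simp add: ee)
    show "gN (F y) (DF y e2 e2) (?X y) = - dder r y e1 / 2"
      using rule[OF y, of e2 e2 e1] comm[OF y, of "?Y y" "DF y e1 e2"] 3 by (simp add: ee s)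
  qed
  have half: "dder (\<lambda>y. a * dder r y v / 2) x v = a * dder (\<lambda>y. dder r y v) x v / 2" for a v
    using dder_eqI[OF has_derivative_mult_right[OF smooth_on_has_derivative[OF smooth_on_dder[OF smr] x], of "a / 2"]] by simp
  \<comment> \<open>Differentiating a component listed in \<open>D\<close> trades the third
    derivative of \<open>F\<close> for second derivatives of \<open>r\<close> and a product of
    second derivatives of \<open>F\<close>.\<close>
  have K1: "?g (along (\<lambda>y. DF y e2 e2) x e1) (?X x) = - dder (\<lambda>y. dder r y e1) x e1 / 2 - ?g (DF x e2 e2) (DF x e1 e1)"
  proof -
    have "dder (\<lambda>y. gN (F y) (DF y e2 e2) (?X y)) x = dder (\<lambda>y. - 1 * dder r y e1 / 2) x"
      by (rule dder_cong_open[OF open_\<Omega> x]) (simp add: D)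
    then show ?thesis
      using along_metric[OF x DF_smooth smX, of e2 e2 e1 e1] half[of "- 1" e1] unfolding along_dF by simp
  qed
  have K2: "?g (along (\<lambda>y. DF y e1 e2) x e2) (?X x) = dder (\<lambda>y. dder r y e2) x e2 / 2 - ?g (DF x e1 e2) (DF x e1 e2)"
  proof -
    have "dder (\<lambda>y. gN (F y) (DF y e1 e2) (?X y)) x = dder (\<lambda>y. 1 * dder r y e2 / 2) x"
      by (rule dder_cong_open[OF open_\<Omega> x]) (simp add: D)
    then show ?thesis
      using along_metric[OF x DF_smooth smX, of e1 e2 e1 e2] half[of 1 e2] DF_sym[OF x, of e2 e1] unfolding along_dF by simp
  qed
  have K: "?g (curv N d (F x) (?X x) (?Y x) (?Y x)) (?X x) =
      - dder (\<lambda>y. dder r y e1) x e1 / 2 - ?g (DF x e2 e2) (DF x e1 e1) - (dder (\<lambda>y. dder r y e2) x e2 / 2 - ?g (DF x e1 e2) (DF x e1 e2))"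
    unfolding along_curvature[OF x, symmetric] bilinear_simps(3)[OF inner_form_bilinear[OF gN_inner_form[OF x]]] K1 K2 ..
  have r: "r x > 0" using m(2)[OF x] by (simp add: r_def)
  have DH: "?g (DF x v w) (H x) = (k / m x + 1/2) * (v $ 1 * w $ 1) + (k / m x - 1/2) * (v $ 2 * w $ 2)" for v w
    unfolding DF_B bilinear_simps(1)[OF inner_form_bilinear[OF gN_inner_form[OF x]]]
    using sh[OF x, of v w] S_eq[OF x, of v w] H_normal[OF x] comm[OF x, of "dder F x (\<Gamma> x v w)" "H x"] by simp
  have XX: "?g (?X x) (?X x) = r x" "?g (?Y x) (?Y x) = r x" "?g (?X x) (?Y x) = 0" by (simp_all add: iso[OF x] ee)
  have inner: "?g V W = ?g V (?X x) * ?g W (?X x) / r x + ?g V (?Y x) * ?g W (?Y x) / r x + ?g V (H x) * ?g W (H x) / k" for V W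
    using orthogonal_triple_inner[OF n gN_inner_form[OF x], of "?X x" "?Y x" "H x" V W] XX r k H[OF x] H_normal[OF x]
      comm[OF x, of "?X x" "H x"] comm[OF x, of "?Y x" "H x"] by simp
  \<comment> \<open>The last summand is the normal part: the two diagonal entries of the shape form
    divided by \<open>k\<close>, the squared length of \<open>H\<close>. In \<open>i2\<close> the
    normal part is absent because the off-diagonal entry is zero.\<close>
  have i1: "?g (DF x e2 e2) (DF x e1 e1) = - ((dder r x e1)\<^sup>2 + (dder r x e2)\<^sup>2) / (4 * r x) + (k / m x - 1/2) * (k / m x + 1/2) / k"
    unfolding inner[of "DF x e2 e2" "DF x e1 e1"] DH D[OF x] axis2_nth using r
    by (simp add: power2_eq_square field_simps)
  have i2: "?g (DF x e1 e2) (DF x e1 e2) = ((dder r x e1)\<^sup>2 + (dder r x e2)\<^sup>2) / (4 * r x)"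
    unfolding inner[of "DF x e1 e2" "DF x e1 e2"] DH D[OF x] axis2_nth using r
    by (simp add: power2_eq_square field_simps)
  have mx: "m x > 0" by (rule m(2)[OF x])
  define \<mu> a b p q where "\<mu> = m x" and "a = dder m x e1" and "b = dder m x e2"
    and "p = dder (\<lambda>y. dder m y e1) x e1" and "q = dder (\<lambda>y. dder m y e2) x e2"
  have K': "?g (curv N d (F x) (?X x) (?Y x) (?Y x)) (?X x) =
      (p + q) / (2 * \<mu>\<^sup>2) - (a\<^sup>2 + b\<^sup>2) / (2 * \<mu>^3) - (k\<^sup>2 / \<mu>\<^sup>2 - 1/4) / k"
    unfolding K i1 i2 ddr dr[OF x] using mx k
    by (simp add: r_def \<mu>_def[symmetric] a_def[symmetric] b_def[symmetric] p_def[symmetric] q_def[symmetric])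
      (simp add: divide_simps power2_eq_square power3_eq_cube, algebra)
  show ?thesis
    unfolding K' \<mu>_def[symmetric] a_def[symmetric] b_def[symmetric] p_def[symmetric] q_def[symmetric]
    using mx k unfolding \<mu>_def[symmetric]
    by (simp add: divide_simps power2_eq_square power3_eq_cube) algebra
qed

end

subsection \<open>Charts adapted to the shape operator\<close>

text \<open>Here \<open>k\<close> stands for the squared mean curvature and \<open>m\<close> for a
  conformal factor in coordinates; that \<open>m\<close> is the difference of the principal
  curvatures is derived, in \<open>principal_difference\<close>.\<close>

locale adapted_surface_chart = surface_chart M N \<phi> c d
  for M :: "('a, 2) riem" and N :: "('b, 'n::finite) riem" and \<phi> c d +
  fixes m :: "real^2 \<Rightarrow> real" and k :: real
  assumes smooth_m: "smooth_on \<Omega> m" and m_pos: "x \<in> \<Omega> \<Longrightarrow> m x > 0"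
    and met: "x \<in> \<Omega> \<Longrightarrow> g x v w = (1 / m x) * (v \<bullet> w)"
    and sh: "x \<in> \<Omega> \<Longrightarrow> g x (S x v) w = (k / m x + 1/2) * (v $ 1 * w $ 1) + (k / m x - 1/2) * (v $ 2 * w $ 2)"
    and cmc: "q \<in> fst c \<Longrightarrow> (mean_curvature M N \<phi> q)\<^sup>2 = k" and k_pos: "k > 0"
begin

lemma S_formula:
  assumes x: "x \<in> \<Omega>"
  shows "S x v = ((k + m x / 2) * v $ 1) *\<^sub>R e1 + ((k - m x / 2) * v $ 2) *\<^sub>R e2"
proof (rule inner_form_eqI[OF g_inner_form[OF x]])
  fix w
  show "g x (S x v) w = g x (((k + m x / 2) * v $ 1) *\<^sub>R e1 + ((k - m x / 2) * v $ 2) *\<^sub>R e2) w"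
    unfolding sh[OF x] unfolding met[OF x] using m_pos[OF x]
    by (simp add: inner_vec_def sum_2 axis2_nth field_simps)
qed

context
  fixes q assumes q: "q \<in> fst c"
begin

lemma coords_in: "snd c q \<in> \<Omega>" "chart_inv c (snd c q) = q"
  using q c by auto

lemma flat_metric_comps: "flat_metric c u v = comps c u \<bullet> comps c v"
  by (simp add: flat_metric_def coord_diff_comps inner_vec_def sum_2)

lemma shape_formula:
  assumes "u \<in> tangent_space M q"
  shows "shape_H M N \<phi> q u = chart_vec M c q (((k + m (snd c q) / 2) * comps c u $ 1) *\<^sub>R e1 +
    ((k - m (snd c q) / 2) * comps c u $ 2) *\<^sub>R e2)"
  using shape_H_rep[OF q, of "comps c u"] M.chart_vec_comps[OF c q assms] S_formula[OF coords_in(1)] by simp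

lemma metric_formula:
  assumes "u \<in> tangent_space M q" "v \<in> tangent_space M q"
  shows "metric M q u v = 1 / m (snd c q) * flat_metric c u v"
  using M.metric_gmet[OF c q, of "comps c u" "comps c v"] M.chart_vec_comps[OF c q] assms met[OF coords_in(1)]
  by (simp add: flat_metric_comps)

lemma shape_metric_formula:
  assumes "u \<in> tangent_space M q" "v \<in> tangent_space M q"
  shows "metric M q (shape_H M N \<phi> q u) v = (k / m (snd c q) + 1/2) * (coord_diff c 1 u * coord_diff c 1 v) +
    (k / m (snd c q) - 1/2) * (coord_diff c 2 u * coord_diff c 2 v)"
  using shape_H_rep[OF q, of "comps c u"] M.metric_gmet[OF c q, of "S (snd c q) (comps c u)" "comps c v"]
    M.chart_vec_comps[OF c q] assms sh[OF coords_in(1), of "comps c u" "comps c v"]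
  by (simp add: coord_diff_comps)

lemma shape_coord_field:
  "shape_H M N \<phi> q (coord_field M c 1 q) = (k + m (snd c q) / 2) *\<^sub>R coord_field M c 1 q"
  "shape_H M N \<phi> q (coord_field M c 2 q) = (k - m (snd c q) / 2) *\<^sub>R coord_field M c 2 q"
proof -
  have e: "coord_field M c i q = chart_vec M c q (axis i 1)" for i by (simp add: coord_field_def)
  show "shape_H M N \<phi> q (coord_field M c 1 q) = (k + m (snd c q) / 2) *\<^sub>R coord_field M c 1 q"
    "shape_H M N \<phi> q (coord_field M c 2 q) = (k - m (snd c q) / 2) *\<^sub>R coord_field M c 2 q"
    unfolding e shape_H_rep[OF q] M.chart_vec_simps(3)[OF c q, symmetric] S_formula[OF coords_in(1)] axis2_nth by simp_all
qed

lemma coord_field_nonzero: "coord_field M c i q \<in> tangent_space M q" "coord_field M c i q \<noteq> 0"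
proof -
  show "coord_field M c i q \<in> tangent_space M q"
    unfolding coord_field_def by (rule M.chart_vec_tangent[OF c q])
  show "coord_field M c i q \<noteq> 0"
  proof
    assume "coord_field M c i q = 0"
    then have "comps c (chart_vec M c q (axis i 1)) = comps c (chart_vec M c q 0)"
      unfolding coord_field_def M.chart_vec_simps(4)[OF c q] by simp
    then show False using c q by (simp add: axis_eq_0_iff)
  qed
qed

text \<open>\<open>lambda1\<close> and \<open>lambda2\<close> are the maximum and minimum of the set
  of all eigenvalues, so besides exhibiting two eigenvectors any further eigenvalue has to be
  excluded.\<close>

lemma principal_curvatures_eq:
  "principal_curvatures M N \<phi> q = {k + m (snd c q) / 2, k - m (snd c q) / 2}"
proof (intro set_eqI iffI)
  fix l assume "l \<in> principal_curvatures M N \<phi> q"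
  then obtain u where u: "u \<in> tangent_space M q" "u \<noteq> 0" "shape_H M N \<phi> q u = l *\<^sub>R u"
    by (auto simp: principal_curvatures_def eigenvector_on_def)
  define v where "v = comps c u"
  have uv: "u = chart_vec M c q v" using M.chart_vec_comps[OF c q u(1)] by (simp add: v_def)
  have "v \<noteq> 0" using u(2) M.chart_vec_simps(4)[OF c q] uv by auto
  have "comps c (shape_H M N \<phi> q u) = comps c (l *\<^sub>R u)" using u(3) by simp
  then have "S (snd c q) v = l *\<^sub>R v"
    unfolding uv shape_H_rep[OF q] M.chart_vec_simps(3)[OF c q, symmetric] M.comps_chart_vec[OF c q] .
  then have "(k + m (snd c q) / 2) * v $ 1 = l * v $ 1" "(k - m (snd c q) / 2) * v $ 2 = l * v $ 2"
    unfolding S_formula[OF coords_in(1)] by (simp_all add: vec_eq_iff forall_2 axis2_nth)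
  moreover have "v $ 1 \<noteq> 0 \<or> v $ 2 \<noteq> 0" using \<open>v \<noteq> 0\<close> by (auto simp: vec_eq_iff forall_2)
  ultimately show "l \<in> {k + m (snd c q) / 2, k - m (snd c q) / 2}" by auto
next
  fix l assume "l \<in> {k + m (snd c q) / 2, k - m (snd c q) / 2}"
  then show "l \<in> principal_curvatures M N \<phi> q"
    using shape_coord_field coord_field_nonzero unfolding principal_curvatures_def eigenvector_on_def by blast
qed

lemma principal_difference: "lambda1 M N \<phi> q - lambda2 M N \<phi> q = m (snd c q)"
  unfolding lambda1_def lambda2_def principal_curvatures_eq using m_pos[OF coords_in(1)] by simp

end

abbreviation "\<mu> \<equiv> (\<lambda>q. lambda1 M N \<phi> q - lambda2 M N \<phi> q)"

text \<open>Agreement with a smooth function over the chart suffices, whatever \<open>f\<close> does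
  elsewhere. This permits the nested application in \<open>laplacian0\<close>, where the inner
  derivative is known only over the chart.\<close>

lemma coord_field_apply:
  assumes q: "q \<in> fst c" and sm: "smooth_on \<Omega> f'" and eq: "\<And>y. y \<in> \<Omega> \<Longrightarrow> f (chart_inv c y) = f' y"
  shows "coord_field M c i q f = dder f' (snd c q) (axis i 1)"
proof -
  note xq = coords_in[OF q]
  have "smooth_near M q f"
    unfolding M.smooth_near_iff[OF c q]
    using smooth_at_cong[OF open_\<Omega> xq(1), of "\<lambda>y. f (chart_inv c y)" f'] eq smooth_atI[OF open_\<Omega> xq(1) sm] by simp
  moreover have "dder (\<lambda>y. f (chart_inv c y)) (snd c q) = dder f' (snd c q)"
    by (rule dder_cong_open[OF open_\<Omega> xq(1)]) (rule eq)
  ultimately show ?thesis by (simp add: coord_field_def M.chart_vec_apply[OF c q])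
qed

lemma mu_rep: "y \<in> \<Omega> \<Longrightarrow> \<mu> (chart_inv c y) = m y"
  using principal_difference[of "chart_inv c y"] c by simp

lemma coord_field_mu: "q \<in> fst c \<Longrightarrow> coord_field M c i q \<mu> = dder m (snd c q) (axis i 1)"
  by (rule coord_field_apply[OF _ smooth_m mu_rep])

lemma laplacian_mu:
  assumes q: "q \<in> fst c"
  shows "laplacian0 M c \<mu> q = - (dder (\<lambda>y. dder m y e1) (snd c q) e1 + dder (\<lambda>y. dder m y e2) (snd c q) e2)"
proof -
  have "coord_field M c i q (\<lambda>r. coord_field M c i r \<mu>) = dder (\<lambda>y. dder m y (axis i 1)) (snd c q) (axis i 1)" for i
    by (rule coord_field_apply[OF q smooth_on_dder[OF smooth_m]]) (use coord_field_mu c in simp)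
  then show ?thesis by (simp add: laplacian0_def sum_2)
qed

lemma grad_mu:
  assumes q: "q \<in> fst c"
  shows "(norm (grad0 M c \<mu> q))\<^sup>2 = (dder m (snd c q) e1)\<^sup>2 + (dder m (snd c q) e2)\<^sup>2"
  unfolding power2_norm_eq_inner
  by (simp add: grad0_def inner_vec_def sum_2 coord_field_mu[OF q] power2_eq_square)

text \<open>The images of the coordinate vectors are orthogonal with squared length
  \<open>1 / m y\<close>; the reciprocal of their Gram determinant is the factor
  \<open>(m y)^2\<close>.\<close>

lemma sectional_formula:
  assumes q: "q \<in> fst c"
  defines "y \<equiv> snd c q"
  shows "sectional_curvature N (\<phi> q) (differential M N \<phi> q ` tangent_space M q) =
    gN (F y) (curv N d (F y) (dder F y e1) (dder F y e2) (dder F y e2)) (dder F y e1) * (m y)\<^sup>2"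
proof -
  have y: "y \<in> \<Omega>" and inv: "chart_inv d (F y) = \<phi> q" using coords_in[OF q] inv_F[OF coords_in(1)[OF q]] by (simp_all add: y_def)
  have m: "m y > 0" by (rule m_pos[OF y])
  note dF = linear_add[OF linear_dF[OF y]] linear_cmul[OF linear_dF[OF y]]
  have G: "gN (F y) (dder F y v) (dder F y w) = (1 / m y) * (v \<bullet> w)" for v w
    using isometric_rep[OF y] met[OF y] by simp
  have comb: "a *\<^sub>R dder F y e1 + b *\<^sub>R dder F y e2 = dder F y (a *\<^sub>R e1 + b *\<^sub>R e2)" for a b
    by (simp add: dF)
  have ind: "a = 0 \<and> b = 0" if z: "a *\<^sub>R dder F y e1 + b *\<^sub>R dder F y e2 = 0" for a b
  proof -
    have "(1 / m y) * ((a *\<^sub>R e1 + b *\<^sub>R e2) \<bullet> (a *\<^sub>R e1 + b *\<^sub>R e2)) = 0"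
      using G[of "a *\<^sub>R e1 + b *\<^sub>R e2" "a *\<^sub>R e1 + b *\<^sub>R e2"] z bilinear_simps(7)[OF inner_form_bilinear[OF gN_inner_form[OF y]]]
      unfolding comb by simp
    then have "a *\<^sub>R e1 + b *\<^sub>R e2 = 0" using m by simp
    then show ?thesis by (simp add: vec_eq_iff forall_2 axis2_nth)
  qed
  have P: "differential M N \<phi> q ` tangent_space M q =
      {chart_vec N d (chart_inv d (F y)) (a *\<^sub>R dder F y e1 + b *\<^sub>R dder F y e2) | a b. True}"
  proof -
    have "differential M N \<phi> q ` tangent_space M q = range (\<lambda>v. chart_vec N d (\<phi> q) (dder F y v))"
      unfolding M.tangent_space_eq[OF c q] image_image differential_rep[OF q] y_def ..
    also have "\<dots> = {chart_vec N d (\<phi> q) (dder F y (a *\<^sub>R e1 + b *\<^sub>R e2)) | a b. True}"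
    proof (intro set_eqI iffI)
      fix t assume "t \<in> range (\<lambda>v. chart_vec N d (\<phi> q) (dder F y v))"
      then obtain v where "t = chart_vec N d (\<phi> q) (dder F y v)" by blast
      then have "t = chart_vec N d (\<phi> q) (dder F y ((v $ 1) *\<^sub>R e1 + (v $ 2) *\<^sub>R e2))"
        unfolding vec2_expand[of v, symmetric] .
      then show "t \<in> {chart_vec N d (\<phi> q) (dder F y (a *\<^sub>R e1 + b *\<^sub>R e2)) | a b. True}" by blast
    qed blast
    finally show ?thesis unfolding comb inv .
  qed
  have "sectional_curvature N (\<phi> q) (differential M N \<phi> q ` tangent_space M q) =
      gN (F y) (curv N d (F y) (dder F y e1) (dder F y e2) (dder F y e2)) (dder F y e1) /
      (gN (F y) (dder F y e1) (dder F y e1) * gN (F y) (dder F y e2) (dder F y e2) - (gN (F y) (dder F y e1) (dder F y e2))\<^sup>2)"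
    using N.sectional_curvature_eq[OF d F_in[OF y] ind P] unfolding inv .
  then show ?thesis
    unfolding G using m by (simp add: inner_axis_axis power2_eq_square)
qed

lemma gauss_equation:
  assumes n: "CARD('n) = 3" and q: "q \<in> fst c"
  shows "\<mu> q * laplacian0 M c \<mu> q + (norm (grad0 M c \<mu> q))\<^sup>2 +
    2 * \<mu> q * (sectional_curvature N (\<phi> q) (differential M N \<phi> q ` tangent_space M q) + k - (\<mu> q)\<^sup>2 / (4 * k)) = 0"
proof -
  have H: "gN (F y) (H y) (H y) = k" if "y \<in> \<Omega>" for y
    using mean_curvature_sq[of "chart_inv c y"] cmc[of "chart_inv c y"] that c by simp
  show ?thesis
    unfolding laplacian_mu[OF q] grad_mu[OF q] sectional_formula[OF q] principal_difference[OF q]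
    by (rule gauss_isothermal[OF n smooth_m m_pos met sh H k_pos coords_in(1)[OF q]])
qed

end

section \<open>The adapted chart around a point that is not pseudoumbilical\<close>

theorem theorem4p14:
  fixes M :: "('a, 2) riem" and N :: "('b, 'n::finite) riem" and \<phi> :: "'a \<Rightarrow> 'b"
    and \<mu> :: "'a \<Rightarrow> real" and h :: "'a \<Rightarrow> real" and A :: "'a \<Rightarrow> 'a tvec \<Rightarrow> 'a tvec" and p :: 'a
  assumes "surface M N \<phi>"
    and "CMC M N \<phi>"
    and "biconservative M N \<phi>"
    and mu_def: "\<mu> = (\<lambda>q. lambda1 M N \<phi> q - lambda2 M N \<phi> q)"
    and h_def: "h = mean_curvature M N \<phi>"
    and A_def: "A = shape_H M N \<phi>"
    and "p \<in> points M"
    and "\<not> pseudoumbilical_at M N \<phi> p"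
  shows "\<exists>c\<in>charts M. p \<in> fst c \<and> isothermal M c \<and> line_of_curvature_chart M N \<phi> c \<and>
    (\<forall>q\<in>fst c. \<forall>u\<in>tangent_space M q. \<forall>v\<in>tangent_space M q.
       metric M q u v = 1 / \<mu> q * flat_metric c u v) \<and>
    (\<forall>q\<in>fst c. \<forall>u\<in>tangent_space M q. \<forall>v\<in>tangent_space M q.
       metric M q (A q u) v =
         ((h q)\<^sup>2 / \<mu> q + 1/2) * (coord_diff c 1 u * coord_diff c 1 v) +
         ((h q)\<^sup>2 / \<mu> q - 1/2) * (coord_diff c 2 u * coord_diff c 2 v)) \<and>
    (\<forall>q\<in>fst c. \<forall>u\<in>tangent_space M q.
       A q u =
         ((h q)\<^sup>2 + \<mu> q / 2) *\<^sub>R (coord_diff c 1 u *\<^sub>R coord_field M c 1 q) +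
         ((h q)\<^sup>2 - \<mu> q / 2) *\<^sub>R (coord_diff c 2 u *\<^sub>R coord_field M c 2 q)) \<and>
    (CARD('n) = 3 \<longrightarrow> (\<forall>q\<in>fst c.
       \<mu> q * laplacian0 M c \<mu> q + (norm (grad0 M c \<mu> q))\<^sup>2 +
       2 * \<mu> q * (sectional_curvature N (\<phi> q) (differential M N \<phi> q ` tangent_space M q)
                    + (h q)\<^sup>2 - (\<mu> q)\<^sup>2 / (4 * (h q)\<^sup>2)) = 0))"
proof -
  have riem: "riemannian_manifold M" "riemannian_manifold N" and imm: "isometric_immersion M N \<phi>"
    using assms(1) by (auto simp: surface_def)
  interpret M: riem_mfd M
    using riem(1) by unfold_locales (auto simp: riemannian_manifold_def)
  interpret N: riem_mfd N
    using riem(2) by unfold_locales (auto simp: riemannian_manifold_def)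
  have "smooth_map M N \<phi>" using imm unfolding isometric_immersion_def by (rule conjunct1)
  then obtain c d where c: "c \<in> charts M" "p \<in> fst c" and d: "d \<in> charts N" and maps: "\<phi> ` fst c \<subseteq> fst d"
    and smF: "smooth_on (chart_img c) (snd d \<circ> \<phi> \<circ> chart_inv c)"
    using assms(7) unfolding smooth_map_def by blast
  have iso: "metric N (\<phi> q) (differential M N \<phi> q u) (differential M N \<phi> q v) = metric M q u v"
    if "q \<in> points M" "u \<in> tangent_space M q" "v \<in> tangent_space M q" for q u v
    using imm that unfolding isometric_immersion_def by blast
  interpret C: surface_chart M N \<phi> c d
    by unfold_locales (use c d maps smF iso M.chart_points[OF c(1)] in \<open>auto simp: o_def\<close>)
  obtain h0 where h0: "mean_curvature M N \<phi> q = h0" if "q \<in> points M" for q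
    using assms(2) by (auto simp: CMC_def constant_on_def)
  define k where "k = h0\<^sup>2"
  have cmc: "(mean_curvature M N \<phi> q)\<^sup>2 = k" if "q \<in> points M" for q using h0[OF that] by (simp add: k_def)
  interpret Z: codazzi_data "chart_img c" "gmet M c" "christoffel M c" C.S k
    by (rule C.codazzi) (use cmc assms(3) M.chart_points[OF c(1)] in \<open>auto simp: biconservative_def\<close>)
  define x0 where "x0 = snd c p"
  have x0: "x0 \<in> chart_img c" using c by (auto simp: x0_def)
  obtain v0 where v0: "C.S x0 v0 \<noteq> k *\<^sub>R v0"
  proof -
    obtain u where u: "u \<in> tangent_space M p" "shape_H M N \<phi> p u \<noteq> k *\<^sub>R u"
      using assms(8) cmc[OF assms(7)] by (auto simp: pseudoumbilical_at_def)
    have "shape_H M N \<phi> p u = chart_vec M c p (C.S x0 (comps c u))" "k *\<^sub>R u = chart_vec M c p (k *\<^sub>R comps c u)"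
      using C.shape_H_rep[OF c(2), of "comps c u"] M.chart_vec_comps[OF c u(1)] M.chart_vec_simps(3)[OF c]
      by (simp_all add: x0_def)
    then show ?thesis using u(2) that by metis
  qed
  \<comment> \<open>As \<open>k\<close> is one constant for the whole surface, nonvanishing of
    \<open>H\<close> at the single point \<open>p\<close> is enough to divide by \<open>k\<close>
    everywhere.\<close>
  have k: "k > 0"
  proof (rule ccontr)
    assume "\<not> k > 0"
    then have k0: "k = 0" by (simp add: k_def)
    then have "C.H x0 = 0"
      using C.mean_curvature_sq[OF c(2)] cmc[OF assms(7)] inner_form_pos[OF C.gN_inner_form[OF x0], of "C.H x0"]
      by (fastforce simp: x0_def)
    then have "gmet M c x0 (C.S x0 v0) w = gmet M c x0 0 w" for w
      using bilinear_simps(7,8)[OF inner_form_bilinear[OF C.gN_inner_form[OF x0]]]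
        bilinear_simps(7)[OF inner_form_bilinear[OF C.g_inner_form[OF x0]]] by (simp add: C.S_eq[OF x0])
    then have "C.S x0 v0 = 0" by (rule inner_form_eqI[OF C.g_inner_form[OF x0]])
    then show False using v0 k0 by simp
  qed
  obtain W and \<psi> :: "real^2 \<Rightarrow> real^2" and n where W: "open W" "x0 \<in> W" "W \<subseteq> chart_img c"
    and \<psi>: "smooth_on W \<psi>" "inj_on \<psi> W" "open (\<psi> ` W)" "smooth_on (\<psi> ` W) (inv_into W \<psi>)" and n: "smooth_on W n"
    and form: "\<forall>x\<in>W. n x > 0 \<and> (\<forall>v w. gmet M c x v w = (1 / n x) * (dder \<psi> x v \<bullet> dder \<psi> x w) \<and>
       gmet M c x (C.S x v) w = (k / n x + 1/2) * (dder \<psi> x v $ 1 * dder \<psi> x w $ 1) +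
         (k / n x - 1/2) * (dder \<psi> x v $ 2 * dder \<psi> x w $ 2))"
    using Z.adapted_coordinates[OF x0 v0] by (elim exE conjE) (rule that)
  define c' where "c' = chart_through c \<psi> W"
  note ct = M.chart_through[OF c(1) W(1,3) \<psi>, folded c'_def]
  have c': "c' \<in> charts M" "chart_img c' = \<psi> ` W" by (rule ct(1), rule ct(2))
  have fst_c': "fst c' = {q \<in> fst c. snd c q \<in> W}" and snd_c': "snd c' q = \<psi> (snd c q)" for q
    by (simp_all add: c'_def chart_through_def)
  have sub: "q \<in> fst c" "snd c q \<in> W" if "q \<in> fst c'" for q using that by (auto simp: fst_c')
  have pc': "p \<in> fst c'" using c(2) W(2) by (simp add: fst_c' x0_def)
  have smF': "smooth_on (\<psi> ` W) (\<lambda>z. snd d (\<phi> (chart_inv c' z)))"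
  proof -
    have "smooth_on (\<psi> ` W) (\<lambda>z. C.F (inv_into W \<psi> z))"
      by (rule smooth_on_compose[OF \<psi>(3) W(1) _ \<psi>(4) smooth_on_mono[OF C.smF W(3)]]) (auto simp: \<psi>(2))
    moreover have "snd d (\<phi> (chart_inv c' z)) = C.F (inv_into W \<psi> z)" if "z \<in> \<psi> ` W" for z
      using ct(3)[OF that] by (simp add: C.F_def)
    ultimately show ?thesis
      using smooth_on_cong[OF \<psi>(3), of "\<lambda>z. snd d (\<phi> (chart_inv c' z))" "\<lambda>z. C.F (inv_into W \<psi> z)"] by simp
  qed
  interpret C': surface_chart M N \<phi> c' d
    by unfold_locales (use c' d maps smF' iso M.chart_points[OF c'(1)] sub(1) in \<open>auto\<close>)
  \<comment> \<open>The conformal factor found in the old coordinates, transported to the new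
    ones.\<close>
  define m where "m z = n (inv_into W \<psi> z)" for z
  \<comment> \<open>The Jacobian of the change of chart is the derivative of \<open>\<psi>\<close>;
    hence the expressions in \<open>form\<close> are already the metric and shape form in the new
    coordinates.\<close>
  have comps': "comps c' (chart_vec M c q v) = dder \<psi> (snd c q) v" if q: "q \<in> fst c'" for q v
  proof -
    have "dder (\<lambda>x. snd c' (chart_inv c x)) (snd c q) = dder \<psi> (snd c q)"
      by (rule dder_cong_open[OF W(1) sub(2)[OF q]]) (use W(3) c(1) in \<open>auto simp: snd_c'\<close>)
    then show ?thesis using M.comps_chart_vec_change[OF c(1) sub(1)[OF q] c'(1) q] by simp
  qed
  have point: "\<exists>q. q \<in> fst c' \<and> snd c' q = z \<and> chart_inv c' z = q \<and> inv_into W \<psi> z = snd c q" if z: "z \<in> chart_img c'" for z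
  proof -
    obtain q where q: "q \<in> fst c'" "z = snd c' q" using z by blast
    have "chart_inv c' z = q" unfolding q(2) by (rule M.chart_inv(1)[OF c'(1) q(1)])
    moreover have "inv_into W \<psi> z = snd c q"
      unfolding q(2) snd_c' by (rule inv_into_f_f[OF \<psi>(2) sub(2)[OF q(1)]])
    ultimately show ?thesis by (intro exI[of _ q] conjI q(1) q(2)[symmetric])
  qed
  \<comment> \<open>Every new component vector is the image of an old one: the same tangent vector
    is read in both charts.\<close>
  have vec: "\<exists>v. chart_vec M c' q w = chart_vec M c q v \<and> w = dder \<psi> (snd c q) v" if q: "q \<in> fst c'" for q w
  proof -
    define v where "v = comps c (chart_vec M c' q w)"
    have eq: "chart_vec M c q v = chart_vec M c' q w"
      unfolding v_def by (rule M.chart_vec_comps[OF c(1) sub(1)[OF q] M.chart_vec_tangent[OF c'(1) q]])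
    have "w = comps c' (chart_vec M c q v)" unfolding eq using M.comps_chart_vec[OF c'(1) q] by simp
    then show ?thesis unfolding comps'[OF q] using eq by metis
  qed
  interpret A: adapted_surface_chart M N \<phi> c' d m k
  proof unfold_locales
    show "smooth_on (chart_img c') m"
      unfolding c'(2) m_def by (rule smooth_on_compose[OF \<psi>(3) W(1) _ \<psi>(4) n]) (auto simp: \<psi>(2))
    fix z assume z: "z \<in> chart_img c'"
    obtain q where q: "q \<in> fst c'" "snd c' q = z" "chart_inv c' z = q" "inv_into W \<psi> z = snd c q" using point[OF z] by blast
    show "m z > 0" using form sub(2)[OF q(1)] q(4) by (simp add: m_def)
    fix v w
    obtain v' where v': "chart_vec M c' q v = chart_vec M c q v'" "v = dder \<psi> (snd c q) v'" using vec[OF q(1)] by blast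
    obtain w' where w': "chart_vec M c' q w = chart_vec M c q w'" "w = dder \<psi> (snd c q) w'" using vec[OF q(1)] by blast
    have "gmet M c' z v w = gmet M c (snd c q) v' w'"
      unfolding gmet_def q(3) v'(1) w'(1) using c(1) sub(1)[OF q(1)] by simp
    then show "gmet M c' z v w = (1 / m z) * (v \<bullet> w)"
      using form sub(2)[OF q(1)] v'(2) w'(2) q(4) by (simp add: m_def)
    have "gmet M c' z (C'.S z v) w = metric M q (shape_H M N \<phi> q (chart_vec M c' q v)) (chart_vec M c' q w)"
      using C'.shape_H_rep[OF q(1), of v] M.metric_gmet[OF c'(1) q(1)] q(2) by simp
    also have "\<dots> = gmet M c (snd c q) (C.S (snd c q) v') w'"
      unfolding v'(1) w'(1) C.shape_H_rep[OF sub(1)[OF q(1)]] by (rule M.metric_gmet[OF c(1) sub(1)[OF q(1)]])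
    also have "\<dots> = (k / n (snd c q) + 1/2) * (dder \<psi> (snd c q) v' $ 1 * dder \<psi> (snd c q) w' $ 1) +
         (k / n (snd c q) - 1/2) * (dder \<psi> (snd c q) v' $ 2 * dder \<psi> (snd c q) w' $ 2)"
      using form sub(2)[OF q(1)] by blast
    finally show "gmet M c' z (C'.S z v) w = (k / m z + 1/2) * (v $ 1 * w $ 1) + (k / m z - 1/2) * (v $ 2 * w $ 2)"
      unfolding m_def q(4) v'(2) w'(2) .
  next
    show "(mean_curvature M N \<phi> q)\<^sup>2 = k" if "q \<in> fst c'" for q
      by (rule cmc[OF M.chart_points[OF c'(1) that]])
  qed (rule k)
  have hq: "(h q)\<^sup>2 = k" and mq: "\<mu> q = m (snd c' q)" if "q \<in> fst c'" for q
    using A.cmc[OF that] A.principal_difference[OF that] by (simp_all add: h_def mu_def)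
  have mpos: "m (snd c' q) > 0" if "q \<in> fst c'" for q using A.m_pos that by simp
  have 1: "metric M q u v = 1 / \<mu> q * flat_metric c' u v"
    if "q \<in> fst c'" "u \<in> tangent_space M q" "v \<in> tangent_space M q" for q u v
    unfolding mq[OF that(1)] by (rule A.metric_formula[OF that])
  have 2: "isothermal M c'"
    unfolding isothermal_def by (rule exI[of _ "\<lambda>q. 1 / \<mu> q"]) (use 1 mq mpos in simp)
  have 3: "line_of_curvature_chart M N \<phi> c'"
    unfolding line_of_curvature_chart_def eigenvector_on_def forall_2
    using A.shape_coord_field A.coord_field_nonzero by blast
  have 4: "metric M q (A q u) v = ((h q)\<^sup>2 / \<mu> q + 1/2) * (coord_diff c' 1 u * coord_diff c' 1 v) +
         ((h q)\<^sup>2 / \<mu> q - 1/2) * (coord_diff c' 2 u * coord_diff c' 2 v)"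
    if "q \<in> fst c'" "u \<in> tangent_space M q" "v \<in> tangent_space M q" for q u v
    unfolding mq[OF that(1)] hq[OF that(1)] A_def by (rule A.shape_metric_formula[OF that])
  have 5: "A q u = ((h q)\<^sup>2 + \<mu> q / 2) *\<^sub>R (coord_diff c' 1 u *\<^sub>R coord_field M c' 1 q) +
         ((h q)\<^sup>2 - \<mu> q / 2) *\<^sub>R (coord_diff c' 2 u *\<^sub>R coord_field M c' 2 q)"
    if "q \<in> fst c'" "u \<in> tangent_space M q" for q u
    unfolding mq[OF that(1)] hq[OF that(1)] A_def A.shape_formula[OF that] coord_diff_comps coord_field_def
    by (simp only: M.chart_vec_simps(1,3)[OF c'(1) that(1)] scaleR_scaleR)
  have 6: "\<mu> q * laplacian0 M c' \<mu> q + (norm (grad0 M c' \<mu> q))\<^sup>2 +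
       2 * \<mu> q * (sectional_curvature N (\<phi> q) (differential M N \<phi> q ` tangent_space M q)
                    + (h q)\<^sup>2 - (\<mu> q)\<^sup>2 / (4 * (h q)\<^sup>2)) = 0"
    if "CARD('n) = 3" "q \<in> fst c'" for q
    unfolding hq[OF that(2)] mu_def by (rule A.gauss_equation[OF that])
  show ?thesis
    by (intro bexI[of _ c'] conjI ballI impI) (rule pc' 2 3 c'(1) | erule (2) 1 4 | erule (1) 5 6)+
qed

end
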